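(* Suppose $\alpha>-1$ and $\varphi\in H^\infty_1$, i.e. $\varphi$ is an analytic function on the unit disk $\mathbb{D}$ with $\sup_{z\in\mathbb{D}}|\varphi(z)|\le1$. Then the following conditions are equivalent. (a) The defect operator $D^\alpha_\varphi=(I-T_\varphi T_\varphi^* )^{1/2}$ is compact on $A^2_\alpha$. (b) The function $\varphi$ is a finite Blaschke product. (c) The space $H^\alpha(\varphi)$ equals $A^2_{\alpha-1}$. (d) The space $H^\alpha(\varphi)$ is contained in $A^2_{\alpha-1}$.
   Context: For any real $\gamma$, $A^2_\gamma$ denotes the space of analytic functions $f$ on $\mathbb{D}$ such that $\int_{\mathbb{D}}(1-|z|^2)^{2k+\gamma}|f^{(k)}(z)|^2\,dA(z)<\infty$, where $k$ is any non-negative integer with $2k+\gamma>-1$ (the space does not depend on the choice of $k$) and $dA$ is normalized area measure on $\mathbb{D}$. For $\alpha>-1$, $A^2_\alpha$ is the weighted Bergman space with the inner product of $L^2(\mathbb{D},dA_\alpha)$, where $dA_\alpha(z)=(\alpha+1)(1-|z|^2)^\alpha\,dA(z)$. $T_\varphi$ is multiplication by $\varphi$ on $A^2_\alpha$ (a contraction) and $T_\varphi^*$ is its adjoint on $A^2_\alpha$. $H^\alpha(\varphi)$ is the range of $(I-T_\varphi T_\varphi^* )^{1/2}$ on $A^2_\alpha$. A finite Blaschke product is a unimodular constant times a finite product of Möbius maps $\frac{a-z}{1-\overline{a}z}$, $a\in\mathbb{D}$.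
   Formalization: The equivalence with (c) is asserted only when φ is not a unimodular constant; for a unimodular constant H^α(φ)={0}, so (a), (b), (d) hold but (c) fails. The equivalence of (a), (b) and (d) is asserted for all φ. *)

theory Defs
  imports "HOL-Analysis.Analysis"
begin

abbreviation unit_disk :: "complex set" where
  "unit_disk \<equiv> ball 0 1"

definition disk_area :: "complex measure" where
  "disk_area = uniform_measure (restrict_space lborel unit_disk) unit_disk"

definition weighted_area :: "real \<Rightarrow> complex measure" where
  "weighted_area \<alpha> =
     density disk_area (\<lambda>z. ennreal ((\<alpha> + 1) * (1 - (cmod z)\<^sup>2) powr \<alpha>))"

text \<open>
  Analytic functions on the disk are represented by total functions that vanish off the disk,
  so that equality of representatives is equality on the disk.  The parameter \<open>k\<close> is
  the order of the derivative used to describe the space of weight \<open>\<gamma>\<close>; it is meant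
  to satisfy \<open>2 * k + \<gamma> > -1\<close>, and every such \<open>k\<close> describes the same space.
\<close>

definition A2_via :: "nat \<Rightarrow> real \<Rightarrow> (complex \<Rightarrow> complex) set" where
  "A2_via k \<gamma> = {f. f holomorphic_on unit_disk \<and> (\<forall>z. z \<notin> unit_disk \<longrightarrow> f z = 0) \<and>
     integrable disk_area
       (\<lambda>z. (1 - (cmod z)\<^sup>2) powr (2 * real k + \<gamma>) * (cmod ((deriv ^^ k) f z))\<^sup>2)}"

abbreviation bergman :: "real \<Rightarrow> (complex \<Rightarrow> complex) set" where
  "bergman \<alpha> \<equiv> A2_via 0 \<alpha>"

definition berg_inner :: "real \<Rightarrow> (complex \<Rightarrow> complex) \<Rightarrow> (complex \<Rightarrow> complex) \<Rightarrow> complex" where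
  "berg_inner \<alpha> f g = (LINT z|weighted_area \<alpha>. f z * cnj (g z))"

definition berg_norm :: "real \<Rightarrow> (complex \<Rightarrow> complex) \<Rightarrow> real" where
  "berg_norm \<alpha> f = sqrt (Re (berg_inner \<alpha> f f))"

definition berg_topology :: "real \<Rightarrow> (complex \<Rightarrow> complex) topology" where
  "berg_topology \<alpha> =
     Metric_space.mtopology (bergman \<alpha>) (\<lambda>f g. berg_norm \<alpha> (\<lambda>z. f z - g z))"

type_synonym fun_op = "(complex \<Rightarrow> complex) \<Rightarrow> (complex \<Rightarrow> complex)"

text \<open>Only the values of an operator on \<open>bergman \<alpha>\<close> matter.\<close>

definition bounded_op :: "real \<Rightarrow> fun_op \<Rightarrow> bool" where
  "bounded_op \<alpha> S \<longleftrightarrow>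
     (\<forall>f\<in>bergman \<alpha>. S f \<in> bergman \<alpha>) \<and>
     (\<forall>f\<in>bergman \<alpha>. \<forall>g\<in>bergman \<alpha>. S (\<lambda>z. f z + g z) = (\<lambda>z. S f z + S g z)) \<and>
     (\<forall>c. \<forall>f\<in>bergman \<alpha>. S (\<lambda>z. c * f z) = (\<lambda>z. c * S f z)) \<and>
     (\<exists>C. \<forall>f\<in>bergman \<alpha>. berg_norm \<alpha> (S f) \<le> C * berg_norm \<alpha> f)"

definition positive_op :: "real \<Rightarrow> fun_op \<Rightarrow> bool" where
  "positive_op \<alpha> S \<longleftrightarrow>
     bounded_op \<alpha> S \<and> (\<forall>f\<in>bergman \<alpha>. berg_inner \<alpha> (S f) f \<in> \<real>\<^sub>\<ge>\<^sub>0)"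

definition compact_op :: "real \<Rightarrow> fun_op \<Rightarrow> bool" where
  "compact_op \<alpha> S \<longleftrightarrow>
     bounded_op \<alpha> S \<and>
     compactin (berg_topology \<alpha>)
       (berg_topology \<alpha> closure_of (S ` {f \<in> bergman \<alpha>. berg_norm \<alpha> f \<le> 1}))"

text \<open>
  The adjoint of a bounded operator, and the positive square root of a positive operator, exist
  and are uniquely determined on \<open>bergman \<alpha>\<close>, so the choice below is
  immaterial there.
\<close>

definition op_adjoint :: "real \<Rightarrow> fun_op \<Rightarrow> fun_op" where
  "op_adjoint \<alpha> S = (SOME R. bounded_op \<alpha> R \<and>
     (\<forall>f\<in>bergman \<alpha>. \<forall>g\<in>bergman \<alpha>. berg_inner \<alpha> (S f) g = berg_inner \<alpha> f (R g)))"

definition op_sqrt :: "real \<Rightarrow> fun_op \<Rightarrow> fun_op" where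
  "op_sqrt \<alpha> P = (SOME R. positive_op \<alpha> R \<and> (\<forall>f\<in>bergman \<alpha>. R (R f) = P f))"

definition mult_op :: "(complex \<Rightarrow> complex) \<Rightarrow> fun_op" where
  "mult_op \<phi> f = (\<lambda>z. \<phi> z * f z)"

definition defect_op :: "real \<Rightarrow> (complex \<Rightarrow> complex) \<Rightarrow> fun_op" where
  "defect_op \<alpha> \<phi> =
     op_sqrt \<alpha> (\<lambda>f z. f z - mult_op \<phi> (op_adjoint \<alpha> (mult_op \<phi>) f) z)"

definition sub_bergman :: "real \<Rightarrow> (complex \<Rightarrow> complex) \<Rightarrow> (complex \<Rightarrow> complex) set" where
  "sub_bergman \<alpha> \<phi> = defect_op \<alpha> \<phi> ` bergman \<alpha>"

text \<open>
  For a unimodular constant (the case \<open>n = 0\<close> of a finite Blaschke product) the defect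
  operator is zero, so \<open>sub_bergman\<close> is trivial and cannot be all of
  \<open>A2_via k (\<alpha> - 1)\<close>.
\<close>

definition unimodular_constant :: "(complex \<Rightarrow> complex) \<Rightarrow> bool" where
  "unimodular_constant \<phi> \<longleftrightarrow> (\<exists>c. cmod c = 1 \<and> (\<forall>z\<in>unit_disk. \<phi> z = c))"

definition finite_blaschke_product :: "(complex \<Rightarrow> complex) \<Rightarrow> bool" where
  "finite_blaschke_product \<phi> \<longleftrightarrow>
     (\<exists>c (n::nat) a. cmod c = 1 \<and> (\<forall>i<n. a i \<in> unit_disk) \<and>
        (\<forall>z\<in>unit_disk. \<phi> z = c * (\<Prod>i<n. (a i - z) / (1 - cnj (a i) * z))))"

end

(* Write R for the defect operator and T for multiplication by \<phi>, so that
   |R h|^2 = |h|^2 - |T* h|^2 =: D_\<phi>(h).  By Riesz representation, f lies in the range of R iff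
   |<h, f>|^2 \<le> C D_\<phi>(h) for all h.  For \<phi>(z) = z the form D is diagonal,
   D_z(h) = \<Sum> (\<alpha> + 1) / (n + \<alpha> + 1) w_n |h_n|^2, and the same criterion describes A^2_{\<alpha>-1}; so
   everything is a comparison of the forms D_\<phi> and D_z.

   For a Moebius factor b with zero a, D_b(h) = (1 - |a|^2) D_z(T_g* h), g = 1 / (1 - cnj a z), and
   the adjoints of multipliers with bounded derivative are D_z-bounded, because the multipliers
   themselves act on A^2_{\<alpha>-1}, described by the first derivative.  With the cocycle identity
   D_{b \<psi>}(h) = D_b(h) + D_\<psi>(T_b* h) this yields D_\<phi> \<approx> D_z for nonconstant finite Blaschke
   products, and D_\<phi> \<le> C D_z makes R compact.

   Conversely, on the normalised reproducing kernel at \<zeta> the form D_\<phi> equals 1 - |\<phi>(\<zeta>)|^2.  If R is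
   compact, or maps into A^2_{\<alpha>-1} (by uniform boundedness), this tends to 0 as |\<zeta>| tends to 1, and
   a function in the unit ball of H^\<infinity> with that property is a finite Blaschke product. *)

theory Submission
  imports Defs "HOL-Complex_Analysis.Complex_Analysis"
begin

section \<open>Abstract Hilbert spaces of functions\<close>

text \<open>The adjoint and the square root are choice terms, so nothing is known of them until
  existence is shown; afterwards only positivity of R and the identity |R h|^2 = D_\<phi>(h) are
  used, and R itself is never computed. The obstacle is that R need not have closed range, so f = R
  g cannot be solved by inverting R; the Riesz argument is therefore made for functionals bounded by
  |A h| with A an arbitrary linear map. T_g* is invertible, with the adjoint of 1 - cnj a z as
  inverse, which gives the lower bound for one Moebius factor. For a product one factor already
  suffices, since the other summand of the cocycle is nonnegative, while the upper bound must follow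
  D_z through every T_b*. A unimodular constant has D_\<phi> = 0, so the lower bound, and with it
  equality of the spaces, fails there: this is the exception in the statement. On the normalised
  kernel D_z equals 1 - |\<zeta>|^2, so inclusion gives even 1 - |\<phi>(\<zeta>)|^2 = O(1 -
  |\<zeta>|^2), whereas compactness gives only convergence to 0.\<close>

locale function_hilbert_space =
  fixes H :: "('a \<Rightarrow> complex) set"
    and ip :: "('a \<Rightarrow> complex) \<Rightarrow> ('a \<Rightarrow> complex) \<Rightarrow> complex"
  assumes H_zero: "(\<lambda>z. 0) \<in> H"
    and H_add: "f \<in> H \<Longrightarrow> g \<in> H \<Longrightarrow> (\<lambda>z. f z + g z) \<in> H"
    and H_scale: "f \<in> H \<Longrightarrow> (\<lambda>z. c * f z) \<in> H"
    and ip_add_left: "f \<in> H \<Longrightarrow> g \<in> H \<Longrightarrow> h \<in> H \<Longrightarrow> ip (\<lambda>z. f z + g z) h = ip f h + ip g h"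
    and ip_scale_left: "f \<in> H \<Longrightarrow> g \<in> H \<Longrightarrow> ip (\<lambda>z. c * f z) g = c * ip f g"
    and ip_commute: "f \<in> H \<Longrightarrow> g \<in> H \<Longrightarrow> ip g f = cnj (ip f g)"
    and ip_nonneg: "f \<in> H \<Longrightarrow> 0 \<le> Re (ip f f)"
    and ip_definite: "f \<in> H \<Longrightarrow> Re (ip f f) = 0 \<Longrightarrow> f = (\<lambda>z. 0)"
    and complete: "(\<And>n. X n \<in> H) \<Longrightarrow>
      (\<And>e. e > 0 \<Longrightarrow> \<exists>N. \<forall>m\<ge>N. \<forall>n\<ge>N.
         Re (ip (\<lambda>z. X m z - X n z) (\<lambda>z. X m z - X n z)) < e) \<Longrightarrow>
      \<exists>l\<in>H. (\<lambda>n. Re (ip (\<lambda>z. X n z - l z) (\<lambda>z. X n z - l z))) \<longlonglongrightarrow> 0"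
begin

definition nrm :: "('a \<Rightarrow> complex) \<Rightarrow> real" where
  "nrm f = sqrt (Re (ip f f))"

lemma H_uminus: "f \<in> H \<Longrightarrow> (\<lambda>z. - f z) \<in> H"
  using H_scale[of f "-1"] by simp

lemma H_diff: "f \<in> H \<Longrightarrow> g \<in> H \<Longrightarrow> (\<lambda>z. f z - g z) \<in> H"
  using H_add[OF _ H_uminus, of f g] by simp

lemmas H_closed = H_zero H_add H_scale H_uminus H_diff

lemma ip_uminus_left: "f \<in> H \<Longrightarrow> h \<in> H \<Longrightarrow> ip (\<lambda>z. - f z) h = - ip f h"
  using ip_scale_left[of f h "-1"] by simp

lemma ip_diff_left:
  assumes "f \<in> H" "g \<in> H" "h \<in> H"
  shows "ip (\<lambda>z. f z - g z) h = ip f h - ip g h"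
  using ip_add_left[OF assms(1) H_uminus[OF assms(2)] assms(3)] ip_uminus_left[OF assms(2,3)] by simp

lemma ip_add_right:
  assumes "f \<in> H" "g \<in> H" "h \<in> H"
  shows "ip f (\<lambda>z. g z + h z) = ip f g + ip f h"
  by (simp add: assms H_add ip_add_left ip_commute[where g = f, OF _ assms(1)])

lemma ip_diff_right:
  assumes "f \<in> H" "g \<in> H" "h \<in> H"
  shows "ip f (\<lambda>z. g z - h z) = ip f g - ip f h"
  by (simp add: assms H_diff ip_diff_left ip_commute[where g = f, OF _ assms(1)])

lemma ip_scale_right:
  assumes "f \<in> H" "g \<in> H"
  shows "ip f (\<lambda>z. c * g z) = cnj c * ip f g"
  by (simp add: assms H_scale ip_scale_left ip_commute[where g = f, OF _ assms(1)])

lemma ip_zero_left: "f \<in> H \<Longrightarrow> ip (\<lambda>z. 0) f = 0"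
  using ip_scale_left[of f f 0] by simp

lemma ip_zero_right: "f \<in> H \<Longrightarrow> ip f (\<lambda>z. 0) = 0"
  using ip_scale_right[of f f 0] by simp

lemmas ip_simps = ip_add_left ip_add_right ip_diff_left ip_diff_right
  ip_scale_left ip_scale_right ip_uminus_left ip_zero_left ip_zero_right

lemma nrm_nonneg: "f \<in> H \<Longrightarrow> 0 \<le> nrm f"
  by (simp add: nrm_def ip_nonneg)

lemma nrm_sq: "f \<in> H \<Longrightarrow> (nrm f)\<^sup>2 = Re (ip f f)"
  by (simp add: nrm_def ip_nonneg)

lemma ip_self: "f \<in> H \<Longrightarrow> ip f f = complex_of_real ((nrm f)\<^sup>2)"
proof -
  assume f: "f \<in> H"
  have "Im (ip f f) = Im (cnj (ip f f))" using ip_commute[OF f f] by (rule arg_cong)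
  thus ?thesis using f by (simp add: complex_eq_iff nrm_sq)
qed

lemma nrm_eq_0: "f \<in> H \<Longrightarrow> nrm f = 0 \<Longrightarrow> f = (\<lambda>z. 0)"
  using ip_definite[of f] nrm_sq[of f] by simp

lemma nrm_zero: "nrm (\<lambda>z. 0) = 0"
  by (simp add: nrm_def ip_zero_left H_zero)

lemma nrm_scale: "f \<in> H \<Longrightarrow> nrm (\<lambda>z. c * f z) = cmod c * nrm f"
proof -
  assume f: "f \<in> H"
  have "(nrm (\<lambda>z. c * f z))\<^sup>2 = Re ((c * cnj c) * ip f f)"
    using f by (simp add: nrm_sq H_scale ip_simps mult_ac)
  also have "\<dots> = (cmod c * nrm f)\<^sup>2"
    using f by (simp add: complex_norm_square[symmetric] ip_self power_mult_distrib flip: of_real_power of_real_mult)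
  finally show ?thesis using f by (simp add: nrm_nonneg H_scale)
qed

lemma nrm_minus_commute:
  assumes "f \<in> H" "g \<in> H" shows "nrm (\<lambda>z. f z - g z) = nrm (\<lambda>z. g z - f z)"
  using nrm_scale[OF H_diff[OF assms], of "-1"] by simp

lemma nrm_sq_diff:
  assumes "f \<in> H" "g \<in> H"
  shows "(nrm (\<lambda>z. f z - g z))\<^sup>2 = (nrm f)\<^sup>2 + (nrm g)\<^sup>2 - 2 * Re (ip f g)"
  using assms by (simp add: nrm_sq H_diff ip_simps ip_commute[OF assms])

lemma nrm_sq_add:
  assumes "f \<in> H" "g \<in> H"
  shows "(nrm (\<lambda>z. f z + g z))\<^sup>2 = (nrm f)\<^sup>2 + (nrm g)\<^sup>2 + 2 * Re (ip f g)"
  using assms by (simp add: nrm_sq H_add ip_simps ip_commute[OF assms])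

lemma cauchy_schwarz:
  assumes "f \<in> H" "g \<in> H" shows "cmod (ip f g) \<le> nrm f * nrm g"
proof (cases "nrm g = 0")
  case True
  have "g = (\<lambda>z. 0)" by (rule nrm_eq_0[OF assms(2) True])
  then show ?thesis using assms True by (simp add: ip_zero_right)
next
  case False
  define t where "t = ip f g / complex_of_real ((nrm g)\<^sup>2)"
  have "0 \<le> (nrm (\<lambda>z. f z - t * g z))\<^sup>2" by simp
  also have "\<dots> = (nrm f)\<^sup>2 + (cmod t)\<^sup>2 * (nrm g)\<^sup>2 - 2 * Re (cnj t * ip f g)"
    using assms by (simp add: nrm_sq_diff H_scale nrm_scale power_mult_distrib ip_simps)
  also have "cnj t * ip f g = complex_of_real ((cmod (ip f g))\<^sup>2 / (nrm g)\<^sup>2)"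
    by (simp add: t_def complex_norm_square mult_ac del: of_real_power)
  also have "(cmod t)\<^sup>2 * (nrm g)\<^sup>2 = (cmod (ip f g))\<^sup>2 / (nrm g)\<^sup>2"
    using False by (simp add: t_def norm_divide power_divide norm_mult power2_eq_square)
  finally have "(cmod (ip f g))\<^sup>2 / (nrm g)\<^sup>2 \<le> (nrm f)\<^sup>2" by simp
  hence "(cmod (ip f g))\<^sup>2 \<le> (nrm f * nrm g)\<^sup>2"
    using False by (simp add: divide_le_eq power_mult_distrib)
  thus ?thesis by (rule power2_le_imp_le) (simp add: nrm_nonneg assms)
qed

lemma nrm_triangle:
  assumes "f \<in> H" "g \<in> H" shows "nrm (\<lambda>z. f z + g z) \<le> nrm f + nrm g"
proof -
  have "Re (ip f g) \<le> nrm f * nrm g"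
    by (rule order_trans[OF complex_Re_le_cmod cauchy_schwarz[OF assms]])
  hence "(nrm (\<lambda>z. f z + g z))\<^sup>2 \<le> (nrm f + nrm g)\<^sup>2"
    using assms by (simp add: nrm_sq_add power2_sum)
  thus ?thesis by (rule power2_le_imp_le) (simp add: nrm_nonneg assms)
qed

lemma nrm_triangle_diff:
  assumes "f \<in> H" "g \<in> H" "h \<in> H"
  shows "nrm (\<lambda>z. f z - h z) \<le> nrm (\<lambda>z. f z - g z) + nrm (\<lambda>z. g z - h z)"
  using nrm_triangle[OF H_diff[OF assms(1,2)] H_diff[OF assms(2,3)]] by simp

lemma nrm_triangle_minus:
  assumes "f \<in> H" "g \<in> H" shows "nrm (\<lambda>z. f z - g z) \<le> nrm f + nrm g"
  using nrm_triangle[OF assms(1) H_uminus[OF assms(2)]] nrm_scale[OF assms(2), of "-1"] by simp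

lemma complete_nrm:
  assumes X: "\<And>n. X n \<in> H"
    and C: "\<And>e. e > 0 \<Longrightarrow> \<exists>N. \<forall>m\<ge>N. \<forall>n\<ge>N. nrm (\<lambda>z. X m z - X n z) < e"
  shows "\<exists>l\<in>H. (\<lambda>n. nrm (\<lambda>z. X n z - l z)) \<longlonglongrightarrow> 0"
proof -
  have "\<exists>l\<in>H. (\<lambda>n. Re (ip (\<lambda>z. X n z - l z) (\<lambda>z. X n z - l z))) \<longlonglongrightarrow> 0"
  proof (rule complete[OF X])
    fix e :: real assume "e > 0"
    hence "sqrt e > 0" by simp
    from C[OF this] obtain N where "\<forall>m\<ge>N. \<forall>n\<ge>N. nrm (\<lambda>z. X m z - X n z) < sqrt e" by blast
    thus "\<exists>N. \<forall>m\<ge>N. \<forall>n\<ge>N. Re (ip (\<lambda>z. X m z - X n z) (\<lambda>z. X m z - X n z)) < e"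
      unfolding nrm_def by (auto simp: real_sqrt_less_iff)
  qed
  then obtain l where l: "l \<in> H" "(\<lambda>n. Re (ip (\<lambda>z. X n z - l z) (\<lambda>z. X n z - l z))) \<longlonglongrightarrow> 0" by blast
  have "(\<lambda>n. sqrt (Re (ip (\<lambda>z. X n z - l z) (\<lambda>z. X n z - l z)))) \<longlonglongrightarrow> sqrt 0"
    by (rule tendsto_real_sqrt[OF l(2)])
  thus ?thesis using l(1) by (auto simp: nrm_def)
qed

text \<open>Boundedness is kept apart and added by \<open>bop\<close>: the variational Riesz
  argument below applies to any linear A.\<close>

definition lin :: "(('a \<Rightarrow> complex) \<Rightarrow> ('a \<Rightarrow> complex)) \<Rightarrow> bool" where
  "lin S \<longleftrightarrow> (\<forall>f\<in>H. S f \<in> H) \<and>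
     (\<forall>f\<in>H. \<forall>g\<in>H. S (\<lambda>z. f z + g z) = (\<lambda>z. S f z + S g z)) \<and>
     (\<forall>c. \<forall>f\<in>H. S (\<lambda>z. c * f z) = (\<lambda>z. c * S f z))"

lemma lin_in: "lin S \<Longrightarrow> f \<in> H \<Longrightarrow> S f \<in> H" by (simp add: lin_def)
lemma lin_add: "lin S \<Longrightarrow> f \<in> H \<Longrightarrow> g \<in> H \<Longrightarrow> S (\<lambda>z. f z + g z) = (\<lambda>z. S f z + S g z)"
  by (simp add: lin_def)
lemma lin_scale: "lin S \<Longrightarrow> f \<in> H \<Longrightarrow> S (\<lambda>z. c * f z) = (\<lambda>z. c * S f z)"
  by (simp add: lin_def)
lemma lin_diff:
  assumes "lin S" "f \<in> H" "g \<in> H" shows "S (\<lambda>z. f z - g z) = (\<lambda>z. S f z - S g z)"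
proof -
  have "S (\<lambda>z. f z + (-1) * g z) = (\<lambda>z. S f z + (-1) * S g z)"
    using lin_add[OF assms(1,2) H_scale[OF assms(3), of "-1"]] lin_scale[OF assms(1,3), of "-1"] by simp
  thus ?thesis by simp
qed

definition bop :: "(('a \<Rightarrow> complex) \<Rightarrow> ('a \<Rightarrow> complex)) \<Rightarrow> bool" where
  "bop S \<longleftrightarrow> lin S \<and> (\<exists>C. \<forall>f\<in>H. nrm (S f) \<le> C * nrm f)"

lemma bop_lin: "bop S \<Longrightarrow> lin S" by (simp add: bop_def)

text \<open>Minimise \<open>nrm (A x)\<^sup>2 - 2 Re (l x)\<close>; by the parallelogram law the
  images of a minimising sequence converge to the representing vector.\<close>

lemma riesz_general:
  assumes A: "lin A"
    and l_add: "\<And>f g. f \<in> H \<Longrightarrow> g \<in> H \<Longrightarrow> l (\<lambda>z. f z + g z) = l f + l g"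
    and l_scale: "\<And>c f. f \<in> H \<Longrightarrow> l (\<lambda>z. c * f z) = c * l f"
    and bd: "\<And>f. f \<in> H \<Longrightarrow> cmod (l f) \<le> C * nrm (A f)"
  shows "\<exists>g\<in>H. \<forall>f\<in>H. l f = ip (A f) g"
proof -
  define J where "J x = (nrm (A x))\<^sup>2 - 2 * Re (l x)" for x
  \<comment> \<open>Completing the square: J x is at least |A x|^2 - 2 C |A x|, hence at least -C^2,
    and the infimum m is finite.\<close>
  have Jlow: "J x \<ge> - C\<^sup>2" if "x \<in> H" for x
  proof -
    have "Re (l x) \<le> C * nrm (A x)" by (rule order_trans[OF complex_Re_le_cmod bd[OF that]])
    moreover have "0 \<le> (nrm (A x) - C)\<^sup>2" by simp
    ultimately show ?thesis unfolding J_def power2_diff by (simp add: mult.commute)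
  qed
  define m where "m = Inf (J ` H)"
  have bdd: "bdd_below (J ` H)" using Jlow by (auto intro: bdd_belowI[of _ "- C\<^sup>2"])
  have m_le: "m \<le> J x" if "x \<in> H" for x unfolding m_def using that bdd by (auto intro: cInf_lower)
  have "\<exists>x\<in>H. J x < m + 1 / real (Suc n)" for n
  proof -
    have "Inf (J ` H) < m + 1 / real (Suc n)" unfolding m_def by simp
    from cInf_lessD[OF _ this] H_zero show ?thesis by blast
  qed
  then obtain X where X: "\<And>n. X n \<in> H" and JX: "\<And>n. J (X n) < m + 1 / real (Suc n)" by metis
  \<comment> \<open>The midpoint of x and y also lies in H, so J there is at least m; the
    parallelogram law turns this into a bound on |A x - A y|.\<close>
  have par: "(nrm (\<lambda>z. A x z - A y z))\<^sup>2 \<le> 2 * (J x - m) + 2 * (J y - m)" if "x \<in> H" "y \<in> H" for x y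
  proof -
    let ?u = "\<lambda>z. (1/2) * (x z + y z)"
    have u: "?u \<in> H" using that by (intro H_scale H_add)
    have Au: "A ?u = (\<lambda>z. (1/2) * (A x z + A y z))"
      using lin_scale[OF A H_add[OF that], of "1/2"] lin_add[OF A that] by simp
    have lu: "l ?u = (1/2) * (l x + l y)"
      using l_scale[OF H_add[OF that], of "1/2"] l_add[OF that] by simp
    have Ax: "A x \<in> H" "A y \<in> H" using that A by (auto intro: lin_in)
    have "nrm (A ?u) = (1/2) * nrm (\<lambda>z. A x z + A y z)"
      unfolding Au nrm_scale[OF H_add[OF Ax]] by (simp add: norm_divide)
    hence "(nrm (A ?u))\<^sup>2 = (1/4) * (nrm (\<lambda>z. A x z + A y z))\<^sup>2"
      by (simp only: power_mult_distrib) (simp add: power2_eq_square)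
    hence "J ?u = (1/4) * ((nrm (A x))\<^sup>2 + (nrm (A y))\<^sup>2 + 2 * Re (ip (A x) (A y))) - Re (l x) - Re (l y)"
      unfolding J_def lu using nrm_sq_add[OF Ax] by (simp add: field_simps)
    moreover have "m \<le> J ?u" by (rule m_le[OF u])
    ultimately have "m \<le> (1/4) * ((nrm (A x))\<^sup>2 + (nrm (A y))\<^sup>2 + 2 * Re (ip (A x) (A y))) - Re (l x) - Re (l y)"
      by (simp only:)
    thus ?thesis unfolding nrm_sq_diff[OF Ax] J_def[of x] J_def[of y] by argo
  qed
  have "\<exists>g\<in>H. (\<lambda>n. nrm (\<lambda>z. A (X n) z - g z)) \<longlonglongrightarrow> 0"
  proof (rule complete_nrm)
    show "A (X n) \<in> H" for n using A X by (auto intro: lin_in)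
    fix e :: real assume e: "e > 0"
    obtain N where N: "1 / real (Suc N) < e\<^sup>2 / 4" using e nat_approx_posE[of "e\<^sup>2/4"] by (metis divide_pos_pos zero_less_numeral zero_less_power)
    have "nrm (\<lambda>z. A (X i) z - A (X j) z) < e" if "i \<ge> N" "j \<ge> N" for i j
    proof -
      have "1 / real (Suc i) \<le> 1 / real (Suc N)" "1 / real (Suc j) \<le> 1 / real (Suc N)"
        using that by (auto simp: divide_simps)
      hence "J (X i) - m < e\<^sup>2 / 4" "J (X j) - m < e\<^sup>2 / 4" using JX[of i] JX[of j] N by auto
      hence "(nrm (\<lambda>z. A (X i) z - A (X j) z))\<^sup>2 < e\<^sup>2" using par[OF X[of i] X[of j]] by argo
      thus ?thesis by (rule power2_less_imp_less) (use e in simp)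
    qed
    thus "\<exists>N. \<forall>m\<ge>N. \<forall>n\<ge>N. nrm (\<lambda>z. A (X m) z - A (X n) z) < e" by blast
  qed
  then obtain g where g: "g \<in> H" and lim: "(\<lambda>n. nrm (\<lambda>z. A (X n) z - g z)) \<longlonglongrightarrow> 0" by blast
  have Re_eq: "Re (l f) = Re (ip (A f) g)" if f: "f \<in> H" for f
  proof -
    have Af: "A f \<in> H" using f A by (auto intro: lin_in)
    \<comment> \<open>First variation in the direction f: J at X n + t f is at least m, while J (X
      n) < m + 1 / (n + 1). Only the images \<open>A (X n)\<close> are known to converge, so the
      inequality is phrased through them and passed to the limit g.\<close>
    have key: "0 \<le> 2 * t * (Re (ip (A f) g) - Re (l f)) + t\<^sup>2 * (nrm (A f))\<^sup>2" for t :: real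
    proof -
      have *: "- 1 / real (Suc n) - 2 * \<bar>t\<bar> * nrm (A f) * nrm (\<lambda>z. A (X n) z - g z)
            \<le> 2 * t * (Re (ip (A f) g) - Re (l f)) + t\<^sup>2 * (nrm (A f))\<^sup>2" for n
      proof -
        let ?y = "\<lambda>z. X n z + of_real t * f z"
        have y: "?y \<in> H" using X f by (intro H_add H_scale)
        have AX: "A (X n) \<in> H" using A X by (auto intro: lin_in)
        have Ay: "A ?y = (\<lambda>z. A (X n) z + of_real t * A f z)"
          using lin_add[OF A X H_scale[OF f]] lin_scale[OF A f] by simp
        have ly: "l ?y = l (X n) + of_real t * l f"
          using l_add[OF X H_scale[OF f]] l_scale[OF f] by simp
        have "J ?y = J (X n) + t\<^sup>2 * (nrm (A f))\<^sup>2 + 2 * t * (Re (ip (A (X n)) (A f)) - Re (l f))"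
          unfolding J_def Ay ly using nrm_sq_add[OF AX H_scale[OF Af, of "of_real t"]] nrm_scale[OF Af, of "of_real t"] AX Af
          by (simp add: ip_simps power_mult_distrib algebra_simps)
        moreover have "m \<le> J ?y" by (rule m_le[OF y])
        moreover have "Re (ip (A (X n)) (A f)) = Re (ip (A f) g) + Re (ip (A f) (\<lambda>z. A (X n) z - g z))"
          using AX Af g by (simp add: ip_simps ip_commute[OF Af AX])
        moreover have "\<bar>Re (ip (A f) (\<lambda>z. A (X n) z - g z))\<bar> \<le> nrm (A f) * nrm (\<lambda>z. A (X n) z - g z)"
          by (rule order_trans[OF abs_Re_le_cmod cauchy_schwarz[OF Af H_diff[OF AX g]]])
        hence "2 * t * Re (ip (A f) (\<lambda>z. A (X n) z - g z)) \<le> 2 * \<bar>t\<bar> * (nrm (A f) * nrm (\<lambda>z. A (X n) z - g z))"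
          by - (rule order_trans[OF abs_ge_self], simp add: abs_mult mult_left_mono)
        ultimately show ?thesis using JX[of n] by (simp add: algebra_simps)
      qed
      have inv: "(\<lambda>n. - 1 / real (Suc n)) \<longlonglongrightarrow> 0"
        using tendsto_minus[OF LIMSEQ_inverse_real_of_nat] by (simp add: inverse_eq_divide)
      have "(\<lambda>n. - 1 / real (Suc n) - 2 * \<bar>t\<bar> * nrm (A f) * nrm (\<lambda>z. A (X n) z - g z)) \<longlonglongrightarrow> 0 - 2 * \<bar>t\<bar> * nrm (A f) * 0"
        by (intro tendsto_diff tendsto_mult tendsto_const lim inv)
      thus ?thesis using * by (intro LIMSEQ_le_const2[of _ 0]) auto
    qed
    show ?thesis
    proof (rule ccontr)
      assume "Re (l f) \<noteq> Re (ip (A f) g)"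
      define d where "d = Re (ip (A f) g) - Re (l f)"
      have d: "d \<noteq> 0" using \<open>Re (l f) \<noteq> _\<close> by (simp add: d_def)
      \<comment> \<open>The value t = -d / s nearly minimises the quadratic in t; the added 1 keeps
        s positive when \<open>A f\<close> vanishes.\<close>
      define s where "s = 1 + (nrm (A f))\<^sup>2"
      have s: "s > 0" unfolding s_def by (simp add: add_pos_nonneg)
      have "0 \<le> 2 * (- d / s) * d + (- d / s)\<^sup>2 * (nrm (A f))\<^sup>2" using key[of "- d / s"] by (simp add: d_def)
      also have "\<dots> \<le> 2 * (- d / s) * d + (- d / s)\<^sup>2 * s" by (intro add_left_mono mult_left_mono) (auto simp: s_def)
      also have "\<dots> = - d\<^sup>2 / s" using s by (simp add: power2_eq_square field_simps)
      also have "\<dots> < 0" using s d by simp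
      finally show False by simp
    qed
  qed
  have "l f = ip (A f) g" if f: "f \<in> H" for f
  proof -
    \<comment> \<open>Replacing f by i f turns the identity of real parts into one of imaginary
      parts.\<close>
    have "Re (l (\<lambda>z. \<i> * f z)) = Re (ip (A (\<lambda>z. \<i> * f z)) g)" by (rule Re_eq[OF H_scale[OF f]])
    hence "Im (l f) = Im (ip (A f) g)"
      using l_scale[OF f] lin_scale[OF A f] ip_scale_left[OF lin_in[OF A f] g] by simp
    thus ?thesis using Re_eq[OF f] by (simp add: complex_eq_iff)
  qed
  thus ?thesis using g by blast
qed

lemma lin_id: "lin (\<lambda>f. f)"
  by (simp add: lin_def)

lemma riesz:
  assumes "\<And>f g. f \<in> H \<Longrightarrow> g \<in> H \<Longrightarrow> l (\<lambda>z. f z + g z) = l f + l g"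
    and "\<And>c f. f \<in> H \<Longrightarrow> l (\<lambda>z. c * f z) = c * l f"
    and "\<And>f. f \<in> H \<Longrightarrow> cmod (l f) \<le> C * nrm f"
  shows "\<exists>g\<in>H. \<forall>f\<in>H. l f = ip f g"
  using riesz_general[OF lin_id assms] by blast

lemma ip_eqI:
  assumes "f \<in> H" "g \<in> H" "\<And>h. h \<in> H \<Longrightarrow> ip h f = ip h g" shows "f = g"
proof -
  let ?d = "\<lambda>z. f z - g z"
  have d: "?d \<in> H" using assms by (intro H_diff)
  hence "Re (ip ?d ?d) = 0" using assms by (simp add: ip_diff_right)
  from ip_definite[OF d this] show ?thesis by (auto simp: fun_eq_iff)
qed

text \<open>For fixed g, Riesz represents \<open>B\<close> in its first slot; since \<open>B\<close>
  and \<open>ip\<close> are both conjugate linear in the second slot, the representing vector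
  depends linearly on g. Adjoints and square roots are both built this way.\<close>

lemma form_operator:
  assumes add_l: "\<And>f g h. f \<in> H \<Longrightarrow> g \<in> H \<Longrightarrow> h \<in> H \<Longrightarrow> B (\<lambda>z. f z + g z) h = B f h + B g h"
    and scale_l: "\<And>c f h. f \<in> H \<Longrightarrow> h \<in> H \<Longrightarrow> B (\<lambda>z. c * f z) h = c * B f h"
    and add_r: "\<And>f g h. f \<in> H \<Longrightarrow> g \<in> H \<Longrightarrow> h \<in> H \<Longrightarrow> B h (\<lambda>z. f z + g z) = B h f + B h g"
    and scale_r: "\<And>c f h. f \<in> H \<Longrightarrow> h \<in> H \<Longrightarrow> B h (\<lambda>z. c * f z) = cnj c * B h f"
    and bd: "\<And>f g. f \<in> H \<Longrightarrow> g \<in> H \<Longrightarrow> cmod (B f g) \<le> C * nrm f * nrm g"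
  shows "\<exists>R. bop R \<and> (\<forall>f\<in>H. \<forall>g\<in>H. B f g = ip f (R g))"
proof -
  have "\<exists>r\<in>H. \<forall>f\<in>H. B f g = ip f r" if g: "g \<in> H" for g
    using riesz[of "\<lambda>f. B f g" "C * nrm g"] g add_l scale_l bd by (simp add: mult_ac)
  then obtain R where R: "\<And>g. g \<in> H \<Longrightarrow> R g \<in> H" and BR: "\<And>f g. f \<in> H \<Longrightarrow> g \<in> H \<Longrightarrow> B f g = ip f (R g)"
    by metis
  have "R (\<lambda>z. f z + g z) = (\<lambda>z. R f z + R g z)" if "f \<in> H" "g \<in> H" for f g
    by (rule ip_eqI) (simp_all add: that R H_add ip_add_right BR[symmetric] add_r)
  moreover have "R (\<lambda>z. c * f z) = (\<lambda>z. c * R f z)" if "f \<in> H" for f c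
    by (rule ip_eqI) (simp_all add: that R H_scale ip_scale_right BR[symmetric] scale_r)
  moreover have "nrm (R g) \<le> C * nrm g" if g: "g \<in> H" for g
  proof (cases "nrm (R g) = 0")
    case True
    \<comment> \<open>The sign of C is not given; nonnegativity of \<open>C * nrm g\<close> is read
      off from the bound at the pair (g, g).\<close>
    have "0 \<le> C * nrm g"
    proof (cases "nrm g = 0")
      case False
      have "0 \<le> (C * nrm g) * nrm g" by (rule order_trans[OF norm_ge_zero bd[OF g g]])
      thus ?thesis using False nrm_nonneg[OF g] by (simp add: zero_le_mult_iff)
    qed simp
    thus ?thesis using True by simp
  next
    case False
    have "(nrm (R g))\<^sup>2 = cmod (B (R g) g)" using R[OF g] g by (simp add: BR ip_self norm_power)
    also have "\<dots> \<le> C * nrm (R g) * nrm g" by (rule bd[OF R[OF g] g])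
    finally have "nrm (R g) * nrm (R g) \<le> nrm (R g) * (C * nrm g)" by (simp add: power2_eq_square mult_ac)
    thus ?thesis using False nrm_nonneg[OF R[OF g]] by (simp add: mult_le_cancel_left)
  qed
  ultimately have "bop R" unfolding bop_def lin_def using R by blast
  thus ?thesis using BR by blast
qed

lemma adjoint_exists:
  assumes S: "bop S"
  shows "\<exists>R. bop R \<and> (\<forall>f\<in>H. \<forall>g\<in>H. ip (S f) g = ip f (R g))"
proof -
  obtain C where C: "\<And>f. f \<in> H \<Longrightarrow> nrm (S f) \<le> C * nrm f" using S by (auto simp: bop_def)
  note L = bop_lin[OF S]
  show ?thesis
  proof (rule form_operator[where C = C])
    fix f g assume fg: "f \<in> H" "g \<in> H"
    have "cmod (ip (S f) g) \<le> nrm (S f) * nrm g" by (rule cauchy_schwarz[OF lin_in[OF L fg(1)] fg(2)])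
    also have "\<dots> \<le> C * nrm f * nrm g" using C fg by (intro mult_right_mono nrm_nonneg) auto
    finally show "cmod (ip (S f) g) \<le> C * nrm f * nrm g" .
  qed (simp_all add: lin_add[OF L] lin_scale[OF L] lin_in[OF L] ip_simps)
qed

definition pos :: "(('a \<Rightarrow> complex) \<Rightarrow> ('a \<Rightarrow> complex)) \<Rightarrow> bool" where
  "pos S \<longleftrightarrow> bop S \<and> (\<forall>f\<in>H. ip (S f) f \<in> \<real>\<^sub>\<ge>\<^sub>0)"

text \<open>Polarisation: \<open>ip (S h) h\<close> is real for h = f + g and for h = f + i g, and
  these two facts compare the imaginary and the real parts of \<open>ip (S f) g\<close> and
  \<open>ip (S g) f\<close>.\<close>

lemma pos_selfadjoint:
  assumes S: "pos S" and f: "f \<in> H" and g: "g \<in> H"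
  shows "ip (S f) g = ip f (S g)"
proof -
  have L: "lin S" using S by (simp add: pos_def bop_lin)
  have Im0: "Im (ip (S h) h) = 0" if "h \<in> H" for h
    using S that by (auto simp: pos_def complex_nonneg_Reals_iff)
  have SH: "S f \<in> H" "S g \<in> H" using L f g by (auto intro: lin_in)
  have 1: "Im (ip (S f) g + ip (S g) f) = 0"
  proof -
    have "ip (S (\<lambda>z. f z + g z)) (\<lambda>z. f z + g z) = ip (S f) f + ip (S g) g + (ip (S f) g + ip (S g) f)"
      using f g SH by (simp add: lin_add[OF L] ip_simps H_closed)
    thus ?thesis using Im0[OF f] Im0[OF g] Im0[OF H_add[OF f g]] by simp
  qed
  have 2: "Im (- \<i> * ip (S f) g + \<i> * ip (S g) f) = 0"
  proof -
    have ig: "(\<lambda>z. \<i> * g z) \<in> H" "(\<lambda>z. \<i> * S g z) \<in> H" using g SH by (auto intro: H_scale)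
    have "ip (S (\<lambda>z. f z + \<i> * g z)) (\<lambda>z. f z + \<i> * g z) = ip (S f) f + ip (S g) g + (- \<i> * ip (S f) g + \<i> * ip (S g) f)"
      using f g SH ig by (simp add: lin_add[OF L] lin_scale[OF L] ip_simps H_closed)
    thus ?thesis using Im0[OF f] Im0[OF g] Im0[OF H_add[OF f ig(1)]] by simp
  qed
  have "ip (S f) g = cnj (ip (S g) f)" using 1 2 by (simp add: complex_eq_iff)
  thus ?thesis using ip_commute[OF SH(2) f] by simp
qed

text \<open>Douglas' range criterion for self-adjoint R. The bound says that the functional given by
  f factors through R; the generalised Riesz lemma with A = R yields g with
  \<open>ip h f = ip (R h) g = ip h (R g)\<close>.\<close>

lemma range_pos_iff:
  assumes R: "pos R" and f: "f \<in> H"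
  shows "f \<in> R ` H \<longleftrightarrow> (\<exists>C. \<forall>h\<in>H. cmod (ip h f) \<le> C * nrm (R h))"
proof
  have L: "lin R" using R by (simp add: pos_def bop_lin)
  assume "f \<in> R ` H"
  then obtain g where g: "g \<in> H" "f = R g" by blast
  have "cmod (ip h f) \<le> nrm g * nrm (R h)" if h: "h \<in> H" for h
    using cauchy_schwarz[OF lin_in[OF L h] g(1)] pos_selfadjoint[OF R h g(1)] g(2) by (simp add: mult_ac)
  thus "\<exists>C. \<forall>h\<in>H. cmod (ip h f) \<le> C * nrm (R h)" by blast
next
  have L: "lin R" using R by (simp add: pos_def bop_lin)
  assume "\<exists>C. \<forall>h\<in>H. cmod (ip h f) \<le> C * nrm (R h)"
  then obtain C where C: "\<And>h. h \<in> H \<Longrightarrow> cmod (ip h f) \<le> C * nrm (R h)" by blast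
  obtain g where g: "g \<in> H" "\<And>h. h \<in> H \<Longrightarrow> ip h f = ip (R h) g"
    using riesz_general[OF L, of "\<lambda>h. ip h f" C] C f by (auto simp: ip_simps)
  have "f = R g" by (rule ip_eqI) (simp_all add: f g lin_in[OF L] pos_selfadjoint[OF R])
  thus "f \<in> R ` H" using g by blast
qed

end

section \<open>The binomial series of the square root\<close>

text \<open>The Taylor coefficients of (1 - x)^(1/2) at 0.\<close>

definition sqrt_coeff :: "nat \<Rightarrow> real" where
  "sqrt_coeff n = pochhammer (-1/2) n / fact n"

lemma sqrt_coeff_0: "sqrt_coeff 0 = 1"
  by (simp add: sqrt_coeff_def)

lemma sqrt_coeff_Suc: "sqrt_coeff (Suc n) = - pochhammer (1/2) n / (2 * fact (Suc n))"
  by (simp add: sqrt_coeff_def pochhammer_rec)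

lemma sqrt_coeff_nonpos: "n \<ge> 1 \<Longrightarrow> sqrt_coeff n \<le> 0"
  by (cases n) (simp_all add: sqrt_coeff_Suc pochhammer_nonneg divide_nonneg_nonneg del: fact_Suc)

text \<open>Partial sums are the coefficients of (1 - x)^(1/2) / (1 - x) = (1 - x)^(-1/2), which are
  positive. This sign drives both the absolute summability and the positivity of the operator square
  root.\<close>

lemma sum_sqrt_coeff: "(\<Sum>k\<le>n. sqrt_coeff k) = pochhammer (1/2) n / fact n"
proof (induction n)
  case (Suc n)
  have "pochhammer (1/2::real) (Suc n) / fact (Suc n)
      = pochhammer (1/2) n / fact n * ((1/2 + n) / (n + 1))"
    by (simp add: pochhammer_rec' field_simps)
  also have "(1/2 + real n) / (n + 1) = 1 - 1 / (2 * (real n + 1))"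
    by (simp add: field_simps)
  finally show ?case
    unfolding sum.atMost_Suc Suc.IH sqrt_coeff_Suc fact_Suc by (simp add: algebra_simps)
qed (simp add: sqrt_coeff_0)

lemma sum_sqrt_coeff_nonneg: "(\<Sum>k<n. sqrt_coeff k) \<ge> 0"
proof (cases n)
  case (Suc m)
  show ?thesis unfolding Suc lessThan_Suc_atMost sum_sqrt_coeff by (simp add: pochhammer_nonneg)
qed simp

lemma summable_abs_sqrt_coeff: "summable (\<lambda>n. \<bar>sqrt_coeff n\<bar>)"
proof (rule bounded_imp_summable)
  fix n
  \<comment> \<open>Only the zeroth coefficient is positive, and it equals 1, so passing to absolute
    values amounts to negating all coefficients and adding 2 at index 0.\<close>
  have "(\<Sum>k\<le>n. \<bar>sqrt_coeff k\<bar>) = (\<Sum>k\<le>n. (if k = 0 then 2 else 0) - sqrt_coeff k)"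
  proof (rule sum.cong)
    fix k show "\<bar>sqrt_coeff k\<bar> = (if k = 0 then 2 else 0) - sqrt_coeff k"
      using sqrt_coeff_nonpos[of k] by (cases k) (auto simp: sqrt_coeff_0)
  qed simp
  also have "\<dots> = 2 - (\<Sum>k\<le>n. sqrt_coeff k)" by (simp add: sum_subtractf)
  also have "\<dots> \<le> 2" using sum_sqrt_coeff_nonneg[of "Suc n"] by (simp add: lessThan_Suc_atMost)
  finally show "(\<Sum>k\<le>n. \<bar>sqrt_coeff k\<bar>) \<le> 2" .
qed simp

text \<open>The square of the series is 1 - x. With the coefficients written as signed binomials
  this is Vandermonde's identity for 1/2 + 1/2 = 1.\<close>

lemma sqrt_coeff_convolution:
  "(\<Sum>k\<le>n. sqrt_coeff k * sqrt_coeff (n - k)) = (if n = 0 then 1 else if n = 1 then -1 else 0)"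
proof -
  have c: "sqrt_coeff k = (-1) ^ k * ((1/2) gchoose k)" for k
    by (simp add: sqrt_coeff_def gbinomial_pochhammer)
  have "(\<Sum>k\<le>n. sqrt_coeff k * sqrt_coeff (n - k)) = (\<Sum>k\<le>n. (-1) ^ n * (((1/2) gchoose k) * ((1/2) gchoose (n - k))))"
    by (rule sum.cong) (auto simp: c power_add[symmetric] mult_ac simp flip: power_add)
  also have "\<dots> = (-1) ^ n * ((1::real) gchoose n)"
    using gbinomial_Vandermonde[of "1/2::real" "1/2" n] by (simp add: sum_distrib_left[symmetric] atLeast0AtMost)
  also have "(1::real) gchoose n = of_nat (1 choose n)" by (simp add: binomial_gbinomial)
  also have "1 choose n = (if n \<le> 1 then 1 else 0)" by (cases n) (auto simp: binomial_eq_0)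
  finally show ?thesis by auto
qed

text \<open>Here \<open>y n\<close> will be \<open>ip ((A ^^ n) h) f\<close>, and the claim is the
  scalar shadow of squaring the series at A: only the terms of 1 - x survive. Boundedness of y and
  absolute summability of the coefficients justify regrouping along i + j = n.\<close>

lemma sqrt_coeff_double_sum:
  fixes y :: "nat \<Rightarrow> complex"
  assumes y: "\<And>n. cmod (y n) \<le> K"
  shows "(\<Sum>i. sqrt_coeff i * (\<Sum>j. sqrt_coeff j * y (i + j))) = y 0 - y 1"
proof -
  define F where "F = (\<lambda>(i, j). complex_of_real (sqrt_coeff i) * (complex_of_real (sqrt_coeff j) * y (i + j)))"
  have c_on: "(\<lambda>i. \<bar>sqrt_coeff i\<bar>) summable_on UNIV"
    using summable_abs_sqrt_coeff by (intro norm_summable_imp_summable_on) auto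
  have "(\<lambda>p. norm (F p)) summable_on UNIV \<times> UNIV"
  proof (rule summable_on_comparison_test)
    have "(\<lambda>(i, j). \<bar>sqrt_coeff i\<bar> * \<bar>sqrt_coeff j\<bar>) summable_on UNIV \<times> UNIV"
      by (rule summable_on_SigmaI[where g = "\<lambda>i. \<bar>sqrt_coeff i\<bar> * (\<Sum>\<^sub>\<infinity>j. \<bar>sqrt_coeff j\<bar>)"])
        (auto intro!: summable_on_cmult_left has_sum_cmult_right has_sum_infsum c_on)
    thus "(\<lambda>p. K * (\<bar>sqrt_coeff (fst p)\<bar> * \<bar>sqrt_coeff (snd p)\<bar>)) summable_on UNIV \<times> UNIV"
      by (intro summable_on_cmult_right) (simp add: case_prod_unfold)
    fix p :: "nat \<times> nat"
    show "norm (F p) \<le> K * (\<bar>sqrt_coeff (fst p)\<bar> * \<bar>sqrt_coeff (snd p)\<bar>)"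
      using mult_right_mono[OF y[of "fst p + snd p"], of "\<bar>sqrt_coeff (fst p)\<bar> * \<bar>sqrt_coeff (snd p)\<bar>"]
      by (simp add: F_def case_prod_unfold norm_mult mult_ac)
  qed simp
  hence Fs: "F summable_on UNIV \<times> UNIV" by (rule abs_summable_summable)
  have inner: "(\<Sum>\<^sub>\<infinity>j. F (i, j)) = sqrt_coeff i * (\<Sum>j. sqrt_coeff j * y (i + j))" for i
  proof -
    have ns: "summable (\<lambda>j. norm (complex_of_real (sqrt_coeff j) * y (i + j)))"
    proof (rule summable_comparison_test')
      show "summable (\<lambda>j. \<bar>sqrt_coeff j\<bar> * K)" using summable_abs_sqrt_coeff by (rule summable_mult2)
      show "norm (norm (complex_of_real (sqrt_coeff j) * y (i + j))) \<le> \<bar>sqrt_coeff j\<bar> * K" if "j \<ge> 0" for j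
        using y by (simp add: norm_mult mult_left_mono)
    qed
    have s: "(\<Sum>\<^sub>\<infinity>j. complex_of_real (sqrt_coeff j) * y (i + j)) = (\<Sum>j. complex_of_real (sqrt_coeff j) * y (i + j))"
      by (rule infsumI[OF norm_summable_imp_has_sum[OF ns summable_sums[OF summable_norm_cancel[OF ns]]]])
    show ?thesis unfolding F_def by (simp add: infsum_cmult_right' s)
  qed
  have out: "(\<lambda>i. \<Sum>\<^sub>\<infinity>j. F (i, j)) summable_on UNIV"
    using summable_on_Sigma_banach[of "\<lambda>i j. F (i, j)" UNIV "\<lambda>_. UNIV"] Fs by simp
  have "(\<Sum>i. sqrt_coeff i * (\<Sum>j. sqrt_coeff j * y (i + j))) = (\<Sum>\<^sub>\<infinity>i. \<Sum>\<^sub>\<infinity>j. F (i, j))"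
    using has_sum_imp_sums[OF has_sum_infsum[OF out]] by (simp add: inner sums_iff)
  also have "\<dots> = infsum F (UNIV \<times> UNIV)"
    using infsum_Sigma_banach[of F UNIV "\<lambda>_. UNIV"] Fs by simp
  \<comment> \<open>Each pair (i, j) becomes (i + j, i), so that the inner sum is a finite
    convolution.\<close>
  also have "\<dots> = infsum (\<lambda>(n, k). F (k, n - k)) (Sigma UNIV (\<lambda>n. {..n}))"
    by (rule infsum_reindex_bij_witness[where j = "\<lambda>(i, j). (i + j, i)" and i = "\<lambda>(n, k). (k, n - k)"]) auto
  also have "\<dots> = (\<Sum>\<^sub>\<infinity>n. \<Sum>\<^sub>\<infinity>k\<in>{..n}. F (k, n - k))"
  proof -
    have "(\<lambda>(n, k). F (k, n - k)) summable_on (Sigma UNIV (\<lambda>n. {..n}))"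
      using Fs by (subst summable_on_reindex_bij_witness[where i = "\<lambda>(i, j). (i + j, i)" and j = "\<lambda>(n, k). (k, n - k)" and T = "UNIV \<times> UNIV" and h = F]) auto
    from infsum_Sigma_banach[OF this] show ?thesis by simp
  qed
  also have "\<dots> = (\<Sum>\<^sub>\<infinity>n. complex_of_real (if n = 0 then 1 else if n = 1 then -1 else 0) * y n)"
  proof (rule infsum_cong)
    fix n :: nat
    have "(\<Sum>\<^sub>\<infinity>k\<in>{..n}. F (k, n - k)) = (\<Sum>k\<le>n. complex_of_real (sqrt_coeff k * sqrt_coeff (n - k)) * y n)"
      by (simp add: F_def mult_ac)
    also have "\<dots> = complex_of_real (\<Sum>k\<le>n. sqrt_coeff k * sqrt_coeff (n - k)) * y n"
      by (simp only: sum_distrib_right[symmetric] of_real_sum)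
    finally show "(\<Sum>\<^sub>\<infinity>k\<in>{..n}. F (k, n - k)) = complex_of_real (if n = 0 then 1 else if n = 1 then -1 else 0) * y n"
      by (simp only: sqrt_coeff_convolution)
  qed
  also have "\<dots> = (\<Sum>\<^sub>\<infinity>n\<in>{0,1}. complex_of_real (if n = 0 then 1 else if n = 1 then -1 else 0) * y n)"
    by (rule infsum_cong_neutral) auto
  also have "\<dots> = y 0 - y 1" by simp
  finally show ?thesis .
qed

section \<open>Operator square roots and uniform boundedness\<close>

context function_hilbert_space
begin

lemma lin_funpow_in: "lin A \<Longrightarrow> f \<in> H \<Longrightarrow> (A ^^ n) f \<in> H"
  by (induction n) (auto intro: lin_in)

lemma lin_funpow: "lin A \<Longrightarrow> lin (A ^^ n)"
proof (induction n)
  case (Suc n)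
  note L = Suc.IH[OF Suc.prems] and A = Suc.prems
  show ?case unfolding lin_def funpow.simps comp_def
    by (auto simp: lin_in[OF A] lin_in[OF L] lin_add[OF L] lin_scale[OF L] lin_add[OF A] lin_scale[OF A])
qed (simp add: lin_def)

text \<open>R is the binomial series of (I - A)^(1/2), formed weakly: its sesquilinear form
  converges absolutely because A is a contraction, and \<open>form_operator\<close> turns it into an
  operator.\<close>

lemma sqrt_exists:
  assumes A: "lin A"
    and sa: "\<And>f g. f \<in> H \<Longrightarrow> g \<in> H \<Longrightarrow> ip (A f) g = ip f (A g)"
    and con: "\<And>f. f \<in> H \<Longrightarrow> nrm (A f) \<le> nrm f"
  shows "\<exists>R. pos R \<and> (\<forall>f\<in>H. R (R f) = (\<lambda>z. f z - A f z))"
proof -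
  have Ain: "(A ^^ n) f \<in> H" if "f \<in> H" for n f using that A by (rule lin_funpow_in[rotated])
  have Acon: "nrm ((A ^^ n) f) \<le> nrm f" if f: "f \<in> H" for n f
  proof (induction n)
    case (Suc n) thus ?case using con[OF Ain[OF f, of n]] by simp
  qed simp
  have Asa: "ip ((A ^^ n) f) g = ip f ((A ^^ n) g)" if "f \<in> H" "g \<in> H" for n f g
    using that
  proof (induction n arbitrary: f)
    case (Suc n)
    have "ip ((A ^^ Suc n) f) g = ip ((A ^^ n) (A f)) g" by (simp add: funpow_swap1)
    also have "\<dots> = ip f ((A ^^ Suc n) g)"
      using Suc.IH[OF lin_in[OF A Suc.prems(1)] Suc.prems(2)] sa[OF Suc.prems(1) Ain[OF Suc.prems(2)]] by simp
    finally show ?case .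
  qed simp
  have bnd: "cmod (ip ((A ^^ n) f) g) \<le> nrm f * nrm g" if "f \<in> H" "g \<in> H" for n f g
    using cauchy_schwarz[OF Ain[OF that(1)] that(2)] mult_right_mono[OF Acon[OF that(1)] nrm_nonneg[OF that(2)]]
    by (rule order_trans)
  define B where "B f g = (\<Sum>n. complex_of_real (sqrt_coeff n) * ip ((A ^^ n) f) g)" for f g
  have nsum: "summable (\<lambda>n. norm (complex_of_real (sqrt_coeff n) * ip ((A ^^ n) f) g))"
    if "f \<in> H" "g \<in> H" for f g
  proof (rule summable_comparison_test')
    show "summable (\<lambda>n. \<bar>sqrt_coeff n\<bar> * (nrm f * nrm g))"
      using summable_abs_sqrt_coeff by (rule summable_mult2)
    show "norm (norm (complex_of_real (sqrt_coeff n) * ip ((A ^^ n) f) g)) \<le> \<bar>sqrt_coeff n\<bar> * (nrm f * nrm g)"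
      if "n \<ge> 0" for n
      using bnd[OF \<open>f \<in> H\<close> \<open>g \<in> H\<close>] by (simp add: norm_mult mult_left_mono)
  qed
  note sm = summable_norm_cancel[OF nsum]
  have "\<exists>R. bop R \<and> (\<forall>f\<in>H. \<forall>g\<in>H. B f g = ip f (R g))"
  proof (rule form_operator)
    fix f g h assume fgh: "f \<in> H" "g \<in> H" "h \<in> H"
    show "B (\<lambda>z. f z + g z) h = B f h + B g h"
      unfolding B_def lin_add[OF lin_funpow[OF A] fgh(1,2)] ip_add_left[OF Ain[OF fgh(1)] Ain[OF fgh(2)] fgh(3)] distrib_left
      by (rule suminf_add[symmetric]) (use sm fgh in auto)
    show "B h (\<lambda>z. f z + g z) = B h f + B h g"
      unfolding B_def ip_add_right[OF Ain[OF fgh(3)] fgh(1,2)] distrib_left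
      by (rule suminf_add[symmetric]) (use sm fgh in auto)
  next
    fix c f h assume fh: "f \<in> H" "h \<in> H"
    show "B (\<lambda>z. c * f z) h = c * B f h"
      unfolding B_def lin_scale[OF lin_funpow[OF A] fh(1)] ip_scale_left[OF Ain[OF fh(1)] fh(2)]
      using suminf_mult[OF sm[OF fh], of c] by (simp add: mult_ac)
    show "B h (\<lambda>z. c * f z) = cnj c * B h f"
      unfolding B_def ip_scale_right[OF Ain[OF fh(2)] fh(1)]
      using suminf_mult[OF sm[OF fh(2,1)], of "cnj c"] by (simp add: mult_ac)
  next
    fix f g assume fg: "f \<in> H" "g \<in> H"
    have "cmod (B f g) \<le> (\<Sum>n. norm (complex_of_real (sqrt_coeff n) * ip ((A ^^ n) f) g))"
      unfolding B_def by (rule summable_norm[OF nsum[OF fg]])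
    also have "\<dots> \<le> (\<Sum>n. \<bar>sqrt_coeff n\<bar> * (nrm f * nrm g))"
      using bnd[OF fg] by (intro suminf_le nsum[OF fg] summable_mult2 summable_abs_sqrt_coeff)
        (simp add: norm_mult mult_left_mono)
    also have "\<dots> = (\<Sum>n. \<bar>sqrt_coeff n\<bar>) * nrm f * nrm g"
      unfolding suminf_mult2[OF summable_abs_sqrt_coeff, symmetric] by simp
    finally show "cmod (B f g) \<le> (\<Sum>n. \<bar>sqrt_coeff n\<bar>) * nrm f * nrm g" .
  qed
  then obtain R where R: "bop R" and BR: "\<And>f g. f \<in> H \<Longrightarrow> g \<in> H \<Longrightarrow> B f g = ip f (R g)" by blast
  have Rin: "R f \<in> H" if "f \<in> H" for f using bop_lin[OF R] that by (rule lin_in)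
  have "ip (R f) f \<in> \<real>\<^sub>\<ge>\<^sub>0" if f: "f \<in> H" for f
  proof -
    have im: "Im (ip ((A ^^ n) f) f) = 0" for n
      using arg_cong[OF ip_commute[OF f Ain[OF f, of n]], of Im] by (simp add: Asa[OF f f])
    have S: "(\<lambda>n. sqrt_coeff n * Re (ip ((A ^^ n) f) f)) sums Re (B f f)"
      using sums_Re[OF summable_sums[OF sm[OF f f]]] by (simp add: B_def)
    have I: "Im (B f f) = 0"
      using sums_unique[OF sums_Im[OF summable_sums[OF sm[OF f f]]]] im by (simp add: B_def)
    have "0 \<le> Re (B f f)"
    proof (rule LIMSEQ_le_const)
      show "(\<lambda>N. \<Sum>n<N. sqrt_coeff n * Re (ip ((A ^^ n) f) f)) \<longlonglongrightarrow> Re (B f f)"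
        using S by (simp add: sums_def)
      \<comment> \<open>Replacing every \<open>ip ((A ^^ n) f) f\<close> by its upper bound |f|^2
        can only lower the partial sum, because the coefficients after the zeroth are nonpositive
        and the zeroth term equals |f|^2 anyway; what remains is a nonnegative partial sum times
        |f|^2.\<close>
      have "0 \<le> (\<Sum>n<N. sqrt_coeff n * Re (ip ((A ^^ n) f) f))" for N
      proof -
        have "0 \<le> (\<Sum>n<N. sqrt_coeff n) * (nrm f)\<^sup>2"
          using sum_sqrt_coeff_nonneg by (intro mult_nonneg_nonneg) auto
        also have "\<dots> = (\<Sum>n<N. sqrt_coeff n * (nrm f)\<^sup>2)" by (rule sum_distrib_right)
        also have "\<dots> \<le> (\<Sum>n<N. sqrt_coeff n * Re (ip ((A ^^ n) f) f))"
        proof (rule sum_mono)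
          fix n
          have "Re (ip ((A ^^ n) f) f) \<le> (nrm f)\<^sup>2"
            using order_trans[OF complex_Re_le_cmod bnd[OF f f, of n]] by (simp add: power2_eq_square)
          thus "sqrt_coeff n * (nrm f)\<^sup>2 \<le> sqrt_coeff n * Re (ip ((A ^^ n) f) f)"
            using sqrt_coeff_nonpos[of n] f
            by (cases n) (auto simp: sqrt_coeff_0 nrm_sq intro: mult_left_mono_neg simp del: funpow.simps(2))
        qed
        finally show ?thesis .
      qed
      thus "\<exists>N. \<forall>n\<ge>N. 0 \<le> (\<Sum>n<n. sqrt_coeff n * Re (ip ((A ^^ n) f) f))" by blast
    qed
    thus ?thesis using I BR[OF f f] ip_commute[OF f Rin[OF f]] by (simp add: complex_nonneg_Reals_iff)
  qed
  hence "pos R" using R by (simp add: pos_def)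
  moreover have "R (R f) = (\<lambda>z. f z - A f z)" if f: "f \<in> H" for f
  proof (rule ip_eqI)
    show "R (R f) \<in> H" "(\<lambda>z. f z - A f z) \<in> H" using f by (auto intro!: Rin H_diff lin_in[OF A])
    fix h assume h: "h \<in> H"
    \<comment> \<open>Expanding the outer R and then the inner one writes R^2 as a double series in
      the powers of A applied to h.\<close>
    have "ip h (R (R f)) = B h (R f)" using h f by (simp add: BR Rin)
    also have "\<dots> = (\<Sum>i. complex_of_real (sqrt_coeff i) * B ((A ^^ i) h) f)"
      unfolding B_def[of h] using BR[OF Ain[OF h] f] by simp
    also have "\<dots> = (\<Sum>i. complex_of_real (sqrt_coeff i) * (\<Sum>j. complex_of_real (sqrt_coeff j) * ip ((A ^^ (i + j)) h) f))"
      unfolding B_def by (simp add: add.commute[of _ "_ :: nat"] flip: funpow_add[unfolded comp_def fun_eq_iff, rule_format])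
    also have "\<dots> = ip ((A ^^ 0) h) f - ip ((A ^^ 1) h) f"
      by (rule sqrt_coeff_double_sum[OF bnd[OF h f]])
    also have "\<dots> = ip h (\<lambda>z. f z - A f z)"
      using h f by (simp add: ip_diff_right lin_in[OF A] sa)
    finally show "ip h (R (R f)) = ip h (\<lambda>z. f z - A f z)" .
  qed
  ultimately show ?thesis by blast
qed

text \<open>Gliding hump: the signs are chosen so that the \<open>n\<close>-th step cannot decrease the pairing with
  the \<open>n\<close>-th vector, while all later steps together are at most half as large.\<close>

lemma weakly_bounded_imp_bounded:
  fixes y :: "nat \<Rightarrow> 'a \<Rightarrow> complex"
  assumes y: "\<And>n. y n \<in> H"
    and wb: "\<And>f. f \<in> H \<Longrightarrow> \<exists>C. \<forall>n. cmod (ip f (y n)) \<le> C"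
  shows "\<exists>C. \<forall>n. nrm (y n) \<le> C"
proof (rule ccontr)
  assume "\<not> ?thesis"
  hence "\<forall>n. \<exists>k. nrm (y k) > 4 ^ n" by (meson linorder_not_le)
  then obtain k where k: "\<And>n. nrm (y (k n)) > 4 ^ n" by metis
  \<comment> \<open>Vectors longer than 4^n are tested against steps of length 3^-(n+1): the steps
    are summable, while the pairings grow like (4/3)^n.\<close>
  define Y where "Y n = y (k n)" for n
  have Y: "Y n \<in> H" and Yn: "nrm (Y n) > 4 ^ n" for n using y k by (auto simp: Y_def)
  have Y0: "nrm (Y n) > 0" for n using Yn[of n] by (meson order.strict_trans zero_less_numeral zero_less_power)
  define u where "u n = (\<lambda>z. complex_of_real (1 / (3 ^ Suc n * nrm (Y n))) * Y n z)" for n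
  have u: "u n \<in> H" for n unfolding u_def by (intro H_scale Y)
  have nu: "nrm (u n) = 1 / 3 ^ Suc n" for n
    unfolding u_def nrm_scale[OF Y] using Y0[of n] by (simp add: norm_divide norm_mult norm_power)
  have iu: "cmod (ip (u n) (Y n)) = nrm (Y n) / 3 ^ Suc n" for n
    unfolding u_def ip_scale_left[OF Y Y] ip_self[OF Y] using Y0[of n]
    by (simp add: norm_divide norm_mult norm_power power2_eq_square)
  define st where "st n x = (if cmod (ip (\<lambda>z. x z + u n z) (Y n)) \<ge> nrm (Y n) / 3 ^ Suc n
     then (\<lambda>z. x z + u n z) else (\<lambda>z. x z - u n z))" for n x
  define x where "x = rec_nat (\<lambda>z. 0) st"
  have x_simps: "x 0 = (\<lambda>z. 0)" "x (Suc n) = st n (x n)" for n by (simp_all add: x_def)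
  have st_H: "st n f \<in> H" if "f \<in> H" for n f using that by (auto simp: st_def intro: H_closed u)
  have x: "x n \<in> H" for n by (induction n) (auto simp: x_simps H_zero st_H)
  \<comment> \<open>The pairings of f + u and f - u with Y differ by twice
    \<open>ip (u n) (Y n)\<close>, so they cannot both be smaller in modulus than that
    number.\<close>
  have st_big: "cmod (ip (st n f) (Y n)) \<ge> nrm (Y n) / 3 ^ Suc n" if f: "f \<in> H" for n f
  proof (cases "cmod (ip (\<lambda>z. f z + u n z) (Y n)) \<ge> nrm (Y n) / 3 ^ Suc n")
    case False
    have "2 * cmod (ip (u n) (Y n)) = cmod ((ip f (Y n) + ip (u n) (Y n)) - (ip f (Y n) - ip (u n) (Y n)))"
      by (simp add: norm_mult)
    also have "\<dots> \<le> cmod (ip f (Y n) + ip (u n) (Y n)) + cmod (ip f (Y n) - ip (u n) (Y n))"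
      by (rule norm_triangle_ineq4)
    finally show ?thesis using False f u Y iu[of n] by (simp add: st_def ip_simps)
  qed (simp add: st_def)
  have step: "nrm (\<lambda>z. x (Suc n) z - x n z) = 1 / 3 ^ Suc n" for n
    using nrm_scale[OF u[of n], of "-1"] nu[of n] by (auto simp: x_simps st_def)
  \<comment> \<open>Geometric series: the steps with indices j from n to n + m - 1 have lengths
    3^-(j+1), with sum (3^-n - 3^-(n+m)) / 2.\<close>
  have tail: "nrm (\<lambda>z. x (n + m) z - x n z) \<le> (1 / 3 ^ n - 1 / 3 ^ (n + m)) / 2" for n m
  proof (induction m)
    case (Suc m)
    have "nrm (\<lambda>z. x (n + Suc m) z - x n z) \<le> nrm (\<lambda>z. x (Suc (n + m)) z - x (n + m) z) + nrm (\<lambda>z. x (n + m) z - x n z)"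
      using nrm_triangle_diff[OF x x x] by simp
    also have "\<dots> \<le> 1 / 3 ^ Suc (n + m) + (1 / 3 ^ n - 1 / 3 ^ (n + m)) / 2"
      using Suc step by simp
    finally show ?case by (simp add: field_simps)
  qed (simp add: nrm_zero)
  have tail': "nrm (\<lambda>z. x m z - x n z) \<le> (1 / 3 ^ n) / 2" if "m \<ge> n" for m n
  proof -
    have "nrm (\<lambda>z. x m z - x n z) \<le> (1 / 3 ^ n - 1 / 3 ^ m) / 2"
      using tail[of n "m - n"] that by simp
    also have "\<dots> \<le> (1 / 3 ^ n) / 2" by (intro divide_right_mono) auto
    finally show ?thesis .
  qed
  have "\<exists>l\<in>H. (\<lambda>n. nrm (\<lambda>z. x n z - l z)) \<longlonglongrightarrow> 0"
  proof (rule complete_nrm[OF x])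
    fix e :: real assume e: "e > 0"
    obtain N where N: "(1/3::real) ^ N < e" using real_arch_pow_inv[OF e, of "1/3"] by auto
    have "nrm (\<lambda>z. x i z - x j z) < e" if "i \<ge> N" "j \<ge> N" for i j
    proof -
      have "nrm (\<lambda>z. x i z - x j z) \<le> nrm (\<lambda>z. x i z - x N z) + nrm (\<lambda>z. x N z - x j z)"
        by (rule nrm_triangle_diff[OF x x x])
      also have "nrm (\<lambda>z. x N z - x j z) = nrm (\<lambda>z. x j z - x N z)" by (rule nrm_minus_commute[OF x x])
      finally show ?thesis using tail'[OF that(1)] tail'[OF that(2)] N by (simp add: power_one_over)
    qed
    thus "\<exists>N. \<forall>m\<ge>N. \<forall>n\<ge>N. nrm (\<lambda>z. x m z - x n z) < e" by blast
  qed
  then obtain l where l: "l \<in> H" and lim: "(\<lambda>n. nrm (\<lambda>z. x n z - l z)) \<longlonglongrightarrow> 0" by blast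
  have lt: "nrm (\<lambda>z. l z - x n z) \<le> (1 / 3 ^ n) / 2" for n
  proof (rule LIMSEQ_le)
    show "(\<lambda>m::nat. nrm (\<lambda>z. l z - x n z)) \<longlonglongrightarrow> nrm (\<lambda>z. l z - x n z)" by simp
    show "(\<lambda>m. nrm (\<lambda>z. x m z - l z) + (1 / 3 ^ n) / 2) \<longlonglongrightarrow> (1 / 3 ^ n) / 2"
      using tendsto_add[OF lim tendsto_const[of "(1 / 3 ^ n) / 2"]] by simp
    have "nrm (\<lambda>z. l z - x n z) \<le> nrm (\<lambda>z. x m z - l z) + (1 / 3 ^ n) / 2" if "m \<ge> n" for m
      using nrm_triangle_diff[OF l x x, of n m] nrm_minus_commute[OF l x, of m] tail'[OF that] by linarith
    thus "\<exists>N. \<forall>m\<ge>N. nrm (\<lambda>z. l z - x n z) \<le> nrm (\<lambda>z. x m z - l z) + (1 / 3 ^ n) / 2" by blast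
  qed
  obtain C where C: "\<And>n. cmod (ip l (y n)) \<le> C" using wb[OF l] by blast
  \<comment> \<open>Step n guarantees |Y n| / 3^(n+1); all later steps cost at most half of that,
    which leaves |Y n| / 3^n / 6, more than (4/3)^n / 6.\<close>
  have low: "(4/3::real) ^ n / 6 \<le> C" for n
  proof -
    have "nrm (Y n) / 3 ^ Suc n \<le> cmod (ip (x (Suc n)) (Y n))" using st_big[OF x] by (simp only: x_simps)
    also have "ip (x (Suc n)) (Y n) = ip l (Y n) - ip (\<lambda>z. l z - x (Suc n) z) (Y n)"
      using l x Y by (simp add: ip_simps)
    also have "cmod \<dots> \<le> cmod (ip l (Y n)) + cmod (ip (\<lambda>z. l z - x (Suc n) z) (Y n))" by (rule norm_triangle_ineq4)
    also have "cmod (ip (\<lambda>z. l z - x (Suc n) z) (Y n)) \<le> (1 / 3 ^ Suc n) / 2 * nrm (Y n)"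
      using order_trans[OF cauchy_schwarz[OF H_diff[OF l x] Y] mult_right_mono[OF lt nrm_nonneg[OF Y]]] .
    also have "cmod (ip l (Y n)) \<le> C" using C by (simp add: Y_def)
    finally have "nrm (Y n) / 3 ^ n / 6 \<le> C" by simp
    moreover have "4 ^ n / 3 ^ n / 6 \<le> nrm (Y n) / 3 ^ n / 6"
      using Yn[of n] by (intro divide_right_mono) auto
    ultimately show ?thesis by (simp add: power_divide)
  qed
  obtain n where "6 * C < (4/3::real) ^ n" using real_arch_pow[of "4/3" "6 * C"] by auto
  thus False using low[of n] by simp
qed

end

section \<open>Rotation invariance and moments of the area measure\<close>

lemma measurable_Complex_pair [measurable]:
  "(\<lambda>(x, y). Complex x y) \<in> (lborel \<Otimes>\<^sub>M lborel) \<rightarrow>\<^sub>M (borel :: complex measure)"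
proof -
  have "(\<lambda>(x, y). Complex x y) \<in> borel_measurable (borel :: (real \<times> real) measure)"
    by (rule borel_measurable_continuous_onI) (auto simp: case_prod_unfold Complex_eq intro!: continuous_intros)
  thus ?thesis unfolding lborel_prod by simp
qed

text \<open>Comparing both measures on boxes suffices. This opens the complex plane to iterated
  integration.\<close>

lemma lborel_complex_eq_distr:
  "(lborel :: complex measure) = distr (lborel \<Otimes>\<^sub>M lborel) borel (\<lambda>(x, y). Complex x y)"
proof (rule lborel_eqI)
  fix l u :: complex
  assume le: "\<And>b. b \<in> Basis \<Longrightarrow> l \<bullet> b \<le> u \<bullet> b"
  have l: "Re l \<le> Re u" "Im l \<le> Im u" using le[of 1] le[of \<i>] by (auto simp: Basis_complex_def)
  have "emeasure (distr (lborel \<Otimes>\<^sub>M lborel) borel (\<lambda>(x, y). Complex x y)) (box l u) =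
        emeasure (lborel \<Otimes>\<^sub>M lborel) ({Re l<..<Re u} \<times> {Im l<..<Im u})"
    by (subst emeasure_distr) (auto intro!: arg_cong2[where f = emeasure] simp: in_box_complex_iff space_pair_measure)
  also have "\<dots> = ennreal (Re u - Re l) * ennreal (Im u - Im l)"
    using l by (subst lborel.emeasure_pair_measure_Times) auto
  also have "\<dots> = ennreal (\<Prod>b\<in>Basis. (u - l) \<bullet> b)"
    using l by (simp add: Basis_complex_def ennreal_mult)
  finally show "emeasure (distr (lborel \<Otimes>\<^sub>M lborel) borel (\<lambda>(x, y). Complex x y)) (box l u)
     = ennreal (\<Prod>b\<in>Basis. (u - l) \<bullet> b)" .
qed simp

lemma nn_integral_complex_iterated:
  assumes [measurable]: "f \<in> borel_measurable (borel :: complex measure)"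
  shows "(\<integral>\<^sup>+z. f z \<partial>lborel) = (\<integral>\<^sup>+x. \<integral>\<^sup>+y. f (Complex x y) \<partial>lborel \<partial>lborel)"
    and "(\<integral>\<^sup>+z. f z \<partial>lborel) = (\<integral>\<^sup>+y. \<integral>\<^sup>+x. f (Complex x y) \<partial>lborel \<partial>lborel)"
proof -
  have m [measurable]: "(\<lambda>(x, y). f (Complex x y)) \<in> borel_measurable (lborel \<Otimes>\<^sub>M lborel)"
    using measurable_compose[OF measurable_Complex_pair assms] by (simp add: case_prod_unfold)
  have *: "(\<integral>\<^sup>+z. f z \<partial>lborel) = (\<integral>\<^sup>+p. (\<lambda>(x, y). f (Complex x y)) p \<partial>(lborel \<Otimes>\<^sub>M lborel))"
    by (subst lborel_complex_eq_distr, subst nn_integral_distr) (auto simp: case_prod_unfold)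
  show "(\<integral>\<^sup>+z. f z \<partial>lborel) = (\<integral>\<^sup>+x. \<integral>\<^sup>+y. f (Complex x y) \<partial>lborel \<partial>lborel)"
    unfolding * by (subst lborel.nn_integral_fst[symmetric]) auto
  show "(\<integral>\<^sup>+z. f z \<partial>lborel) = (\<integral>\<^sup>+y. \<integral>\<^sup>+x. f (Complex x y) \<partial>lborel \<partial>lborel)"
    unfolding * by (subst lborel_pair.nn_integral_snd[symmetric]) auto
qed

lemma nn_integral_lborel_shift:
  assumes [measurable]: "f \<in> borel_measurable (borel :: real measure)"
  shows "(\<integral>\<^sup>+x. f (x + c) \<partial>lborel) = (\<integral>\<^sup>+x. f x \<partial>lborel)"
  by (subst (2) lborel_distr_plus[of c, symmetric], subst nn_integral_distr) (auto simp: add.commute)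

text \<open>On each horizontal, respectively vertical, line the map is a translation, so the inner
  integral does not change.\<close>

lemma nn_integral_shear:
  fixes t :: real
  assumes f [measurable]: "f \<in> borel_measurable (borel :: complex measure)"
  shows "(\<integral>\<^sup>+z. f (z + of_real (t * Im z)) \<partial>lborel) = (\<integral>\<^sup>+z. f z \<partial>lborel)"
    and "(\<integral>\<^sup>+z. f (z + \<i> * of_real (t * Re z)) \<partial>lborel) = (\<integral>\<^sup>+z. f z \<partial>lborel)"
proof -
  have [measurable]: "(\<lambda>x. Complex x y) \<in> borel \<rightarrow>\<^sub>M borel" "(\<lambda>y. Complex x y) \<in> borel \<rightarrow>\<^sub>M borel" for x y
    by (auto intro!: borel_measurable_continuous_onI continuous_intros simp: Complex_eq)
  have m1: "(\<lambda>z. f (z + of_real (t * Im z))) \<in> borel_measurable borel"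
    "(\<lambda>z. f (z + \<i> * of_real (t * Re z))) \<in> borel_measurable borel" by measurable
  have "(\<integral>\<^sup>+z. f (z + of_real (t * Im z)) \<partial>lborel) = (\<integral>\<^sup>+y. \<integral>\<^sup>+x. f (Complex (x + t * y) y) \<partial>lborel \<partial>lborel)"
    by (subst nn_integral_complex_iterated(2)[OF m1(1)]) (simp add: Complex_eq algebra_simps)
  also have "\<dots> = (\<integral>\<^sup>+y. \<integral>\<^sup>+x. f (Complex x y) \<partial>lborel \<partial>lborel)"
    by (intro nn_integral_cong nn_integral_lborel_shift[where f = "\<lambda>x. f (Complex x _)"]) measurable
  finally show "(\<integral>\<^sup>+z. f (z + of_real (t * Im z)) \<partial>lborel) = (\<integral>\<^sup>+z. f z \<partial>lborel)"
    by (simp add: nn_integral_complex_iterated(2)[OF f])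
  have "(\<integral>\<^sup>+z. f (z + \<i> * of_real (t * Re z)) \<partial>lborel) = (\<integral>\<^sup>+x. \<integral>\<^sup>+y. f (Complex x (y + t * x)) \<partial>lborel \<partial>lborel)"
    by (subst nn_integral_complex_iterated(1)[OF m1(2)]) (simp add: Complex_eq algebra_simps)
  also have "\<dots> = (\<integral>\<^sup>+x. \<integral>\<^sup>+y. f (Complex x y) \<partial>lborel \<partial>lborel)"
    by (intro nn_integral_cong nn_integral_lborel_shift[where f = "\<lambda>y. f (Complex _ y)"]) measurable
  finally show "(\<integral>\<^sup>+z. f (z + \<i> * of_real (t * Re z)) \<partial>lborel) = (\<integral>\<^sup>+z. f z \<partial>lborel)"
    by (simp add: nn_integral_complex_iterated(1)[OF f])
qed

text \<open>A rotation is a product of three shears.\<close>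

lemma nn_integral_rotate:
  assumes u: "cmod u = 1" "u \<noteq> -1"
    and f [measurable]: "f \<in> borel_measurable (borel :: complex measure)"
  shows "(\<integral>\<^sup>+z. f (u * z) \<partial>lborel) = (\<integral>\<^sup>+z. f z \<partial>lborel)"
proof -
  define c s where "c = Re u" and "s = Im u"
  have cs: "c\<^sup>2 + s\<^sup>2 = 1" using u(1) cmod_power2[of u] by (simp add: c_def s_def)
  have c: "1 + c \<noteq> 0"
  proof
    assume "1 + c = 0"
    hence "c = -1" by simp
    hence "u = -1" using cs by (simp add: complex_eq_iff c_def s_def)
    thus False using u by simp
  qed
  \<comment> \<open>For u = cis \<theta> this is -tan(\<theta>/2), from the standard factorisation
    of a rotation into shears; it is the reason for excluding u = -1.\<close>
  define t where "t = - s / (1 + c)"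
  have t1: "1 + t * s = c"
  proof -
    have "s * s = (1 - c) * (1 + c)" using cs by (simp add: power2_eq_square algebra_simps)
    thus ?thesis using c by (simp add: t_def field_simps)
  qed
  have t2: "t * c + t = - s"
  proof -
    have "t * (1 + c) = - s" using c by (simp add: t_def)
    thus ?thesis by (simp add: algebra_simps)
  qed
  define X where "X = (\<lambda>z. z + complex_of_real (t * Im z))"
  define Y where "Y = (\<lambda>z. z + \<i> * complex_of_real (s * Re z))"
  have [measurable]: "X \<in> borel_measurable borel" "Y \<in> borel_measurable borel"
    unfolding X_def Y_def by measurable
  have "X (Y (X z)) = u * z" for z
  proof (rule complex_eqI)
    have "Re (X (Y (X z))) = (1 + t * s) * Re z + (t + t * (1 + t * s)) * Im z"
      by (simp add: X_def Y_def algebra_simps)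
    also have "\<dots> = Re (u * z)" unfolding t1 using t2 by (simp add: c_def s_def algebra_simps)
    finally show "Re (X (Y (X z))) = Re (u * z)" .
    have "Im (X (Y (X z))) = s * Re z + (1 + t * s) * Im z"
      by (simp add: X_def Y_def algebra_simps)
    also have "\<dots> = Im (u * z)" unfolding t1 by (simp add: c_def s_def algebra_simps)
    finally show "Im (X (Y (X z))) = Im (u * z)" .
  qed
  hence "(\<integral>\<^sup>+z. f (u * z) \<partial>lborel) = (\<integral>\<^sup>+z. f (X (Y (X z))) \<partial>lborel)" by simp
  also have "\<dots> = (\<integral>\<^sup>+z. f (X (Y z)) \<partial>lborel)"
    using nn_integral_shear(1)[of "\<lambda>z. f (X (Y z))" t] by (simp add: X_def)
  also have "\<dots> = (\<integral>\<^sup>+z. f (X z) \<partial>lborel)"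
    using nn_integral_shear(2)[of "\<lambda>z. f (X z)" s] by (simp add: Y_def)
  also have "\<dots> = (\<integral>\<^sup>+z. f z \<partial>lborel)" using nn_integral_shear(1)[of f t] by (simp add: X_def)
  finally show ?thesis .
qed

lemma sets_disk_area: "sets disk_area = sets (restrict_space borel unit_disk)"
  by (simp add: disk_area_def sets_restrict_space cong: sets_restrict_space_cong)

lemma space_disk_area [simp]: "space disk_area = unit_disk"
  by (simp add: disk_area_def space_restrict_space)

lemma emeasure_unit_disk: "emeasure lborel unit_disk = ennreal pi"
  using emeasure_ball[of 1 "0 :: complex"] unit_ball_vol_even[of 1] by (simp add: unit_ball_vol_2)

lemma measurable_disk_area_iff: "borel_measurable disk_area = borel_measurable (restrict_space borel unit_disk)"
  by (rule measurable_cong_sets[OF sets_disk_area refl])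

lemma continuous_imp_measurable_disk_area:
  fixes f :: "complex \<Rightarrow> 'b::topological_space"
  assumes "continuous_on unit_disk f" shows "f \<in> borel_measurable disk_area"
  unfolding measurable_disk_area_iff by (rule borel_measurable_continuous_on_restrict[OF assms])

lemma nn_integral_disk_area:
  assumes f: "f \<in> borel_measurable disk_area"
  shows "(\<integral>\<^sup>+z. f z \<partial>disk_area) = (\<integral>\<^sup>+z. f z * indicator unit_disk z \<partial>lborel) / ennreal pi"
proof -
  have f': "f \<in> borel_measurable (restrict_space lborel unit_disk)"
    using f by (simp add: measurable_disk_area_iff cong: measurable_cong_sets sets_restrict_space_cong)
  have "(\<integral>\<^sup>+z. f z \<partial>disk_area) = (\<integral>\<^sup>+z. f z * indicator unit_disk z \<partial>restrict_space lborel unit_disk)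
      / emeasure (restrict_space lborel unit_disk) unit_disk"
    unfolding disk_area_def using f' by (intro nn_integral_uniform_measure) (auto simp: sets_restrict_space)
  also have "(\<integral>\<^sup>+z. f z * indicator unit_disk z \<partial>restrict_space lborel unit_disk) = (\<integral>\<^sup>+z. f z * indicator unit_disk z \<partial>lborel)"
    by (subst nn_integral_restrict_space) (auto intro!: nn_integral_cong simp: indicator_def)
  finally show ?thesis by (simp add: emeasure_restrict_space emeasure_unit_disk)
qed

lemma emeasure_disk_area:
  assumes "A \<in> sets borel"
  shows "emeasure disk_area (A \<inter> unit_disk) = emeasure lborel (A \<inter> unit_disk) / ennreal pi"
proof -
  have A: "A \<inter> unit_disk \<in> sets disk_area"
    using assms unfolding sets_disk_area sets_restrict_space by auto
  have "emeasure disk_area (A \<inter> unit_disk) = (\<integral>\<^sup>+z. indicator (A \<inter> unit_disk) z \<partial>disk_area)" using A by simp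
  also have "\<dots> = (\<integral>\<^sup>+z. indicator (A \<inter> unit_disk) z * indicator unit_disk z \<partial>lborel) / ennreal pi"
    using A by (intro nn_integral_disk_area) auto
  also have "(\<integral>\<^sup>+z. indicator (A \<inter> unit_disk) z * indicator unit_disk z \<partial>lborel)
      = (\<integral>\<^sup>+z. indicator (A \<inter> unit_disk) z \<partial>lborel)"
    by (intro nn_integral_cong) (auto simp: indicator_def)
  also have "\<dots> = emeasure lborel (A \<inter> unit_disk)" using assms by (intro nn_integral_indicator) auto
  finally show ?thesis .
qed

lemma disk_area_rotate:
  assumes u: "cmod u = 1" "u \<noteq> -1"
  shows "(*) u \<in> disk_area \<rightarrow>\<^sub>M disk_area" and "distr disk_area disk_area ((*) u) = disk_area"
proof -
  have meas: "(*) u \<in> borel \<rightarrow>\<^sub>M borel" by (intro borel_measurable_continuous_onI continuous_intros)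
  show M: "(*) u \<in> disk_area \<rightarrow>\<^sub>M disk_area"
    using u meas by (auto intro!: measurable_restrict_space3 simp: measurable_cong_sets[OF sets_disk_area sets_disk_area] norm_mult)
  show "distr disk_area disk_area ((*) u) = disk_area"
  proof (rule measure_eqI)
    fix A assume "A \<in> sets (distr disk_area disk_area ((*) u))"
    hence A: "A \<in> sets disk_area" by simp
    then obtain B where B: "B \<in> sets borel" "A = B \<inter> unit_disk"
      by (auto simp: sets_disk_area sets_restrict_space)
    have B': "(*) u -` B \<in> sets borel" using measurable_sets[OF meas B(1)] by simp
    have "emeasure (distr disk_area disk_area ((*) u)) A = emeasure disk_area ((*) u -` B \<inter> unit_disk)"
      using u by (subst emeasure_distr[OF M A]) (auto intro!: arg_cong[where f = "emeasure disk_area"] simp: B norm_mult)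
    also have "\<dots> = emeasure lborel ((*) u -` B \<inter> unit_disk) / ennreal pi" by (rule emeasure_disk_area[OF B'])
    also have "emeasure lborel ((*) u -` B \<inter> unit_disk) = (\<integral>\<^sup>+z. indicator ((*) u -` B \<inter> unit_disk) z \<partial>lborel)"
      using B' by (intro nn_integral_indicator[symmetric]) auto
    also have "\<dots> = (\<integral>\<^sup>+z. indicator (B \<inter> unit_disk) (u * z) \<partial>lborel)"
      using u by (intro nn_integral_cong) (auto simp: indicator_def norm_mult)
    also have "\<dots> = (\<integral>\<^sup>+z. indicator (B \<inter> unit_disk) z \<partial>lborel)"
      using B by (intro nn_integral_rotate u borel_measurable_indicator) auto
    also have "\<dots> = emeasure lborel (B \<inter> unit_disk)" using B by (intro nn_integral_indicator) auto
    also have "\<dots> / ennreal pi = emeasure disk_area A" using emeasure_disk_area[OF B(1)] B by simp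
    finally show "emeasure (distr disk_area disk_area ((*) u)) A = emeasure disk_area A" .
  qed simp
qed

lemma emeasure_disk_area_space: "emeasure disk_area unit_disk = 1"
  using emeasure_disk_area[of UNIV] by (simp add: emeasure_unit_disk ennreal_divide_self)

interpretation disk_area: finite_measure disk_area
  by standard (simp add: emeasure_disk_area_space)

text \<open>The part of the disk with |z|^2 > x has normalised area 1 - x, so |z|^2 is uniformly
  distributed on (0,1). Radial integrals thus become one-dimensional without polar
  coordinates.\<close>

lemma distr_disk_area_norm_sq:
  "distr disk_area borel (\<lambda>z. (cmod z)\<^sup>2) = density lborel (indicator {0<..<1})"
proof (rule measure_eqI_lessThan)
  have M: "(\<lambda>z. (cmod z)\<^sup>2) \<in> disk_area \<rightarrow>\<^sub>M borel"
    by (intro continuous_imp_measurable_disk_area continuous_intros)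
  fix x :: real
  have L: "emeasure (distr disk_area borel (\<lambda>z. (cmod z)\<^sup>2)) {x<..} = emeasure disk_area ({z. x < (cmod z)\<^sup>2} \<inter> unit_disk)"
    by (subst emeasure_distr[OF M]) (auto intro!: arg_cong[where f = "emeasure disk_area"])
  have "emeasure disk_area ({z. x < (cmod z)\<^sup>2} \<inter> unit_disk) = ennreal (1 - max 0 (min 1 x))"
  proof (cases "0 \<le> x \<and> x < 1")
    case True
    have sub: "cball (0::complex) (sqrt x) \<subseteq> unit_disk" using True real_sqrt_lt_1_iff[of x] by (auto intro: le_less_trans simp del: real_sqrt_lt_1_iff)
    have eq: "{z. x < (cmod z)\<^sup>2} \<inter> unit_disk = (unit_disk - cball 0 (sqrt x)) \<inter> unit_disk"
    proof -
      have "x < (cmod z)\<^sup>2 \<longleftrightarrow> \<not> cmod z \<le> sqrt x" for z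
        using real_sqrt_less_iff[of x "(cmod z)\<^sup>2"] by (simp add: not_le)
      thus ?thesis by (simp only: set_eq_iff Int_iff Diff_iff mem_Collect_eq mem_cball_0) blast
    qed
    have "emeasure disk_area ({z. x < (cmod z)\<^sup>2} \<inter> unit_disk) = emeasure lborel (unit_disk - cball (0::complex) (sqrt x)) / ennreal pi"
      unfolding eq by (subst emeasure_disk_area) (auto intro!: arg_cong[where f = "\<lambda>A. emeasure lborel A / _"])
    also have "emeasure lborel (unit_disk - cball (0::complex) (sqrt x)) = emeasure lborel unit_disk - emeasure lborel (cball (0::complex) (sqrt x))"
      using sub True by (intro emeasure_Diff) (auto simp: emeasure_cball)
    also have "\<dots> = ennreal (pi * (1 - x))"
      using True by (simp add: emeasure_unit_disk emeasure_cball unit_ball_vol_2 ennreal_minus algebra_simps)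
    finally show ?thesis using True by (simp add: divide_ennreal)
  next
    case False
    show ?thesis
    proof (cases "x < 0")
      case True
      hence "{z. x < (cmod z)\<^sup>2} = UNIV" by (auto intro: less_le_trans)
      thus ?thesis using True emeasure_disk_area_space by simp
    next
      case False
      hence "x \<ge> 1" using \<open>\<not> (0 \<le> x \<and> x < 1)\<close> by simp
      have "{z. x < (cmod z)\<^sup>2} \<inter> unit_disk = {}"
      proof -
        have "(cmod z)\<^sup>2 \<le> x" if "cmod z < 1" for z
          using that \<open>x \<ge> 1\<close> power_le_one[of "cmod z" 2] by simp
        thus ?thesis by (force simp: not_less)
      qed
      thus ?thesis using \<open>x \<ge> 1\<close> by simp
    qed
  qed
  moreover have "emeasure (density lborel (indicator {0<..<1})) {x<..} = ennreal (1 - max 0 (min 1 x))"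
  proof -
    have "emeasure (density lborel (indicator {0<..<1})) {x<..} = (\<integral>\<^sup>+t. indicator {0<..<1} t * indicator {x<..} t \<partial>lborel)"
      by (rule emeasure_density) auto
    also have "\<dots> = (\<integral>\<^sup>+t. indicator {max 0 (min 1 x)<..<1} t \<partial>lborel)"
      by (intro nn_integral_cong) (auto simp: indicator_def max_def min_def)
    also have "\<dots> = ennreal (1 - max 0 (min 1 x))" by simp
    finally show ?thesis .
  qed
  ultimately show "emeasure (distr disk_area borel (\<lambda>z. (cmod z)\<^sup>2)) {x<..} = emeasure (density lborel (indicator {0<..<1})) {x<..}"
    using L by simp
  show "emeasure (distr disk_area borel (\<lambda>z. (cmod z)\<^sup>2)) {x<..} < \<infinity>"
    using L \<open>emeasure disk_area _ = ennreal _\<close> by simp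
qed auto

text \<open>With t = |z|^2 uniform on (0,1) the moment is Euler's integral for the Beta
  function.\<close>

lemma disk_moment:
  assumes \<beta>: "\<beta> > -1"
  shows "(\<integral>\<^sup>+z. ennreal ((1 - (cmod z)\<^sup>2) powr \<beta> * (cmod z) ^ (2 * n)) \<partial>disk_area) = ennreal (Beta (real n + 1) (\<beta> + 1))"
proof -
  have M: "(\<lambda>z. (cmod z)\<^sup>2) \<in> disk_area \<rightarrow>\<^sub>M borel"
    by (intro continuous_imp_measurable_disk_area continuous_intros)
  define h where "h t = ennreal ((1 - t) powr \<beta> * t ^ n)" for t :: real
  have [measurable]: "h \<in> borel_measurable borel" unfolding h_def by measurable
  have "(\<integral>\<^sup>+z. ennreal ((1 - (cmod z)\<^sup>2) powr \<beta> * (cmod z) ^ (2 * n)) \<partial>disk_area) = (\<integral>\<^sup>+z. h ((cmod z)\<^sup>2) \<partial>disk_area)"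
    by (simp add: h_def power_mult)
  also have "\<dots> = (\<integral>\<^sup>+t. h t \<partial>distr disk_area borel (\<lambda>z. (cmod z)\<^sup>2))"
    by (rule nn_integral_distr[OF M, symmetric]) simp
  also have "\<dots> = (\<integral>\<^sup>+t. indicator {0<..<1} t * h t \<partial>lborel)"
    unfolding distr_disk_area_norm_sq by (rule nn_integral_density) auto
  also have "\<dots> = (\<integral>\<^sup>+t. ennreal (t powr (real n + 1 - 1) * (1 - t) powr (\<beta> + 1 - 1)) * indicator {0<..<1} t \<partial>lborel)"
    by (intro nn_integral_cong) (auto simp: h_def indicator_def powr_realpow mult_ac)
  also have "\<dots> = ennreal (Beta (real n + 1) (\<beta> + 1))"
    using has_integral_Beta_real[of "real n + 1" "\<beta> + 1"] \<beta>
    by (intro nn_integral_has_integral_lebesgue') (auto simp: has_integral_Icc_iff_Ioo)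
  finally show ?thesis .
qed

lemma integrable_disk_area_bounded:
  fixes f :: "complex \<Rightarrow> 'b::{banach, second_countable_topology}"
  assumes "f \<in> borel_measurable disk_area" "\<And>z. cmod z < 1 \<Longrightarrow> norm (f z) \<le> B"
  shows "integrable disk_area f"
  by (rule disk_area.integrable_const_bound[of _ B]) (use assms in auto)

text \<open>Rotation by u leaves the integral unchanged but multiplies the integrand by
  \<open>u ^ n * cnj (u ^ m)\<close>, so the integral vanishes as soon as this factor differs from
  1.\<close>

lemma monomials_orthogonal:
  fixes W :: "real \<Rightarrow> real"
  assumes nm: "n \<noteq> m"
    and W: "(\<lambda>z. W (cmod z)) \<in> borel_measurable disk_area"
    and bd: "\<And>t. 0 \<le> t \<Longrightarrow> t < 1 \<Longrightarrow> \<bar>W t\<bar> \<le> B"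
  shows "(LINT z|disk_area. complex_of_real (W (cmod z)) * (z ^ n * cnj (z ^ m))) = 0"
proof -
  define d where "d = (if n < m then m - n else n - m)"
  have d: "d > 0" using nm by (auto simp: d_def)
  \<comment> \<open>A rotation with u^d = i, d = |n - m|, makes the factor i or -i. Its angle is at
    most pi/2, hence u is not -1 and rotation invariance applies.\<close>
  define u where "u = cis (pi / (2 * d))"
  have ud: "u ^ d = \<i>" unfolding u_def Complex.DeMoivre using d by simp
  have u1: "cmod u = 1" by (simp add: u_def)
  have u2: "u \<noteq> -1"
  proof
    assume "u = -1"
    hence "Re u = -1" by simp
    have "pi / (2 * real d) \<le> pi / 2" using d by (intro divide_left_mono) auto
    moreover have "0 \<le> pi / (2 * real d)" by simp
    ultimately have "cos (pi / (2 * real d)) \<ge> 0" by (intro cos_ge_zero) linarith+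
    hence "Re u \<ge> 0" by (simp add: u_def)
    thus False using \<open>Re u = -1\<close> by simp
  qed
  have uc: "u * cnj u = 1" using complex_norm_square[of u] u1 by simp
  have uu: "u ^ n * cnj (u ^ m) \<noteq> 1"
  proof (cases "n < m")
    case True
    hence "u ^ n * cnj (u ^ m) = (u * cnj u) ^ n * cnj (u ^ d)"
      by (simp add: d_def power_mult_distrib power_add[symmetric] mult.assoc)
    hence E: "u ^ n * cnj (u ^ m) = - \<i>" using uc by (simp add: ud)
    show ?thesis unfolding E by (simp add: complex_eq_iff)
  next
    case False
    hence "u ^ n * cnj (u ^ m) = (u * cnj u) ^ m * u ^ d"
      by (simp add: d_def power_mult_distrib power_add[symmetric] mult_ac)
    hence E: "u ^ n * cnj (u ^ m) = \<i>" using uc by (simp add: ud)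
    show ?thesis unfolding E by (simp add: complex_eq_iff)
  qed
  define g where "g z = complex_of_real (W (cmod z)) * (z ^ n * cnj (z ^ m))" for z
  have g: "g \<in> borel_measurable disk_area"
    unfolding g_def
    by (rule borel_measurable_times[OF measurable_compose[OF W borel_measurable_of_real] continuous_imp_measurable_disk_area])
      (intro continuous_intros)
  have "(LINT z|disk_area. g z) = (LINT z|distr disk_area disk_area ((*) u). g z)"
    by (simp add: disk_area_rotate(2)[OF u1 u2])
  also have "\<dots> = (LINT z|disk_area. g (u * z))"
    by (rule integral_distr[OF disk_area_rotate(1)[OF u1 u2] g])
  also have "\<dots> = (LINT z|disk_area. (u ^ n * cnj (u ^ m)) * g z)"
    using u1 by (intro Bochner_Integration.integral_cong) (auto simp: g_def norm_mult power_mult_distrib)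
  also have "\<dots> = (u ^ n * cnj (u ^ m)) * (LINT z|disk_area. g z)" by simp
  finally have "(1 - u ^ n * cnj (u ^ m)) * (LINT z|disk_area. g z) = 0" by (simp add: algebra_simps)
  thus ?thesis using uu by (simp add: g_def)
qed

text \<open>A weight that vanishes from r < 1 on confines the integral to a disk where the partial
  sums are uniformly bounded, so orthogonality of the monomials passes to the limit by dominated
  convergence. The series stays inside the integral on the right so that the truncation can be
  removed from both sides by the same monotone limit.\<close>

lemma parseval_truncated:
  fixes W :: "real \<Rightarrow> real"
  assumes W: "(\<lambda>z. W (cmod z)) \<in> borel_measurable disk_area"
    and bd: "\<And>t. 0 \<le> t \<Longrightarrow> t < 1 \<Longrightarrow> 0 \<le> W t \<and> W t \<le> B"
    and r: "0 < r" "r < 1" "\<And>t. r \<le> t \<Longrightarrow> W t = 0"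
    and f: "f \<in> borel_measurable disk_area" "\<And>z. cmod z < 1 \<Longrightarrow> (\<lambda>n. a n * z ^ n) sums f z"
  shows "(\<integral>\<^sup>+z. ennreal (W (cmod z) * (cmod (f z))\<^sup>2) \<partial>disk_area)
       = (\<integral>\<^sup>+z. (\<Sum>n. ennreal (W (cmod z) * ((cmod (a n))\<^sup>2 * cmod z ^ (2 * n)))) \<partial>disk_area)"
proof -
  have B: "B \<ge> 0" using bd[of 0] by simp
  define s where "s N z = (\<Sum>n<N. a n * z ^ n)" for N z
  have sm: "s N \<in> borel_measurable disk_area" for N
    unfolding s_def by (intro continuous_imp_measurable_disk_area continuous_intros)
  have cm: "(\<lambda>z. cmod z) \<in> borel_measurable disk_area"
    by (intro continuous_imp_measurable_disk_area continuous_intros)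
  define M where "M = (\<Sum>n. cmod (a n) * r ^ n)"
  have asum: "summable (\<lambda>n. cmod (a n) * r ^ n)"
  proof -
    \<comment> \<open>Convergence at a radius strictly between r and 1 gives absolute convergence at
      r.\<close>
    define \<rho> where "\<rho> = (r + 1) / 2"
    have \<rho>: "r < \<rho>" "\<rho> < 1" "0 < \<rho>" using r by (auto simp: \<rho>_def)
    have "summable (\<lambda>n. a n * complex_of_real \<rho> ^ n)" using f(2)[of "of_real \<rho>"] \<rho> by (auto simp: sums_iff)
    hence "summable (\<lambda>n. norm (a n * complex_of_real r ^ n))"
      by (rule powser_insidea) (use \<rho> r in auto)
    thus ?thesis using r by (simp add: norm_mult norm_power)
  qed
  have termbd: "cmod (a n * z ^ n) \<le> cmod (a n) * r ^ n" if "cmod z \<le> r" for n z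
    using that by (simp add: norm_mult norm_power mult_left_mono power_mono)
  have sbd: "cmod (s N z) \<le> M" if z: "cmod z \<le> r" for N z
  proof -
    have "cmod (s N z) \<le> (\<Sum>n<N. cmod (a n) * r ^ n)"
      unfolding s_def using termbd[OF z] by (intro sum_norm_le) auto
    also have "\<dots> \<le> M" unfolding M_def using asum r by (intro sum_le_suminf) auto
    finally show ?thesis .
  qed
  have slim: "(\<lambda>N. s N z) \<longlonglongrightarrow> f z" if "cmod z < 1" for z
    using f(2)[OF that] by (simp add: sums_def s_def)
  define c where "c n = (LINT z|disk_area. W (cmod z) * cmod z ^ (2 * n))" for n
  have Wint: "integrable disk_area (\<lambda>z. complex_of_real (W (cmod z)) * (z ^ n * cnj (z ^ m)))" for n m
  proof (rule integrable_disk_area_bounded[where B = B])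
    show "(\<lambda>z. complex_of_real (W (cmod z)) * (z ^ n * cnj (z ^ m))) \<in> borel_measurable disk_area"
      by (rule borel_measurable_times[OF measurable_compose[OF W borel_measurable_of_real] continuous_imp_measurable_disk_area])
        (intro continuous_intros)
    fix z :: complex assume z: "cmod z < 1"
    have "cmod z ^ n * cmod z ^ m \<le> 1"
      using z by (simp add: mult_le_one power_le_one)
    hence "\<bar>W (cmod z)\<bar> * (cmod z ^ n * cmod z ^ m) \<le> B * 1"
      using bd[of "cmod z"] z B by (intro mult_mono) auto
    thus "norm (complex_of_real (W (cmod z)) * (z ^ n * cnj (z ^ m))) \<le> B"
      by (simp add: norm_mult norm_power)
  qed
  have mono_int: "integrable disk_area (\<lambda>z. W (cmod z) * cmod z ^ (2 * n))" for n
  proof -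
    have "complex_of_real (W (cmod z)) * (z ^ n * cnj (z ^ n)) = complex_of_real (W (cmod z) * cmod z ^ (2 * n))" for z
      using complex_norm_square[of "z ^ n"] by (simp add: norm_power power_mult power2_eq_square power_mult_distrib)
    with Wint[of n n] have "integrable disk_area (\<lambda>z. complex_of_real (W (cmod z) * cmod z ^ (2 * n)))"
      by (simp only:)
    from integrable_Re[OF this] show ?thesis by simp
  qed
  have orth: "(LINT z|disk_area. complex_of_real (W (cmod z)) * (z ^ n * cnj (z ^ m))) = (if n = m then complex_of_real (c n) else 0)" for n m
  proof (cases "n = m")
    case True
    have "complex_of_real (W (cmod z)) * (z ^ n * cnj (z ^ n)) = complex_of_real (W (cmod z) * cmod z ^ (2 * n))" for z
      using complex_norm_square[of "z ^ n"] by (simp add: norm_power power_mult power2_eq_square power_mult_distrib)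
    thus ?thesis using True by (simp add: c_def del: of_real_mult)
  next
    case False
    thus ?thesis using monomials_orthogonal[OF False W, of B] bd by (auto simp: abs_of_nonneg)
  qed
  have fin: "(LINT z|disk_area. W (cmod z) * (cmod (s N z))\<^sup>2) = (\<Sum>n<N. (cmod (a n))\<^sup>2 * c n)" for N
  proof -
    have ex: "complex_of_real (W (cmod z) * (cmod (s N z))\<^sup>2) =
        (\<Sum>n<N. \<Sum>m<N. (a n * cnj (a m)) * (complex_of_real (W (cmod z)) * (z ^ n * cnj (z ^ m))))" for z
    proof -
      have "complex_of_real (W (cmod z) * (cmod (s N z))\<^sup>2) = complex_of_real (W (cmod z)) * (s N z * cnj (s N z))"
        by (simp only: of_real_mult complex_norm_square)
      also have "s N z * cnj (s N z) = (\<Sum>n<N. \<Sum>m<N. (a n * z ^ n) * cnj (a m * z ^ m))"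
        by (simp add: s_def sum_product)
      finally show ?thesis by (simp add: sum_distrib_left mult_ac)
    qed
    have "complex_of_real (LINT z|disk_area. W (cmod z) * (cmod (s N z))\<^sup>2)
        = (LINT z|disk_area. (\<Sum>n<N. \<Sum>m<N. (a n * cnj (a m)) * (complex_of_real (W (cmod z)) * (z ^ n * cnj (z ^ m)))))"
      by (simp only: integral_complex_of_real[symmetric] ex)
    also have "\<dots> = (\<Sum>n<N. \<Sum>m<N. (a n * cnj (a m)) * (LINT z|disk_area. complex_of_real (W (cmod z)) * (z ^ n * cnj (z ^ m))))"
      using Wint by (simp add: Bochner_Integration.integral_sum)
    also have "\<dots> = (\<Sum>n<N. (a n * cnj (a n)) * complex_of_real (c n))"
      unfolding orth by (simp add: if_distrib[where f = "\<lambda>x. _ * x"] sum.delta cong: if_cong)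
    also have "\<dots> = complex_of_real (\<Sum>n<N. (cmod (a n))\<^sup>2 * c n)"
      by (simp only: of_real_sum of_real_mult complex_norm_square)
    finally show ?thesis by (simp only: of_real_eq_iff)
  qed
  have fbd: "W (cmod z) * (cmod (f z))\<^sup>2 \<le> B * M\<^sup>2" if z: "cmod z < 1" for z
  proof (cases "cmod z \<le> r")
    case True
    have "cmod (f z) \<le> M" using tendsto_norm[OF slim[OF z]] sbd[OF True] by (intro LIMSEQ_le_const2[of _ "cmod (f z)"]) auto
    thus ?thesis using bd[of "cmod z"] z B by (intro mult_mono power_mono) auto
  qed (use r(3)[of "cmod z"] B in auto)
  have sbd': "norm (W (cmod z) * (cmod (s N z))\<^sup>2) \<le> B * M\<^sup>2" if z: "cmod z < 1" for N z
  proof (cases "cmod z \<le> r")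
    case True
    show ?thesis using sbd[OF True, of N] bd[of "cmod z"] z B by (auto intro!: mult_mono power_mono simp: abs_mult)
  qed (use r(3)[of "cmod z"] B in auto)
  have Fint: "integrable disk_area (\<lambda>z. W (cmod z) * (cmod (f z))\<^sup>2)"
  proof (rule integrable_disk_area_bounded[where B = "B * M\<^sup>2"])
    show "(\<lambda>z. W (cmod z) * (cmod (f z))\<^sup>2) \<in> borel_measurable disk_area" using W f(1) by measurable
    show "norm (W (cmod z) * (cmod (f z))\<^sup>2) \<le> B * M\<^sup>2" if "cmod z < 1" for z
      using fbd[OF that] bd[of "cmod z"] that by simp
  qed
  have "(\<lambda>N. LINT z|disk_area. W (cmod z) * (cmod (s N z))\<^sup>2) \<longlonglongrightarrow> (LINT z|disk_area. W (cmod z) * (cmod (f z))\<^sup>2)"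
  proof (rule integral_dominated_convergence[where w = "\<lambda>_. B * M\<^sup>2"])
    show "(\<lambda>z. W (cmod z) * (cmod (f z))\<^sup>2) \<in> borel_measurable disk_area" using W f(1) by measurable
    show "(\<lambda>z. W (cmod z) * (cmod (s N z))\<^sup>2) \<in> borel_measurable disk_area" for N using W sm by measurable
    show "AE z in disk_area. (\<lambda>N. W (cmod z) * (cmod (s N z))\<^sup>2) \<longlonglongrightarrow> W (cmod z) * (cmod (f z))\<^sup>2"
      by (auto intro!: AE_I2 tendsto_intros slim)
    show "AE z in disk_area. norm (W (cmod z) * (cmod (s N z))\<^sup>2) \<le> B * M\<^sup>2" for N
      using sbd' by (intro AE_I2) auto
  qed simp
  hence S: "(\<lambda>n. (cmod (a n))\<^sup>2 * c n) sums (LINT z|disk_area. W (cmod z) * (cmod (f z))\<^sup>2)"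
    unfolding fin sums_def .
  have c0: "c n \<ge> 0" for n unfolding c_def using bd by (intro integral_nonneg_AE AE_I2) auto
  have "(\<integral>\<^sup>+z. ennreal (W (cmod z) * (cmod (f z))\<^sup>2) \<partial>disk_area) = ennreal (LINT z|disk_area. W (cmod z) * (cmod (f z))\<^sup>2)"
    using bd by (intro nn_integral_eq_integral Fint AE_I2) auto
  also have "\<dots> = (\<Sum>n. ennreal ((cmod (a n))\<^sup>2 * c n))"
    using S c0 by (simp add: sums_iff suminf_ennreal2)
  also have "\<dots> = (\<Sum>n. \<integral>\<^sup>+z. ennreal (W (cmod z) * ((cmod (a n))\<^sup>2 * cmod z ^ (2 * n))) \<partial>disk_area)"
  proof (rule suminf_cong)
    fix n
    have "(cmod (a n))\<^sup>2 * c n = (LINT z|disk_area. W (cmod z) * ((cmod (a n))\<^sup>2 * cmod z ^ (2 * n)))"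
      unfolding c_def by (subst integral_mult_right_zero[symmetric]) (simp add: mult_ac)
    moreover have "integrable disk_area (\<lambda>z. W (cmod z) * ((cmod (a n))\<^sup>2 * cmod z ^ (2 * n)))"
      using integrable_mult_right[OF mono_int[of n], of "(cmod (a n))\<^sup>2"] by (simp add: mult_ac)
    ultimately show "ennreal ((cmod (a n))\<^sup>2 * c n) = (\<integral>\<^sup>+z. ennreal (W (cmod z) * ((cmod (a n))\<^sup>2 * cmod z ^ (2 * n))) \<partial>disk_area)"
      using bd by (subst nn_integral_eq_integral) auto
  qed
  also have "\<dots> = (\<integral>\<^sup>+z. (\<Sum>n. ennreal (W (cmod z) * ((cmod (a n))\<^sup>2 * cmod z ^ (2 * n)))) \<partial>disk_area)"
  proof (rule nn_integral_suminf[symmetric])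
    have "(\<lambda>z. (cmod (a n))\<^sup>2 * cmod z ^ (2 * n)) \<in> borel_measurable disk_area" for n
      using cm by measurable
    thus "(\<lambda>z. ennreal (W (cmod z) * ((cmod (a n))\<^sup>2 * cmod z ^ (2 * n)))) \<in> borel_measurable disk_area" for n
      using W by measurable
  qed
  finally show ?thesis .
qed

text \<open>Monotone convergence along concentric disks. The shift by 2 makes every radius positive,
  as the truncated identity requires.\<close>

lemma nn_integral_disk_area_SUP:
  assumes G: "G \<in> borel_measurable disk_area"
  shows "(\<integral>\<^sup>+z. G z \<partial>disk_area) = (SUP j. \<integral>\<^sup>+z. indicator (ball 0 (1 - 1 / (real j + 2))) z * G z \<partial>disk_area)"
proof -
  let ?I = "\<lambda>j::nat. indicator (ball 0 (1 - 1 / (real j + 2))) :: complex \<Rightarrow> ennreal"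
  have I: "?I j \<in> borel_measurable disk_area" for j
    unfolding measurable_disk_area_iff by (intro measurable_restrict_space1 borel_measurable_indicator) simp
  have "(SUP j. \<integral>\<^sup>+z. ?I j z * G z \<partial>disk_area) = (\<integral>\<^sup>+z. (SUP j. ?I j z * G z) \<partial>disk_area)"
  proof (rule nn_integral_monotone_convergence_SUP[symmetric])
    have "1 - 1 / (real i + 2) \<le> 1 - 1 / (real j + 2)" if "i \<le> j" for i j
      using that by (simp add: frac_le)
    thus "incseq (\<lambda>j z. ?I j z * G z)"
      by (force simp: incseq_def le_fun_def indicator_def)
    show "(\<lambda>z. ?I j z * G z) \<in> borel_measurable disk_area" for j using I G by measurable
  qed
  also have "\<dots> = (\<integral>\<^sup>+z. G z \<partial>disk_area)"
  proof (rule nn_integral_cong)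
    fix z assume "z \<in> space disk_area"
    hence z: "cmod z < 1" by simp
    then obtain j :: nat where j: "1 / (1 - cmod z) < real j" using reals_Archimedean2 by blast
    have "1 < (1 - cmod z) * (real j + 2)" using j z by (simp add: field_simps)
    hence "cmod z < 1 - 1 / (real j + 2)" by (simp add: field_simps)
    hence "?I j z * G z = G z" by simp
    moreover have "?I i z * G z \<le> G z" for i by (auto simp: indicator_def)
    ultimately show "(SUP j. ?I j z * G z) = G z"
      by (intro antisym SUP_least) (auto intro: SUP_upper2[of j])
  qed
  finally show ?thesis ..
qed

text \<open>Both sides of the truncated identity increase to the full ones. In
  \<open>ennreal\<close> the identity also holds when both sides are infinite, so it decides
  integrability as well.\<close>

lemma parseval_nn:
  assumes \<beta>: "\<beta> > -1"
    and f: "continuous_on unit_disk f" "\<And>z. cmod z < 1 \<Longrightarrow> (\<lambda>n. a n * z ^ n) sums f z"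
  shows "(\<integral>\<^sup>+z. ennreal ((1 - (cmod z)\<^sup>2) powr \<beta> * (cmod (f z))\<^sup>2) \<partial>disk_area)
       = (\<Sum>n. ennreal ((cmod (a n))\<^sup>2 * Beta (real n + 1) (\<beta> + 1)))"
proof -
  have pos: "0 < 1 - (cmod z)\<^sup>2" if "cmod z < 1" for z :: complex
    using that power_less_one_iff[of "cmod z" 2] by simp
  have fm: "f \<in> borel_measurable disk_area" by (rule continuous_imp_measurable_disk_area[OF f(1)])
  have cm: "(\<lambda>z. cmod z) \<in> borel_measurable disk_area"
    by (intro continuous_imp_measurable_disk_area continuous_intros)
  let ?G1 = "\<lambda>z. ennreal ((1 - (cmod z)\<^sup>2) powr \<beta> * (cmod (f z))\<^sup>2)"
  let ?G2 = "\<lambda>z. \<Sum>n. ennreal ((1 - (cmod z)\<^sup>2) powr \<beta> * ((cmod (a n))\<^sup>2 * cmod z ^ (2 * n)))"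
  have G: "?G1 \<in> borel_measurable disk_area" "?G2 \<in> borel_measurable disk_area"
    using cm fm by measurable
  have trunc: "(\<integral>\<^sup>+z. indicator (ball 0 (1 - 1 / (real j + 2))) z * ?G1 z \<partial>disk_area)
      = (\<integral>\<^sup>+z. indicator (ball 0 (1 - 1 / (real j + 2))) z * ?G2 z \<partial>disk_area)" for j :: nat
  proof -
    define r where "r = 1 - 1 / (real j + 2)"
    have r: "0 < r" "r < 1" by (auto simp: r_def field_simps)
    define W where "W t = (if t < r then (1 - t\<^sup>2) powr \<beta> else 0)" for t :: real
    \<comment> \<open>For \<beta> \<ge> 0 the weight is at most 1; for negative \<beta> it increases
      with t and is at most its value at r. The sum of the two bounds serves both cases.\<close>
    have Wb: "0 \<le> W t \<and> W t \<le> 1 + (1 - r\<^sup>2) powr \<beta>" if "0 \<le> t" "t < 1" for t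
    proof (cases "t < r")
      case True
      have r2: "0 < 1 - r\<^sup>2" using r power_less_one_iff[of r 2] by simp
      have t2: "1 - r\<^sup>2 \<le> 1 - t\<^sup>2" "1 - t\<^sup>2 \<le> 1" using that True by (auto intro: power_mono)
      have "(1 - t\<^sup>2) powr \<beta> \<le> 1 + (1 - r\<^sup>2) powr \<beta>"
      proof (cases "\<beta> \<ge> 0")
        case True
        hence "(1 - t\<^sup>2) powr \<beta> \<le> 1 powr \<beta>" using t2 r2 by (intro powr_mono2) auto
        thus ?thesis by (simp add: add_increasing2)
      next
        case False
        hence "(1 - t\<^sup>2) powr \<beta> \<le> (1 - r\<^sup>2) powr \<beta>" using t2 r2 by (intro powr_mono2') auto
        thus ?thesis by simp
      qed
      thus ?thesis using True by (simp add: W_def)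
    qed (simp add: W_def add_nonneg_nonneg)
    have Wm: "(\<lambda>z. W (cmod z)) \<in> borel_measurable disk_area"
      unfolding W_def using cm by measurable
    have "(\<integral>\<^sup>+z. indicator (ball 0 r) z * ?G1 z \<partial>disk_area) = (\<integral>\<^sup>+z. ennreal (W (cmod z) * (cmod (f z))\<^sup>2) \<partial>disk_area)"
      by (intro nn_integral_cong) (auto simp: W_def indicator_def)
    also have "\<dots> = (\<integral>\<^sup>+z. (\<Sum>n. ennreal (W (cmod z) * ((cmod (a n))\<^sup>2 * cmod z ^ (2 * n)))) \<partial>disk_area)"
      using r Wb by (intro parseval_truncated[OF Wm _ _ _ _ fm f(2), where r = r and B = "1 + (1 - r\<^sup>2) powr \<beta>"]) (auto simp: W_def)
    also have "\<dots> = (\<integral>\<^sup>+z. indicator (ball 0 r) z * ?G2 z \<partial>disk_area)"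
      by (intro nn_integral_cong) (auto simp: W_def indicator_def)
    finally show ?thesis by (simp add: r_def)
  qed
  have "(\<integral>\<^sup>+z. ?G1 z \<partial>disk_area) = (SUP j. \<integral>\<^sup>+z. indicator (ball 0 (1 - 1 / (real j + 2))) z * ?G1 z \<partial>disk_area)"
    by (rule nn_integral_disk_area_SUP[OF G(1)])
  also have "\<dots> = (\<integral>\<^sup>+z. ?G2 z \<partial>disk_area)"
    unfolding trunc by (rule nn_integral_disk_area_SUP[OF G(2), symmetric])
  also have "\<dots> = (\<Sum>n. \<integral>\<^sup>+z. ennreal ((1 - (cmod z)\<^sup>2) powr \<beta> * ((cmod (a n))\<^sup>2 * cmod z ^ (2 * n))) \<partial>disk_area)"
    by (rule nn_integral_suminf) (use cm in measurable)
  also have "\<dots> = (\<Sum>n. ennreal ((cmod (a n))\<^sup>2 * Beta (real n + 1) (\<beta> + 1)))"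
  proof (rule suminf_cong)
    fix n
    have "(\<integral>\<^sup>+z. ennreal ((1 - (cmod z)\<^sup>2) powr \<beta> * ((cmod (a n))\<^sup>2 * cmod z ^ (2 * n))) \<partial>disk_area)
      = (\<integral>\<^sup>+z. ennreal ((cmod (a n))\<^sup>2) * ennreal ((1 - (cmod z)\<^sup>2) powr \<beta> * cmod z ^ (2 * n)) \<partial>disk_area)"
      by (intro nn_integral_cong) (simp add: ennreal_mult[symmetric] mult_ac)
    also have "\<dots> = ennreal ((cmod (a n))\<^sup>2) * (\<integral>\<^sup>+z. ennreal ((1 - (cmod z)\<^sup>2) powr \<beta> * cmod z ^ (2 * n)) \<partial>disk_area)"
      by (rule nn_integral_cmult) (use cm in measurable)
    also have "\<dots> = ennreal ((cmod (a n))\<^sup>2 * Beta (real n + 1) (\<beta> + 1))"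
      unfolding disk_moment[OF \<beta>] using \<beta> by (simp add: ennreal_mult' )
    finally show "(\<integral>\<^sup>+z. ennreal ((1 - (cmod z)\<^sup>2) powr \<beta> * ((cmod (a n))\<^sup>2 * cmod z ^ (2 * n))) \<partial>disk_area)
      = ennreal ((cmod (a n))\<^sup>2 * Beta (real n + 1) (\<beta> + 1))" .
  qed
  finally show ?thesis .
qed

lemma Beta_real_pos: "a > 0 \<Longrightarrow> b > 0 \<Longrightarrow> Beta a b > (0::real)"
  by (simp add: Beta_def)

lemma parseval:
  assumes \<beta>: "\<beta> > -1"
    and f: "continuous_on unit_disk f" "\<And>z. cmod z < 1 \<Longrightarrow> (\<lambda>n. a n * z ^ n) sums f z"
  shows "integrable disk_area (\<lambda>z. (1 - (cmod z)\<^sup>2) powr \<beta> * (cmod (f z))\<^sup>2) \<longleftrightarrow>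
      summable (\<lambda>n. (cmod (a n))\<^sup>2 * Beta (real n + 1) (\<beta> + 1))" (is "integrable _ ?F \<longleftrightarrow> summable ?c")
    and "summable (\<lambda>n. (cmod (a n))\<^sup>2 * Beta (real n + 1) (\<beta> + 1)) \<Longrightarrow>
      (LINT z|disk_area. (1 - (cmod z)\<^sup>2) powr \<beta> * (cmod (f z))\<^sup>2) = (\<Sum>n. (cmod (a n))\<^sup>2 * Beta (real n + 1) (\<beta> + 1))"
proof -
  have c0: "?c n \<ge> 0" for n using Beta_real_pos[of "real n + 1" "\<beta> + 1"] \<beta> by simp
  have "(\<lambda>z. cmod z) \<in> borel_measurable disk_area" "f \<in> borel_measurable disk_area"
    by (intro continuous_imp_measurable_disk_area continuous_intros f)+
  hence Fm: "?F \<in> borel_measurable disk_area" by measurable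
  have N: "(\<integral>\<^sup>+z. ennreal (?F z) \<partial>disk_area) = (\<Sum>n. ennreal (?c n))"
    by (rule parseval_nn[OF \<beta> f])
  show I: "integrable disk_area ?F \<longleftrightarrow> summable ?c"
  proof
    assume "integrable disk_area ?F"
    hence "(\<integral>\<^sup>+z. ennreal (?F z) \<partial>disk_area) < \<infinity>" by (simp add: integrable_iff_bounded)
    hence "(\<Sum>n. ennreal (?c n)) < \<infinity>" by (simp only: N)
    thus "summable ?c" using c0 by (intro summable_suminf_not_top) auto
  next
    assume s: "summable ?c"
    have "(\<integral>\<^sup>+z. ennreal (?F z) \<partial>disk_area) = ennreal (suminf ?c)"
      by (simp only: N suminf_ennreal2[of ?c, OF c0 s])
    thus "integrable disk_area ?F" using Fm by (simp add: integrable_iff_bounded)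
  qed
  assume s: "summable ?c"
  have "ennreal (LINT z|disk_area. ?F z) = (\<integral>\<^sup>+z. ennreal (?F z) \<partial>disk_area)"
    using s I by (intro nn_integral_eq_integral[symmetric]) auto
  also have "\<dots> = ennreal (suminf ?c)" unfolding N by (rule suminf_ennreal2[OF c0 s])
  finally show "(LINT z|disk_area. ?F z) = suminf ?c"
    using c0 s by (simp add: suminf_nonneg integral_nonneg_AE)
qed

section \<open>Taylor coefficients\<close>

definition taylor_coeff :: "(complex \<Rightarrow> complex) \<Rightarrow> nat \<Rightarrow> complex" where
  "taylor_coeff f n = (deriv ^^ n) f 0 / fact n"

lemma taylor_sums:
  assumes "f holomorphic_on unit_disk" "cmod z < 1"
  shows "(\<lambda>n. taylor_coeff f n * z ^ n) sums f z"
  using holomorphic_power_series[of f 0 1 z] assms by (simp add: taylor_coeff_def)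

lemma taylor_coeff_unique:
  assumes "\<And>z. cmod z < 1 \<Longrightarrow> (\<lambda>n. a n * z ^ n) sums f z"
  shows "taylor_coeff f n = a n"
proof -
  have hol: "f holomorphic_on unit_disk"
    by (rule power_series_holomorphic[where a = a]) (use assms in simp)
  define b where "b n = taylor_coeff f n - a n" for n
  have b: "(\<lambda>n. b n * (z - 0) ^ n) sums 0" if "cmod z < 1" for z
    using sums_diff[OF taylor_sums[OF hol that] assms[OF that]] by (simp add: b_def algebra_simps)
  have "b m = 0" for m
  proof (cases "m = 0")
    case True
    have "(\<lambda>n. b n * 0 ^ n) sums b 0" by (simp add: powser_sums_zero_iff)
    thus ?thesis using True b[of 0] sums_unique2 by fastforce
  next
    case False
    show ?thesis
    proof (rule ccontr)
      assume m: "b m \<noteq> 0"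
      \<comment> \<open>\<open>powser_0_nonzero\<close> is applied to the zero function: a nonzero
        coefficient would make it nonzero on a punctured disk.\<close>
      obtain s where s: "0 < s" "\<And>z::complex. z \<in> cball 0 s - {0} \<Longrightarrow> (0::complex) \<noteq> 0"
        using powser_0_nonzero[of 1 0 b "\<lambda>_. 0" m] b m False by auto
      have "complex_of_real s \<in> cball 0 s - {0}" using s(1) by auto
      thus False using s(2) by blast
    qed
  qed
  thus ?thesis by (simp add: b_def)
qed

lemma taylor_coeff_add:
  assumes "f holomorphic_on unit_disk" "g holomorphic_on unit_disk"
  shows "taylor_coeff (\<lambda>z. f z + g z) n = taylor_coeff f n + taylor_coeff g n"
  by (rule taylor_coeff_unique) (use assms in \<open>auto simp: distrib_right intro!: sums_add taylor_sums\<close>)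

lemma taylor_coeff_scale:
  assumes "f holomorphic_on unit_disk"
  shows "taylor_coeff (\<lambda>z. c * f z) n = c * taylor_coeff f n"
  by (rule taylor_coeff_unique) (use assms in \<open>auto simp: mult.assoc intro!: sums_mult taylor_sums\<close>)

lemma taylor_coeff_diff:
  assumes "f holomorphic_on unit_disk" "g holomorphic_on unit_disk"
  shows "taylor_coeff (\<lambda>z. f z - g z) n = taylor_coeff f n - taylor_coeff g n"
  by (rule taylor_coeff_unique) (use assms in \<open>auto simp: left_diff_distrib intro!: sums_diff taylor_sums\<close>)

lemma taylor_coeff_deriv: "taylor_coeff (deriv f) n = of_nat (Suc n) * taylor_coeff f (Suc n)"
  by (simp add: taylor_coeff_def funpow_swap1 del: of_nat_Suc)

lemma Beta_real_rec:
  assumes "a > 0" "b > (0::real)"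
  shows "Beta (a + 1) b = a / (a + b) * Beta a b" "Beta a (b + 1) = b / (a + b) * Beta a b"
proof -
  have "a \<notin> \<int>\<^sub>\<le>\<^sub>0" "b \<notin> \<int>\<^sub>\<le>\<^sub>0" using assms by auto
  hence "(a + b) * Beta (a + 1) b = a * Beta a b" "(a + b) * Beta a (b + 1) = b * Beta a b"
    by (auto intro: Beta_plus1_left Beta_plus1_right)
  thus "Beta (a + 1) b = a / (a + b) * Beta a b" "Beta a (b + 1) = b / (a + b) * Beta a b"
    using assms by (simp_all add: field_simps)
qed

lemma summable_equivalent:
  fixes f g :: "nat \<Rightarrow> real"
  assumes "c > 0" "C > 0" "\<And>n. 0 \<le> f n" "\<And>n. c * f n \<le> g n" "\<And>n. g n \<le> C * f n"
  shows "summable f \<longleftrightarrow> summable g"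
proof
  assume f: "summable f"
  have g0: "0 \<le> g n" for n
    using order_trans[OF mult_nonneg_nonneg[OF less_imp_le[OF assms(1)] assms(3)] assms(4)] .
  show "summable g"
    by (rule summable_comparison_test'[OF summable_mult[OF f, of C], of 0]) (simp add: g0 assms(5))
next
  assume g: "summable g"
  have "f n \<le> (1 / c) * g n" for n using assms(1) assms(4)[of n] by (simp add: field_simps)
  thus "summable f"
    by (intro summable_comparison_test'[OF summable_mult[OF g, of "1 / c"], of 0]) (simp add: assms(3))
qed

text \<open>Coefficientwise, one derivative changes the moments by a bounded factor.\<close>

lemma integrable_deriv_iff:
  assumes \<beta>: "\<beta> > -1" and f: "f holomorphic_on unit_disk"
  shows "integrable disk_area (\<lambda>z. (1 - (cmod z)\<^sup>2) powr \<beta> * (cmod (f z))\<^sup>2) \<longleftrightarrow>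
    integrable disk_area (\<lambda>z. (1 - (cmod z)\<^sup>2) powr (\<beta> + 2) * (cmod (deriv f z))\<^sup>2)"
proof -
  have df: "deriv f holomorphic_on unit_disk" by (rule holomorphic_deriv[OF f]) simp
  define u where "u n = (cmod (taylor_coeff f n))\<^sup>2 * Beta (real n + 1) (\<beta> + 1)" for n
  define v where "v n = (cmod (taylor_coeff (deriv f) n))\<^sup>2 * Beta (real n + 1) (\<beta> + 2 + 1)" for n
  have u0: "0 \<le> u n" for n
    unfolding u_def using Beta_real_pos[of "real n + 1" "\<beta> + 1"] \<beta> by (intro mult_nonneg_nonneg) auto
  have uv: "v n = (real n + 1) * (\<beta> + 1) * (\<beta> + 2) / (real n + \<beta> + 3) * u (Suc n)" for n
  proof -
    define B where "B = Beta (real n + 1) (\<beta> + 1)"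
    have 1: "Beta (real (Suc n) + 1) (\<beta> + 1) = (real n + 1) / (real n + \<beta> + 2) * B"
      using Beta_real_rec(1)[of "real n + 1" "\<beta> + 1"] \<beta> by (simp add: B_def algebra_simps)
    have 2: "Beta (real n + 1) (\<beta> + 2 + 1) = (\<beta> + 2) / (real n + \<beta> + 3) * ((\<beta> + 1) / (real n + \<beta> + 2) * B)"
      using Beta_real_rec(2)[of "real n + 1" "\<beta> + 1"] Beta_real_rec(2)[of "real n + 1" "\<beta> + 2"] \<beta>
      by (simp add: B_def algebra_simps)
    have 3: "(cmod (taylor_coeff (deriv f) n))\<^sup>2 = (real n + 1)\<^sup>2 * (cmod (taylor_coeff f (Suc n)))\<^sup>2"
      by (simp only: taylor_coeff_deriv norm_mult norm_of_nat power_mult_distrib) simp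
    have nz: "real n + \<beta> + 2 \<noteq> 0" "real n + \<beta> + 3 \<noteq> 0" using \<beta> by auto
    show ?thesis unfolding u_def v_def 1 2 3 using nz by (simp add: field_simps power2_eq_square)
  qed
  have "summable v \<longleftrightarrow> summable (\<lambda>n. u (Suc n))"
  proof (rule summable_equivalent[symmetric])
    define c where "c = (\<beta> + 1) * (\<beta> + 2)"
    have c: "c > 0" using \<beta> by (simp add: c_def)
    \<comment> \<open>The quotient (n + 1) / (n + \<beta> + 3) increases from 1 / (\<beta> + 3) at n
      = 0 towards 1.\<close>
    have bnds: "c / (\<beta> + 3) \<le> (real n + 1) * (\<beta> + 1) * (\<beta> + 2) / (real n + \<beta> + 3)"
      "(real n + 1) * (\<beta> + 1) * (\<beta> + 2) / (real n + \<beta> + 3) \<le> c" for n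
    proof -
      have "1 / (\<beta> + 3) \<le> (real n + 1) / (real n + \<beta> + 3)"
      proof -
        have "0 \<le> real n * (\<beta> + 2)" using \<beta> by simp
        hence "1 * (real n + \<beta> + 3) \<le> (real n + 1) * (\<beta> + 3)" by (simp add: algebra_simps)
        hence "1 \<le> (real n + 1) * (\<beta> + 3) / (real n + \<beta> + 3)"
          using \<beta> by (subst pos_le_divide_eq) auto
        thus ?thesis using \<beta> by (subst pos_divide_le_eq) auto
      qed
      from mult_left_mono[OF this, of c] show "c / (\<beta> + 3) \<le> (real n + 1) * (\<beta> + 1) * (\<beta> + 2) / (real n + \<beta> + 3)"
        using c by (simp add: c_def mult_ac)
      have "(real n + 1) / (real n + \<beta> + 3) \<le> 1" using \<beta> by simp
      from mult_left_mono[OF this, of c] show "(real n + 1) * (\<beta> + 1) * (\<beta> + 2) / (real n + \<beta> + 3) \<le> c"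
        using c by (simp add: c_def mult_ac)
    qed
    show "c / (\<beta> + 3) > 0" "c > 0" using c \<beta> by auto
    show "0 \<le> u (Suc n)" for n by (rule u0)
    show "c / (\<beta> + 3) * u (Suc n) \<le> v n" "v n \<le> c * u (Suc n)" for n
      unfolding uv by (rule mult_right_mono[OF bnds(1) u0], rule mult_right_mono[OF bnds(2) u0])
  qed
  also have "\<dots> \<longleftrightarrow> summable u" by (rule summable_Suc_iff)
  finally have "summable v \<longleftrightarrow> summable u" .
  moreover have "integrable disk_area (\<lambda>z. (1 - (cmod z)\<^sup>2) powr \<beta> * (cmod (f z))\<^sup>2) \<longleftrightarrow> summable u"
    unfolding u_def by (rule parseval(1)) (use \<beta> f in \<open>auto intro: holomorphic_on_imp_continuous_on taylor_sums\<close>)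
  moreover have "integrable disk_area (\<lambda>z. (1 - (cmod z)\<^sup>2) powr (\<beta> + 2) * (cmod (deriv f z))\<^sup>2) \<longleftrightarrow> summable v"
    unfolding v_def by (rule parseval(1)) (use \<beta> df in \<open>auto intro: holomorphic_on_imp_continuous_on taylor_sums\<close>)
  ultimately show ?thesis by blast
qed

lemma A2_via_Suc:
  assumes "2 * real k + \<gamma> > -1"
  shows "A2_via (Suc k) \<gamma> = A2_via k \<gamma>"
proof -
  have "integrable disk_area (\<lambda>z. (1 - (cmod z)\<^sup>2) powr (2 * real k + \<gamma>) * (cmod ((deriv ^^ k) f z))\<^sup>2) \<longleftrightarrow>
    integrable disk_area (\<lambda>z. (1 - (cmod z)\<^sup>2) powr (2 * real (Suc k) + \<gamma>) * (cmod ((deriv ^^ Suc k) f z))\<^sup>2)"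
    if "f holomorphic_on unit_disk" for f
  proof -
    have "(deriv ^^ k) f holomorphic_on unit_disk" using that by (intro holomorphic_higher_deriv) auto
    from integrable_deriv_iff[OF assms this] show ?thesis by (simp add: algebra_simps)
  qed
  thus ?thesis unfolding A2_via_def by blast
qed

lemma A2_via_ge:
  assumes "2 * real k + \<gamma> > -1" "k \<le> m"
  shows "A2_via m \<gamma> = A2_via k \<gamma>"
  using assms(2)
proof (induction m rule: dec_induct)
  case (step m)
  have "2 * real m + \<gamma> > -1" using step(1) assms(1) by linarith
  thus ?case using A2_via_Suc step by simp
qed simp

text \<open>Order 1 is the meeting point: for \<gamma> = \<alpha> - 1 with \<alpha> > -1 it is
  always admissible, whereas order 0 requires \<alpha> > 0.\<close>

lemma A2_via_eq_1:
  assumes "2 * real k + \<gamma> > -1" "2 + \<gamma> > -1"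
  shows "A2_via k \<gamma> = A2_via 1 \<gamma>"
  using A2_via_ge[of k \<gamma> "max k 1"] A2_via_ge[of 1 \<gamma> "max k 1"] assms by simp

section \<open>Coefficient weights and coefficient criteria\<close>

text \<open>The squared norm of z^n in the normalised weighted space, n! Gamma(\<alpha> + 2) /
  Gamma(n + \<alpha> + 2).\<close>

definition wt :: "real \<Rightarrow> nat \<Rightarrow> real" where
  "wt \<alpha> n = (\<alpha> + 1) * Beta (real n + 1) (\<alpha> + 1)"

lemma wt_pos: "\<alpha> > -1 \<Longrightarrow> wt \<alpha> n > 0"
  by (simp add: wt_def Beta_real_pos)

lemma wt_0: "\<alpha> > -1 \<Longrightarrow> wt \<alpha> 0 = 1"
proof -
  assume a: "\<alpha> > -1"
  have "Gamma (\<alpha> + 1 + 1) = (\<alpha> + 1) * Gamma (\<alpha> + 1)" using a by (intro Gamma_plus1) auto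
  hence "Gamma (1 + (\<alpha> + 1)) = (\<alpha> + 1) * Gamma (\<alpha> + 1)" by (simp only: add.commute[of 1])
  moreover have "Gamma (\<alpha> + 1) > 0" using a by (intro Gamma_real_pos) simp
  ultimately have "wt \<alpha> 0 = (\<alpha> + 1) * (Gamma (\<alpha> + 1) / ((\<alpha> + 1) * Gamma (\<alpha> + 1)))" "Gamma (\<alpha> + 1) \<noteq> 0"
    by (simp_all only: wt_def Beta_def) simp_all
  thus ?thesis using a by (simp only: nonzero_mult_divide_mult_cancel_right) simp
qed

lemma wt_Suc: "\<alpha> > -1 \<Longrightarrow> wt \<alpha> (Suc n) = (real n + 1) / (real n + \<alpha> + 2) * wt \<alpha> n"
proof -
  assume a: "\<alpha> > -1"
  have "Beta (real (Suc n) + 1) (\<alpha> + 1) = (real n + 1) / (real n + \<alpha> + 2) * Beta (real n + 1) (\<alpha> + 1)"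
    using Beta_real_rec(1)[of "real n + 1" "\<alpha> + 1"] a by (simp add: add_ac)
  thus ?thesis by (simp add: wt_def)
qed

lemma wt_le_1: "\<alpha> > -1 \<Longrightarrow> wt \<alpha> n \<le> 1"
proof (induction n)
  case (Suc n)
  have "wt \<alpha> (Suc n) \<le> 1 * wt \<alpha> n"
    unfolding wt_Suc[OF Suc.prems] using Suc.prems wt_pos[OF Suc.prems, of n] by (intro mult_right_mono) auto
  thus ?case using Suc by simp
qed (simp add: wt_0)

lemma A2_via_holomorphic: "f \<in> A2_via k \<gamma> \<Longrightarrow> f holomorphic_on unit_disk"
  by (simp add: A2_via_def)

lemma A2_via_off_disk: "f \<in> A2_via k \<gamma> \<Longrightarrow> cmod z \<ge> 1 \<Longrightarrow> f z = 0"
  by (simp add: A2_via_def)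

lemma summable_bergman_iff:
  assumes "\<alpha> > -1" "f holomorphic_on unit_disk"
  shows "integrable disk_area (\<lambda>z. (1 - (cmod z)\<^sup>2) powr \<alpha> * (cmod (f z))\<^sup>2) \<longleftrightarrow>
    summable (\<lambda>n. wt \<alpha> n * (cmod (taylor_coeff f n))\<^sup>2)"
proof -
  have "integrable disk_area (\<lambda>z. (1 - (cmod z)\<^sup>2) powr \<alpha> * (cmod (f z))\<^sup>2) \<longleftrightarrow>
    summable (\<lambda>n. (cmod (taylor_coeff f n))\<^sup>2 * Beta (real n + 1) (\<alpha> + 1))"
    using assms by (intro parseval(1)) (auto intro: holomorphic_on_imp_continuous_on taylor_sums)
  also have "\<dots> \<longleftrightarrow> summable (\<lambda>n. (\<alpha> + 1) * ((cmod (taylor_coeff f n))\<^sup>2 * Beta (real n + 1) (\<alpha> + 1)))"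
    using assms by (subst summable_cmult_iff) auto
  finally show ?thesis by (simp add: wt_def mult_ac)
qed

lemma bergman_iff:
  assumes "\<alpha> > -1"
  shows "f \<in> bergman \<alpha> \<longleftrightarrow> f holomorphic_on unit_disk \<and> (\<forall>z. z \<notin> unit_disk \<longrightarrow> f z = 0) \<and>
    summable (\<lambda>n. wt \<alpha> n * (cmod (taylor_coeff f n))\<^sup>2)"
  using summable_bergman_iff[OF assms, of f] by (auto simp: A2_via_def)

lemma bergman_summable:
  "\<alpha> > -1 \<Longrightarrow> f \<in> bergman \<alpha> \<Longrightarrow> summable (\<lambda>n. wt \<alpha> n * (cmod (taylor_coeff f n))\<^sup>2)"
  by (simp add: bergman_iff)

text \<open>For one derivative and exponent \<alpha> + 1 the moments are n w_n up to the constant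
  factor \<alpha> + 1 of the normalisation being absorbed exactly, so the Dirichlet norm can be read
  both as a coefficient sum and as an integral.\<close>

lemma dirichlet_moment:
  assumes "\<alpha> > -1"
  shows "(cmod (taylor_coeff (deriv f) n))\<^sup>2 * Beta (real n + 1) (\<alpha> + 1 + 1)
    = real (Suc n) * wt \<alpha> (Suc n) * (cmod (taylor_coeff f (Suc n)))\<^sup>2"
proof -
  define B where "B = Beta (real n + 1) (\<alpha> + 1)"
  have 1: "wt \<alpha> (Suc n) = (\<alpha> + 1) * ((real n + 1) / (real n + \<alpha> + 2) * B)"
    using Beta_real_rec(1)[of "real n + 1" "\<alpha> + 1"] assms by (simp add: B_def wt_def algebra_simps)
  have 2: "Beta (real n + 1) (\<alpha> + 1 + 1) = (\<alpha> + 1) / (real n + \<alpha> + 2) * B"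
    using Beta_real_rec(2)[of "real n + 1" "\<alpha> + 1"] assms by (simp add: B_def algebra_simps)
  have 3: "(cmod (taylor_coeff (deriv f) n))\<^sup>2 = (real n + 1)\<^sup>2 * (cmod (taylor_coeff f (Suc n)))\<^sup>2"
    by (simp only: taylor_coeff_deriv norm_mult norm_of_nat power_mult_distrib) simp
  have nz: "real n + \<alpha> + 2 \<noteq> 0" using assms by auto
  show ?thesis unfolding 1 2 3 using nz by (simp add: field_simps power2_eq_square)
qed

lemma dirichlet_integral:
  assumes \<alpha>: "\<alpha> > -1" and f: "f holomorphic_on unit_disk"
  shows "integrable disk_area (\<lambda>z. (1 - (cmod z)\<^sup>2) powr (\<alpha> + 1) * (cmod (deriv f z))\<^sup>2) \<longleftrightarrow>
      summable (\<lambda>n. real n * wt \<alpha> n * (cmod (taylor_coeff f n))\<^sup>2)"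
    and "summable (\<lambda>n. real n * wt \<alpha> n * (cmod (taylor_coeff f n))\<^sup>2) \<Longrightarrow>
      (LINT z|disk_area. (1 - (cmod z)\<^sup>2) powr (\<alpha> + 1) * (cmod (deriv f z))\<^sup>2)
        = (\<Sum>n. real n * wt \<alpha> n * (cmod (taylor_coeff f n))\<^sup>2)"
proof -
  have df: "deriv f holomorphic_on unit_disk" by (rule holomorphic_deriv[OF f]) simp
  have P: "\<alpha> + 1 > -1" "continuous_on unit_disk (deriv f)" "\<And>z. cmod z < 1 \<Longrightarrow> (\<lambda>n. taylor_coeff (deriv f) n * z ^ n) sums deriv f z"
    using \<alpha> df by (auto intro: holomorphic_on_imp_continuous_on taylor_sums)
  let ?t = "\<lambda>n. real n * wt \<alpha> n * (cmod (taylor_coeff f n))\<^sup>2"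
  let ?v = "\<lambda>n. (cmod (taylor_coeff (deriv f) n))\<^sup>2 * Beta (real n + 1) (\<alpha> + 1 + 1)"
  have I0: "integrable disk_area (\<lambda>z. (1 - (cmod z)\<^sup>2) powr (\<alpha> + 1) * (cmod (deriv f z))\<^sup>2) \<longleftrightarrow> summable ?v"
    by (rule parseval(1)[OF P])
  have V0: "summable ?v \<Longrightarrow> (LINT z|disk_area. (1 - (cmod z)\<^sup>2) powr (\<alpha> + 1) * (cmod (deriv f z))\<^sup>2) = suminf ?v"
    by (rule parseval(2)[OF P])
  show I: "integrable disk_area (\<lambda>z. (1 - (cmod z)\<^sup>2) powr (\<alpha> + 1) * (cmod (deriv f z))\<^sup>2) \<longleftrightarrow> summable ?t"
    unfolding I0 dirichlet_moment[OF \<alpha>] by (rule summable_Suc_iff[of ?t])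
  assume s: "summable ?t"
  have "(LINT z|disk_area. (1 - (cmod z)\<^sup>2) powr (\<alpha> + 1) * (cmod (deriv f z))\<^sup>2) = (\<Sum>n. ?t (Suc n))"
    using V0 s summable_Suc_iff[of ?t] unfolding dirichlet_moment[OF \<alpha>] by blast
  also have "\<dots> = suminf ?t" using suminf_split_head[OF s] by simp
  finally show "(LINT z|disk_area. (1 - (cmod z)\<^sup>2) powr (\<alpha> + 1) * (cmod (deriv f z))\<^sup>2) = suminf ?t" .
qed

text \<open>For n \<ge> 1 the factor n only enlarges the terms, and the single term at n = 0 does
  not affect summability; hence the Dirichlet condition implies membership in the Bergman
  space.\<close>

lemma A2_via_iff:
  assumes \<alpha>: "\<alpha> > -1" and k: "2 * real k + (\<alpha> - 1) > -1"
  shows "f \<in> A2_via k (\<alpha> - 1) \<longleftrightarrow> f \<in> bergman \<alpha> \<and> summable (\<lambda>n. real n * wt \<alpha> n * (cmod (taylor_coeff f n))\<^sup>2)"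
proof -
  have "A2_via k (\<alpha> - 1) = A2_via 1 (\<alpha> - 1)" using k \<alpha> by (intro A2_via_eq_1) auto
  moreover have "f \<in> A2_via 1 (\<alpha> - 1) \<longleftrightarrow> f holomorphic_on unit_disk \<and> (\<forall>z. z \<notin> unit_disk \<longrightarrow> f z = 0) \<and>
      summable (\<lambda>n. real n * wt \<alpha> n * (cmod (taylor_coeff f n))\<^sup>2)"
    using dirichlet_integral(1)[OF \<alpha>, of f] by (auto simp: A2_via_def add_ac)
  moreover have "summable (\<lambda>n. wt \<alpha> n * (cmod (taylor_coeff f n))\<^sup>2)"
    if s: "summable (\<lambda>n. real n * wt \<alpha> n * (cmod (taylor_coeff f n))\<^sup>2)"
  proof (rule summable_comparison_test'[OF s, of 1])
    fix n :: nat assume "n \<ge> 1"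
    hence "1 * (wt \<alpha> n * (cmod (taylor_coeff f n))\<^sup>2) \<le> real n * (wt \<alpha> n * (cmod (taylor_coeff f n))\<^sup>2)"
      using wt_pos[OF \<alpha>, of n] by (intro mult_right_mono) auto
    thus "norm (wt \<alpha> n * (cmod (taylor_coeff f n))\<^sup>2) \<le> real n * wt \<alpha> n * (cmod (taylor_coeff f n))\<^sup>2"
      using wt_pos[OF \<alpha>, of n] by (simp add: mult_ac)
  qed
  ultimately show ?thesis using bergman_iff[OF \<alpha>, of f] by auto
qed

section \<open>The weighted Bergman space as a Hilbert space\<close>

lemma cmod_add_sq_le: "(cmod (a + b))\<^sup>2 \<le> 2 * (cmod a)\<^sup>2 + 2 * (cmod b)\<^sup>2"
proof -
  have "(cmod (a + b))\<^sup>2 \<le> (cmod a + cmod b)\<^sup>2" by (intro power_mono norm_triangle_ineq) auto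
  also have "\<dots> \<le> 2 * (cmod a)\<^sup>2 + 2 * (cmod b)\<^sup>2"
    using sum_squares_ge_zero[of "cmod a - cmod b" 0] by (simp add: power2_eq_square algebra_simps)
  finally show ?thesis .
qed

lemma cmod_mult_le: "cmod a * cmod b \<le> (cmod a)\<^sup>2 + (cmod b)\<^sup>2"
proof -
  have "0 \<le> (cmod a - cmod b)\<^sup>2" "0 \<le> cmod a * cmod b" by auto
  thus ?thesis unfolding power2_diff by linarith
qed

locale bergman_weight =
  fixes \<alpha> :: real
  assumes \<alpha>: "\<alpha> > -1"
begin

abbreviation "H \<equiv> bergman \<alpha>"
abbreviation "w \<equiv> wt \<alpha>"

lemma w_pos: "w n > 0" by (rule wt_pos[OF \<alpha>])
lemma w_nonneg: "w n \<ge> 0" using w_pos[of n] by simp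

lemma H_hol: "f \<in> H \<Longrightarrow> f holomorphic_on unit_disk" by (rule A2_via_holomorphic)

lemmas H_sum = bergman_summable[OF \<alpha>]

lemma bergmanI:
  assumes "f holomorphic_on unit_disk" "\<And>z. z \<notin> unit_disk \<Longrightarrow> f z = 0"
    "summable (\<lambda>n. w n * (cmod (taylor_coeff f n))\<^sup>2)"
  shows "f \<in> H"
  using assms by (simp add: bergman_iff[OF \<alpha>])

lemma summable_add_sq:
  assumes "summable (\<lambda>n. w n * (cmod (a n))\<^sup>2)" "summable (\<lambda>n. w n * (cmod (b n))\<^sup>2)"
  shows "summable (\<lambda>n. w n * (cmod (a n + b n))\<^sup>2)"
proof (rule summable_comparison_test'[of "\<lambda>n. 2 * (w n * (cmod (a n))\<^sup>2) + 2 * (w n * (cmod (b n))\<^sup>2)" 0])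
  show "summable (\<lambda>n. 2 * (w n * (cmod (a n))\<^sup>2) + 2 * (w n * (cmod (b n))\<^sup>2))"
    by (intro summable_add summable_mult assms)
  fix n
  have "w n * (cmod (a n + b n))\<^sup>2 \<le> w n * (2 * (cmod (a n))\<^sup>2 + 2 * (cmod (b n))\<^sup>2)"
    by (intro mult_left_mono cmod_add_sq_le w_nonneg)
  thus "norm (w n * (cmod (a n + b n))\<^sup>2) \<le> 2 * (w n * (cmod (a n))\<^sup>2) + 2 * (w n * (cmod (b n))\<^sup>2)"
    using w_nonneg by (simp add: algebra_simps)
qed

lemma bergman_zero: "(\<lambda>z. 0) \<in> H"
  by (simp add: A2_via_def)

lemma bergman_add:
  assumes "f \<in> H" "g \<in> H" shows "(\<lambda>z. f z + g z) \<in> H"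
  using assms summable_add_sq[OF H_sum[OF assms(1)] H_sum[OF assms(2)]]
  by (auto simp: bergman_iff[OF \<alpha>] taylor_coeff_add intro: holomorphic_intros)

lemma bergman_scale:
  assumes "f \<in> H" shows "(\<lambda>z. c * f z) \<in> H"
  using assms summable_mult[OF H_sum[OF assms], of "(cmod c)\<^sup>2"]
  by (auto simp: bergman_iff[OF \<alpha>] taylor_coeff_scale norm_mult power_mult_distrib mult_ac intro: holomorphic_intros)

lemma measurable_weight: "(\<lambda>z. (1 - (cmod z)\<^sup>2) powr \<beta>) \<in> borel_measurable disk_area"
proof -
  have "(\<lambda>z. 1 - (cmod z)\<^sup>2) \<in> borel_measurable disk_area"
    by (intro continuous_imp_measurable_disk_area continuous_intros)
  thus ?thesis by measurable
qed

lemma measurable_H_mult: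
  assumes "f \<in> H" "g \<in> H" shows "(\<lambda>z. f z * cnj (g z)) \<in> borel_measurable disk_area"
  using assms by (intro continuous_imp_measurable_disk_area continuous_intros holomorphic_on_imp_continuous_on H_hol)

definition berg_integrand :: "(complex \<Rightarrow> complex) \<Rightarrow> (complex \<Rightarrow> complex) \<Rightarrow> complex \<Rightarrow> complex" where
  "berg_integrand f g z = complex_of_real ((1 - (cmod z)\<^sup>2) powr \<alpha>) * (f z * cnj (g z))"

lemma berg_inner_eq:
  assumes "f \<in> H" "g \<in> H"
  shows "berg_inner \<alpha> f g = (\<alpha> + 1) * (LINT z|disk_area. berg_integrand f g z)"
proof -
  note m = measurable_H_mult[OF assms]
  have w: "(\<lambda>z. (\<alpha> + 1) * (1 - (cmod z)\<^sup>2) powr \<alpha>) \<in> borel_measurable disk_area"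
    using measurable_weight[of \<alpha>] by measurable
  have "berg_inner \<alpha> f g = (LINT z|disk_area. ((\<alpha> + 1) * (1 - (cmod z)\<^sup>2) powr \<alpha>) *\<^sub>R (f z * cnj (g z)))"
    unfolding berg_inner_def weighted_area_def using \<alpha> by (intro integral_density m w AE_I2) auto
  also have "\<dots> = (LINT z|disk_area. (\<alpha> + 1) * berg_integrand f g z)"
    by (intro Bochner_Integration.integral_cong) (auto simp: berg_integrand_def scaleR_conv_of_real mult_ac)
  also have "\<dots> = (\<alpha> + 1) * (LINT z|disk_area. berg_integrand f g z)" by simp
  finally show ?thesis .
qed

lemma berg_integrand_integrable:
  assumes "f \<in> H" "g \<in> H" shows "integrable disk_area (berg_integrand f g)"
proof (rule Bochner_Integration.integrable_bound)
  show "integrable disk_area (\<lambda>z. (1 - (cmod z)\<^sup>2) powr \<alpha> * (cmod (f z))\<^sup>2 + (1 - (cmod z)\<^sup>2) powr \<alpha> * (cmod (g z))\<^sup>2)"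
    using assms by (intro Bochner_Integration.integrable_add) (auto simp: A2_via_def)
  show "berg_integrand f g \<in> borel_measurable disk_area"
    unfolding berg_integrand_def by (rule borel_measurable_times[OF measurable_compose[OF measurable_weight borel_measurable_of_real] measurable_H_mult[OF assms]])
  show "AE z in disk_area. norm (berg_integrand f g z) \<le> norm ((1 - (cmod z)\<^sup>2) powr \<alpha> * (cmod (f z))\<^sup>2 + (1 - (cmod z)\<^sup>2) powr \<alpha> * (cmod (g z))\<^sup>2)"
  proof (rule AE_I2)
    fix z
    have "norm (berg_integrand f g z) = (1 - (cmod z)\<^sup>2) powr \<alpha> * (cmod (f z) * cmod (g z))"
      by (simp add: berg_integrand_def norm_mult)
    also have "\<dots> \<le> (1 - (cmod z)\<^sup>2) powr \<alpha> * ((cmod (f z))\<^sup>2 + (cmod (g z))\<^sup>2)"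
      by (intro mult_left_mono cmod_mult_le) auto
    finally show "norm (berg_integrand f g z) \<le> norm ((1 - (cmod z)\<^sup>2) powr \<alpha> * (cmod (f z))\<^sup>2 + (1 - (cmod z)\<^sup>2) powr \<alpha> * (cmod (g z))\<^sup>2)"
      by (simp add: distrib_left)
  qed
qed

lemma berg_inner_add_left:
  assumes "f \<in> H" "g \<in> H" "h \<in> H"
  shows "berg_inner \<alpha> (\<lambda>z. f z + g z) h = berg_inner \<alpha> f h + berg_inner \<alpha> g h"
proof -
  have "(LINT z|disk_area. berg_integrand (\<lambda>z. f z + g z) h z) = (LINT z|disk_area. berg_integrand f h z + berg_integrand g h z)"
    by (intro Bochner_Integration.integral_cong) (auto simp: berg_integrand_def algebra_simps)
  also have "\<dots> = (LINT z|disk_area. berg_integrand f h z) + (LINT z|disk_area. berg_integrand g h z)"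
    by (intro Bochner_Integration.integral_add berg_integrand_integrable assms)
  finally show ?thesis using assms by (simp add: berg_inner_eq bergman_add distrib_left)
qed

lemma berg_inner_scale_left:
  assumes "f \<in> H" "g \<in> H"
  shows "berg_inner \<alpha> (\<lambda>z. c * f z) g = c * berg_inner \<alpha> f g"
proof -
  have "(LINT z|disk_area. berg_integrand (\<lambda>z. c * f z) g z) = (LINT z|disk_area. c * berg_integrand f g z)"
    by (intro Bochner_Integration.integral_cong) (auto simp: berg_integrand_def mult_ac)
  thus ?thesis using assms by (simp add: berg_inner_eq bergman_scale)
qed

lemma berg_inner_commute:
  assumes "f \<in> H" "g \<in> H"
  shows "berg_inner \<alpha> g f = cnj (berg_inner \<alpha> f g)"
proof -
  have "berg_integrand g f z = cnj (berg_integrand f g z)" for z by (simp add: berg_integrand_def mult_ac)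
  thus ?thesis using assms by (simp add: berg_inner_eq integral_cnj[symmetric] del: integral_cnj)
qed

lemma berg_inner_self:
  assumes f: "f \<in> H"
  shows "berg_inner \<alpha> f f = complex_of_real (\<Sum>n. w n * (cmod (taylor_coeff f n))\<^sup>2)"
proof -
  let ?c = "\<lambda>n. (cmod (taylor_coeff f n))\<^sup>2 * Beta (real n + 1) (\<alpha> + 1)"
  have c: "w n * (cmod (taylor_coeff f n))\<^sup>2 = (\<alpha> + 1) * ?c n" for n by (simp add: wt_def mult_ac)
  have s: "summable ?c" using H_sum[OF f] \<alpha> unfolding c by (subst (asm) summable_cmult_iff) auto
  have "berg_integrand f f z = complex_of_real ((1 - (cmod z)\<^sup>2) powr \<alpha> * (cmod (f z))\<^sup>2)" for z
    by (simp only: berg_integrand_def of_real_mult complex_norm_square)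
  hence "(LINT z|disk_area. berg_integrand f f z) = complex_of_real (LINT z|disk_area. (1 - (cmod z)\<^sup>2) powr \<alpha> * (cmod (f z))\<^sup>2)"
    by (simp only: integral_complex_of_real)
  also have "(LINT z|disk_area. (1 - (cmod z)\<^sup>2) powr \<alpha> * (cmod (f z))\<^sup>2) = suminf ?c"
    using H_hol[OF f] by (intro parseval(2) \<alpha> s) (auto intro: holomorphic_on_imp_continuous_on taylor_sums)
  finally have "berg_inner \<alpha> f f = complex_of_real ((\<alpha> + 1) * suminf ?c)" by (simp add: berg_inner_eq[OF f f])
  also have "(\<alpha> + 1) * suminf ?c = (\<Sum>n. w n * (cmod (taylor_coeff f n))\<^sup>2)"
    unfolding c by (rule suminf_mult[OF s, symmetric])
  finally show ?thesis .
qed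

text \<open>These are the terms of the reproducing kernel on the diagonal, at |z|^2 = x; the ratio
  of consecutive weights tends to 1, so the ratio test applies for x < 1.\<close>

lemma summable_kernel:
  assumes "0 \<le> x" "x < 1"
  shows "summable (\<lambda>n. x ^ n / w n)"
proof -
  define c where "c = (x + 1) / 2"
  have c: "x < c" "c < 1" "0 < c" using assms by (auto simp: c_def)
  \<comment> \<open>Beyond N the ratio x (n + \<alpha> + 2) / (n + 1) is at most c, the midpoint of
    x and 1: this amounts to x (\<alpha> + 1) \<le> (n + 1) (c - x).\<close>
  obtain N :: nat where N: "x * (\<alpha> + 1) / (c - x) < real N" using reals_Archimedean2 by blast
  show ?thesis
  proof (rule summable_ratio_test[of c N])
    fix n assume n: "n \<ge> N"
    have pos: "real n + 1 > 0" "real n + \<alpha> + 2 > 0" using \<alpha> by auto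
    have "x * (\<alpha> + 1) < real N * (c - x)" using N c by (simp add: field_simps)
    also have "\<dots> \<le> (real n + 1) * (c - x)" using n c by (intro mult_right_mono) auto
    finally have "x * (real n + \<alpha> + 2) \<le> c * (real n + 1)" by (simp add: algebra_simps)
    hence r: "x * ((real n + \<alpha> + 2) / (real n + 1)) \<le> c" using pos by (simp add: field_simps)
    have "x ^ Suc n / w (Suc n) = (x * ((real n + \<alpha> + 2) / (real n + 1))) * (x ^ n / w n)"
      unfolding wt_Suc[OF \<alpha>] using pos w_pos[of n] by (simp add: field_simps)
    also have "\<dots> \<le> c * (x ^ n / w n)"
      using r assms w_nonneg by (intro mult_right_mono) auto
    finally show "norm (x ^ Suc n / w (Suc n)) \<le> c * norm (x ^ n / w n)"
      using assms w_nonneg by simp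
  qed (rule c)
qed

text \<open>The inverse of \<open>taylor_coeff\<close> on weighted square summable sequences; the
  value 0 off the disk makes the result a legal representative.\<close>

definition synth :: "(nat \<Rightarrow> complex) \<Rightarrow> complex \<Rightarrow> complex" where
  "synth a z = (if cmod z < 1 then (\<Sum>n. a n * z ^ n) else 0)"

text \<open>The term splits into sqrt(w_n) a_n and z^n / sqrt(w_n); both factors are square
  summable, the second by the kernel series.\<close>

lemma synth_sums:
  assumes s: "summable (\<lambda>n. w n * (cmod (a n))\<^sup>2)" and z: "cmod z < 1"
  shows "(\<lambda>n. a n * z ^ n) sums synth a z"
proof -
  have "(cmod z)\<^sup>2 < 1" using z by (simp add: power_less_one_iff)
  hence k: "summable (\<lambda>n. ((cmod z)\<^sup>2) ^ n / w n)" by (intro summable_kernel) auto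
  have "summable (\<lambda>n. a n * z ^ n)"
  proof (rule summable_comparison_test'[OF summable_add[OF s k]])
    fix n
    let ?s = "complex_of_real (sqrt (w n))"
    have "norm (a n * z ^ n) = cmod (?s * a n) * cmod (z ^ n / ?s)"
      using w_pos[of n] by (simp add: norm_mult norm_divide)
    also have "\<dots> \<le> (cmod (?s * a n))\<^sup>2 + (cmod (z ^ n / ?s))\<^sup>2" by (rule cmod_mult_le)
    also have "\<dots> = w n * (cmod (a n))\<^sup>2 + ((cmod z)\<^sup>2) ^ n / w n"
      using w_pos[of n] by (simp add: norm_mult norm_divide power_mult_distrib power_divide norm_power mult.commute flip: power_mult)
    finally show "norm (a n * z ^ n) \<le> w n * (cmod (a n))\<^sup>2 + ((cmod z)\<^sup>2) ^ n / w n" .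
  qed
  thus ?thesis using z by (simp add: synth_def summable_sums)
qed

lemma synth_coeff:
  assumes "summable (\<lambda>n. w n * (cmod (a n))\<^sup>2)" shows "taylor_coeff (synth a) n = a n"
  by (rule taylor_coeff_unique) (rule synth_sums[OF assms])

lemma synth_in_H:
  assumes "summable (\<lambda>n. w n * (cmod (a n))\<^sup>2)" shows "synth a \<in> H"
proof (rule bergmanI)
  show "synth a holomorphic_on unit_disk"
    by (rule power_series_holomorphic[where a = a]) (simp add: synth_sums[OF assms])
  show "summable (\<lambda>n. w n * (cmod (taylor_coeff (synth a) n))\<^sup>2)"
    using assms by (simp add: synth_coeff[OF assms])
qed (simp add: synth_def)

lemma H_eqI:
  assumes "f \<in> H" "g \<in> H" "\<And>n. taylor_coeff f n = taylor_coeff g n" shows "f = g"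
proof
  fix z
  show "f z = g z"
  proof (cases "cmod z < 1")
    case True
    thus ?thesis using taylor_sums[OF H_hol[OF assms(1)] True] taylor_sums[OF H_hol[OF assms(2)] True] assms(3)
      by (simp add: sums_unique2)
  qed (use assms in \<open>simp add: A2_via_def\<close>)
qed

lemma bergman_diff: "f \<in> H \<Longrightarrow> g \<in> H \<Longrightarrow> (\<lambda>z. f z - g z) \<in> H"
  using bergman_add[OF _ bergman_scale[of g "-1"], of f] by simp

lemma Re_berg_inner_self: "f \<in> H \<Longrightarrow> Re (berg_inner \<alpha> f f) = (\<Sum>n. w n * (cmod (taylor_coeff f n))\<^sup>2)"
  by (simp add: berg_inner_self)

text \<open>Completeness of a weighted l^2 space, carried over by \<open>taylor_coeff\<close> and
  \<open>synth\<close>.\<close>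

lemma bergman_complete:
  assumes X: "\<And>n. X n \<in> H"
    and C: "\<And>e. e > 0 \<Longrightarrow> \<exists>N. \<forall>m\<ge>N. \<forall>n\<ge>N.
         Re (berg_inner \<alpha> (\<lambda>z. X m z - X n z) (\<lambda>z. X m z - X n z)) < e"
  shows "\<exists>l\<in>H. (\<lambda>n. Re (berg_inner \<alpha> (\<lambda>z. X n z - l z) (\<lambda>z. X n z - l z))) \<longlonglongrightarrow> 0"
proof -
  define a where "a m k = taylor_coeff (X m) k" for m k
  define d where "d m n = Re (berg_inner \<alpha> (\<lambda>z. X m z - X n z) (\<lambda>z. X m z - X n z))" for m n
  have sa: "summable (\<lambda>k. w k * (cmod (a m k))\<^sup>2)" for m unfolding a_def by (rule H_sum[OF X])
  have sd: "summable (\<lambda>k. w k * (cmod (a m k - a n k))\<^sup>2)" for m n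
    using H_sum[OF bergman_diff[OF X X, of m n]] by (simp add: a_def taylor_coeff_diff H_hol X)
  have d: "d m n = (\<Sum>k. w k * (cmod (a m k - a n k))\<^sup>2)" for m n
    unfolding d_def by (simp add: Re_berg_inner_self bergman_diff X taylor_coeff_diff H_hol a_def)
  have partial: "(\<Sum>k<K. w k * (cmod (a m k - a n k))\<^sup>2) \<le> d m n" for K m n
    unfolding d by (rule sum_le_suminf[OF sd]) (auto simp: w_nonneg)
  have coeff_bd: "w k * (cmod (a m k - a n k))\<^sup>2 \<le> d m n" for k m n
  proof -
    have "w k * (cmod (a m k - a n k))\<^sup>2 \<le> (\<Sum>k<Suc k. w k * (cmod (a m k - a n k))\<^sup>2)"
      by (simp add: sum_nonneg w_nonneg)
    thus ?thesis using partial order_trans by blast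
  qed
  have "Cauchy (\<lambda>m. a m k)" for k
  proof (rule CauchyI)
    fix e :: real assume e: "e > 0"
    have "w k * e\<^sup>2 > 0" using e w_pos by simp
    from C[OF this] obtain N where N: "\<And>m n. m \<ge> N \<Longrightarrow> n \<ge> N \<Longrightarrow> d m n < w k * e\<^sup>2"
      unfolding d_def by blast
    have "norm (a m k - a n k) < e" if "m \<ge> N" "n \<ge> N" for m n
    proof -
      have "w k * (cmod (a m k - a n k))\<^sup>2 < w k * e\<^sup>2" using coeff_bd N[OF that] by (rule le_less_trans)
      hence "(cmod (a m k - a n k))\<^sup>2 < e\<^sup>2" using w_pos[of k] by simp
      thus ?thesis using e by (intro power2_less_imp_less[of _ e]) auto
    qed
    thus "\<exists>M. \<forall>m\<ge>M. \<forall>n\<ge>M. norm (a m k - a n k) < e" by blast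
  qed
  hence "\<exists>l. (\<lambda>m. a m k) \<longlonglongrightarrow> l" for k using Cauchy_convergent_iff convergent_def by blast
  then obtain l where l: "\<And>k. (\<lambda>m. a m k) \<longlonglongrightarrow> l k" by metis
  \<comment> \<open>A bound on finite partial sums survives the coefficientwise limit; letting K
    grow afterwards gives the full norm.\<close>
  have lim_bd: "(\<Sum>k<K. w k * (cmod (a m k - l k))\<^sup>2) \<le> e"
    if "\<And>n. n \<ge> N \<Longrightarrow> d m n \<le> e" for K m N e
  proof (rule LIMSEQ_le_const2)
    show "(\<lambda>n. \<Sum>k<K. w k * (cmod (a m k - a n k))\<^sup>2) \<longlonglongrightarrow> (\<Sum>k<K. w k * (cmod (a m k - l k))\<^sup>2)"
      by (intro tendsto_intros l)
    show "\<exists>N. \<forall>n\<ge>N. (\<Sum>k<K. w k * (cmod (a m k - a n k))\<^sup>2) \<le> e"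
      using that partial order_trans by blast
  qed
  have s_lim: "summable (\<lambda>k. w k * (cmod (a m k - l k))\<^sup>2) \<and> (\<Sum>k. w k * (cmod (a m k - l k))\<^sup>2) \<le> e"
    if "\<And>n. n \<ge> N \<Longrightarrow> d m n \<le> e" for m N e
  proof -
    note b = lim_bd[of N m e, OF that]
    have "summable (\<lambda>k. w k * (cmod (a m k - l k))\<^sup>2)"
      by (rule bounded_imp_summable[of _ e]) (use b[of "Suc _"] w_nonneg in \<open>auto simp: lessThan_Suc_atMost\<close>)
    thus ?thesis using b by (auto intro: suminf_le_const)
  qed
  obtain N1 where N1: "\<And>m n. m \<ge> N1 \<Longrightarrow> n \<ge> N1 \<Longrightarrow> d m n < 1" using C[of 1] unfolding d_def by auto
  have "summable (\<lambda>k. w k * (cmod (a N1 k - l k))\<^sup>2)" using s_lim[of N1 N1 1] N1 by force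
  hence "summable (\<lambda>k. w k * (cmod (l k - a N1 k))\<^sup>2)" by (simp add: norm_minus_commute)
  from summable_add_sq[OF this sa[of N1]] have sl: "summable (\<lambda>k. w k * (cmod (l k))\<^sup>2)" by simp
  define L where "L = synth l"
  have L: "L \<in> H" unfolding L_def by (rule synth_in_H[OF sl])
  have dist: "Re (berg_inner \<alpha> (\<lambda>z. X n z - L z) (\<lambda>z. X n z - L z)) = (\<Sum>k. w k * (cmod (a n k - l k))\<^sup>2)" for n
    by (simp add: Re_berg_inner_self bergman_diff X L taylor_coeff_diff H_hol a_def) (simp add: L_def synth_coeff[OF sl])
  have "(\<lambda>n. Re (berg_inner \<alpha> (\<lambda>z. X n z - L z) (\<lambda>z. X n z - L z))) \<longlonglongrightarrow> 0"
  proof (rule LIMSEQ_I)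
    fix e :: real assume e: "e > 0"
    obtain N where N: "\<And>m n. m \<ge> N \<Longrightarrow> n \<ge> N \<Longrightarrow> d m n < e / 2" using C[of "e / 2"] e unfolding d_def by auto
    have "norm (Re (berg_inner \<alpha> (\<lambda>z. X n z - L z) (\<lambda>z. X n z - L z)) - 0) < e" if n: "n \<ge> N" for n
    proof -
      have s: "summable (\<lambda>k. w k * (cmod (a n k - l k))\<^sup>2)" "(\<Sum>k. w k * (cmod (a n k - l k))\<^sup>2) \<le> e / 2"
        using s_lim[of N n "e / 2"] N[OF n] by (auto simp: less_imp_le)
      have "0 \<le> (\<Sum>k. w k * (cmod (a n k - l k))\<^sup>2)" using s(1) by (intro suminf_nonneg) (auto simp: w_nonneg)
      thus ?thesis unfolding dist using s(2) e by simp
    qed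
    thus "\<exists>no. \<forall>n\<ge>no. norm (Re (berg_inner \<alpha> (\<lambda>z. X n z - L z) (\<lambda>z. X n z - L z)) - 0) < e" by blast
  qed
  thus ?thesis using L by blast
qed

lemma suminf_zero_coeff:
  assumes f: "f \<in> H" and z: "(\<Sum>n. w n * (cmod (taylor_coeff f n))\<^sup>2) = 0"
  shows "f = (\<lambda>z. 0)"
proof (rule H_eqI[OF f bergman_zero])
  fix n
  have "\<forall>n. w n * (cmod (taylor_coeff f n))\<^sup>2 = 0"
    using z by (subst (asm) suminf_eq_zero_iff[OF H_sum[OF f]]) (auto simp: w_nonneg)
  hence "taylor_coeff f n = 0" using w_pos[of n] by (auto dest: spec[of _ n])
  moreover have "taylor_coeff (\<lambda>z. 0) n = 0" using taylor_coeff_scale[of "\<lambda>z. 0" 0 n] by simp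
  ultimately show "taylor_coeff f n = taylor_coeff (\<lambda>z. 0) n" by simp
qed

sublocale function_hilbert_space "bergman \<alpha>" "berg_inner \<alpha>"
proof
  fix f assume f: "f \<in> H"
  show "0 \<le> Re (berg_inner \<alpha> f f)"
    using f H_sum[OF f] by (simp add: Re_berg_inner_self suminf_nonneg w_nonneg)
  show "Re (berg_inner \<alpha> f f) = 0 \<Longrightarrow> f = (\<lambda>z. 0)"
    using f suminf_zero_coeff[OF f] by (simp add: Re_berg_inner_self)
qed (auto intro: bergman_zero bergman_add bergman_scale berg_inner_add_left berg_inner_scale_left
     berg_inner_commute bergman_complete)

lemma nrm_eq: "nrm f = berg_norm \<alpha> f"
  by (simp add: nrm_def berg_norm_def)

lemma bop_eq: "bop S = bounded_op \<alpha> S"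
  by (auto simp: bop_def lin_def bounded_op_def nrm_eq)

lemma pos_eq: "pos S = positive_op \<alpha> S"
  by (simp add: pos_def positive_op_def bop_eq)

lemma nrm_sq_sum: "f \<in> H \<Longrightarrow> (nrm f)\<^sup>2 = (\<Sum>n. w n * (cmod (taylor_coeff f n))\<^sup>2)"
  by (simp add: nrm_sq Re_berg_inner_self)

lemma summable_ip:
  assumes "f \<in> H" "g \<in> H"
  shows "summable (\<lambda>n. complex_of_real (w n) * (taylor_coeff f n * cnj (taylor_coeff g n)))"
proof (rule summable_comparison_test'[OF summable_add[OF H_sum[OF assms(1)] H_sum[OF assms(2)]]])
  fix n
  have "norm (complex_of_real (w n) * (taylor_coeff f n * cnj (taylor_coeff g n)))
     = w n * (cmod (taylor_coeff f n) * cmod (taylor_coeff g n))" by (simp add: norm_mult w_nonneg)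
  also have "\<dots> \<le> w n * ((cmod (taylor_coeff f n))\<^sup>2 + (cmod (taylor_coeff g n))\<^sup>2)"
    by (intro mult_left_mono cmod_mult_le w_nonneg)
  finally show "norm (complex_of_real (w n) * (taylor_coeff f n * cnj (taylor_coeff g n)))
     \<le> w n * (cmod (taylor_coeff f n))\<^sup>2 + w n * (cmod (taylor_coeff g n))\<^sup>2" by (simp add: distrib_left)
qed

text \<open>Both sides are sesquilinear, so by polarisation it suffices to compare them on the diagonal.\<close>

lemma ip_sum:
  assumes f: "f \<in> H" and g: "g \<in> H"
  shows "berg_inner \<alpha> f g = (\<Sum>n. complex_of_real (w n) * (taylor_coeff f n * cnj (taylor_coeff g n)))"
proof -
  define S where "S f g = (\<Sum>n. complex_of_real (w n) * (taylor_coeff f n * cnj (taylor_coeff g n)))" for f g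
  have S_add: "S (\<lambda>z. f z + g z) h = S f h + S g h" "S h (\<lambda>z. f z + g z) = S h f + S h g"
    if "f \<in> H" "g \<in> H" "h \<in> H" for f g h
  proof -
    have "(\<lambda>n. complex_of_real (w n) * (taylor_coeff (\<lambda>z. f z + g z) n * cnj (taylor_coeff h n))) =
      (\<lambda>n. complex_of_real (w n) * (taylor_coeff f n * cnj (taylor_coeff h n)) + complex_of_real (w n) * (taylor_coeff g n * cnj (taylor_coeff h n)))"
      by (simp add: taylor_coeff_add H_hol that algebra_simps)
    thus "S (\<lambda>z. f z + g z) h = S f h + S g h"
      unfolding S_def by (simp only: suminf_add[OF summable_ip[OF that(1,3)] summable_ip[OF that(2,3)]])
    have "(\<lambda>n. complex_of_real (w n) * (taylor_coeff h n * cnj (taylor_coeff (\<lambda>z. f z + g z) n))) =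
      (\<lambda>n. complex_of_real (w n) * (taylor_coeff h n * cnj (taylor_coeff f n)) + complex_of_real (w n) * (taylor_coeff h n * cnj (taylor_coeff g n)))"
      by (simp add: taylor_coeff_add H_hol that algebra_simps)
    thus "S h (\<lambda>z. f z + g z) = S h f + S h g"
      unfolding S_def by (simp only: suminf_add[OF summable_ip[OF that(3,1)] summable_ip[OF that(3,2)]])
  qed
  have S_scale: "S (\<lambda>z. c * f z) h = c * S f h" "S h (\<lambda>z. c * f z) = cnj c * S h f"
    if "f \<in> H" "h \<in> H" for f h c
  proof -
    have "(\<lambda>n. complex_of_real (w n) * (taylor_coeff (\<lambda>z. c * f z) n * cnj (taylor_coeff h n))) =
      (\<lambda>n. c * (complex_of_real (w n) * (taylor_coeff f n * cnj (taylor_coeff h n))))"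
      by (simp add: taylor_coeff_scale H_hol that mult_ac)
    thus "S (\<lambda>z. c * f z) h = c * S f h"
      unfolding S_def by (simp only: suminf_mult[OF summable_ip[OF that]])
    have "(\<lambda>n. complex_of_real (w n) * (taylor_coeff h n * cnj (taylor_coeff (\<lambda>z. c * f z) n))) =
      (\<lambda>n. cnj c * (complex_of_real (w n) * (taylor_coeff h n * cnj (taylor_coeff f n))))"
      by (simp add: taylor_coeff_scale H_hol that mult_ac)
    thus "S h (\<lambda>z. c * f z) = cnj c * S h f"
      unfolding S_def by (simp only: suminf_mult[OF summable_ip[OF that(2,1)]])
  qed
  have S_self: "berg_inner \<alpha> f f = S f f" if "f \<in> H" for f
  proof -
    have "complex_of_real (w n) * (taylor_coeff f n * cnj (taylor_coeff f n)) = complex_of_real (w n * (cmod (taylor_coeff f n))\<^sup>2)" for n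
      by (simp only: of_real_mult complex_norm_square)
    thus ?thesis unfolding S_def berg_inner_self[OF that] by (simp only: suminf_of_real[OF H_sum[OF that]])
  qed
  define D where "D f g = berg_inner \<alpha> f g - S f g" for f g
  have D0: "D f f = 0" if "f \<in> H" for f using S_self[OF that] by (simp add: D_def)
  have ig: "(\<lambda>z. \<i> * g z) \<in> H" using g by (rule H_scale)
  have "D f g + D g f = 0"
    using D0[OF H_add[OF f g]] D0[OF f] D0[OF g] f g by (simp add: D_def ip_simps S_add H_add algebra_simps)
  moreover have "- \<i> * D f g + \<i> * D g f = 0"
    using D0[OF H_add[OF f ig]] D0[OF f] D0[OF g] f g ig
    by (simp add: D_def ip_simps S_add S_scale H_add algebra_simps)
  ultimately have "- (2 * \<i>) * D f g = 0" by (simp add: add_eq_0_iff algebra_simps)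
  hence "D f g = 0" by simp
  thus ?thesis by (simp add: D_def S_def)
qed

end

section \<open>Multipliers and their adjoints\<close>

definition bounded_multiplier :: "(complex \<Rightarrow> complex) \<Rightarrow> bool" where
  "bounded_multiplier u \<longleftrightarrow> u holomorphic_on unit_disk \<and> (\<exists>M. \<forall>z. cmod z < 1 \<longrightarrow> cmod (u z) \<le> M)"

lemma bounded_multiplierI:
  "u holomorphic_on unit_disk \<Longrightarrow> (\<And>z. cmod z < 1 \<Longrightarrow> cmod (u z) \<le> M) \<Longrightarrow> bounded_multiplier u"
  by (auto simp: bounded_multiplier_def)

lemma bounded_multiplier_mult:
  assumes "bounded_multiplier u" "bounded_multiplier v" shows "bounded_multiplier (\<lambda>z. u z * v z)"
proof -
  obtain M N where M: "\<And>z. cmod z < 1 \<Longrightarrow> cmod (u z) \<le> M" and N: "\<And>z. cmod z < 1 \<Longrightarrow> cmod (v z) \<le> N"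
    using assms unfolding bounded_multiplier_def by blast
  have "0 \<le> M" using M[of 0] order_trans[OF norm_ge_zero] by force
  hence "cmod (u z * v z) \<le> M * N" if "cmod z < 1" for z
    using M[OF that] N[OF that] by (simp add: norm_mult mult_mono)
  thus ?thesis using assms by (intro bounded_multiplierI[of _ "M * N"]) (auto simp: bounded_multiplier_def intro: holomorphic_intros)
qed

lemma bounded_multiplier_affine: "bounded_multiplier (\<lambda>z. a - c * z)"
proof (rule bounded_multiplierI)
  fix z :: complex assume z: "cmod z < 1"
  have "cmod (a - c * z) \<le> cmod a + cmod c * cmod z" using norm_triangle_ineq4[of a "c * z"] by (simp add: norm_mult)
  also have "\<dots> \<le> cmod a + cmod c * 1" using z by (intro add_left_mono mult_left_mono) auto
  finally show "cmod (a - c * z) \<le> cmod a + cmod c" by simp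
qed (intro holomorphic_intros)

lemma bounded_multiplier_id: "bounded_multiplier (\<lambda>z. z)"
  by (rule bounded_multiplierI[of _ 1]) auto

lemma bounded_multiplier_const: "bounded_multiplier (\<lambda>z. c)"
  by (rule bounded_multiplierI[of _ "cmod c"]) auto

context bergman_weight
begin

lemma nrm_sq_integral:
  assumes f: "f \<in> H"
  shows "(nrm f)\<^sup>2 = (\<alpha> + 1) * (LINT z|disk_area. (1 - (cmod z)\<^sup>2) powr \<alpha> * (cmod (f z))\<^sup>2)"
proof -
  have "berg_integrand f f z = complex_of_real ((1 - (cmod z)\<^sup>2) powr \<alpha> * (cmod (f z))\<^sup>2)" for z
    by (simp only: berg_integrand_def of_real_mult complex_norm_square)
  hence "(LINT z|disk_area. berg_integrand f f z) = complex_of_real (LINT z|disk_area. (1 - (cmod z)\<^sup>2) powr \<alpha> * (cmod (f z))\<^sup>2)"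
    by (simp only: integral_complex_of_real)
  thus ?thesis by (simp add: nrm_sq[OF f] berg_inner_eq[OF f f])
qed

lemma mult_in_H_bound:
  assumes u: "u holomorphic_on unit_disk" "\<And>z. cmod z < 1 \<Longrightarrow> cmod (u z) \<le> M" and f: "f \<in> H"
  shows "(\<lambda>z. u z * f z) \<in> H" "(nrm (\<lambda>z. u z * f z))\<^sup>2 \<le> M\<^sup>2 * (nrm f)\<^sup>2"
proof -
  let ?F = "\<lambda>z. (1 - (cmod z)\<^sup>2) powr \<alpha> * (cmod (f z))\<^sup>2"
  let ?G = "\<lambda>z. (1 - (cmod z)\<^sup>2) powr \<alpha> * (cmod (u z * f z))\<^sup>2"
  have hol: "(\<lambda>z. u z * f z) holomorphic_on unit_disk" using u H_hol[OF f] by (intro holomorphic_intros)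
  have Fi: "integrable disk_area ?F" using f by (simp add: A2_via_def)
  have bd: "?G z \<le> M\<^sup>2 * ?F z" if z: "cmod z < 1" for z
  proof -
    have "(cmod (u z * f z))\<^sup>2 = (cmod (u z))\<^sup>2 * (cmod (f z))\<^sup>2" by (simp add: norm_mult power_mult_distrib)
    also have "\<dots> \<le> M\<^sup>2 * (cmod (f z))\<^sup>2" using u(2)[OF z] by (intro mult_right_mono power_mono) auto
    finally have "?G z \<le> (1 - (cmod z)\<^sup>2) powr \<alpha> * (M\<^sup>2 * (cmod (f z))\<^sup>2)" by (intro mult_left_mono) auto
    thus ?thesis by (simp add: mult_ac)
  qed
  have Gi: "integrable disk_area ?G"
  proof (rule Bochner_Integration.integrable_bound)
    show "integrable disk_area (\<lambda>z. M\<^sup>2 * ?F z)" using Fi by (rule integrable_mult_right)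
    have "(\<lambda>z. (cmod (u z * f z))\<^sup>2) \<in> borel_measurable disk_area"
      by (intro continuous_imp_measurable_disk_area continuous_intros holomorphic_on_imp_continuous_on u(1) H_hol[OF f])
    thus "?G \<in> borel_measurable disk_area" by (rule borel_measurable_times[OF measurable_weight])
    show "AE z in disk_area. norm (?G z) \<le> norm (M\<^sup>2 * ?F z)"
      using bd by (intro AE_I2) (auto simp: abs_mult intro: order_trans[OF _ abs_ge_self])
  qed
  show H: "(\<lambda>z. u z * f z) \<in> H" using hol Gi f by (simp add: A2_via_def)
  have "(LINT z|disk_area. ?G z) \<le> (LINT z|disk_area. M\<^sup>2 * ?F z)"
    using bd by (intro integral_mono Gi integrable_mult_right Fi) auto
  hence "(\<alpha> + 1) * (LINT z|disk_area. ?G z) \<le> (\<alpha> + 1) * (M\<^sup>2 * (LINT z|disk_area. ?F z))"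
    using \<alpha> by (intro mult_left_mono) auto
  thus "(nrm (\<lambda>z. u z * f z))\<^sup>2 \<le> M\<^sup>2 * (nrm f)\<^sup>2"
    unfolding nrm_sq_integral[OF H] nrm_sq_integral[OF f] by (simp only: mult.left_commute)
qed

lemma mult_in_H: "bounded_multiplier u \<Longrightarrow> f \<in> H \<Longrightarrow> (\<lambda>z. u z * f z) \<in> H"
  unfolding bounded_multiplier_def by (metis mult_in_H_bound(1))

lemma bop_mult: "bounded_multiplier u \<Longrightarrow> bop (mult_op u)"
proof -
  assume u: "bounded_multiplier u"
  then obtain M where M: "\<And>z. cmod z < 1 \<Longrightarrow> cmod (u z) \<le> M" and hol: "u holomorphic_on unit_disk"
    unfolding bounded_multiplier_def by blast
  have M0: "0 \<le> M" using M[of 0] order_trans[OF norm_ge_zero] by force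
  have "nrm (mult_op u f) \<le> M * nrm f" if f: "f \<in> H" for f
  proof (rule power2_le_imp_le)
    show "(nrm (mult_op u f))\<^sup>2 \<le> (M * nrm f)\<^sup>2"
      using mult_in_H_bound(2)[OF hol M f] by (simp add: mult_op_def power_mult_distrib)
    show "0 \<le> M * nrm f" using M0 nrm_nonneg[OF f] by simp
  qed
  thus ?thesis unfolding bop_def lin_def
    using mult_in_H[OF u] by (auto simp: mult_op_def algebra_simps)
qed

definition adj :: "(complex \<Rightarrow> complex) \<Rightarrow> (complex \<Rightarrow> complex) \<Rightarrow> (complex \<Rightarrow> complex)" where
  "adj u = op_adjoint \<alpha> (mult_op u)"

lemma adj_prop:
  assumes "bounded_multiplier u"
  shows "bop (adj u) \<and> (\<forall>f\<in>H. \<forall>g\<in>H. berg_inner \<alpha> (mult_op u f) g = berg_inner \<alpha> f (adj u g))"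
  using someI_ex[OF adjoint_exists[OF bop_mult[OF assms]]]
  unfolding adj_def op_adjoint_def bop_eq by blast

lemma adj_in_H: "bounded_multiplier u \<Longrightarrow> g \<in> H \<Longrightarrow> adj u g \<in> H"
  using adj_prop lin_in bop_lin by blast

lemma adj_ip:
  assumes "bounded_multiplier u" "f \<in> H" "g \<in> H"
  shows "berg_inner \<alpha> f (adj u g) = berg_inner \<alpha> (\<lambda>z. u z * f z) g"
  using adj_prop[OF assms(1)] assms(2,3) by (simp add: mult_op_def)

lemma adj_eqI:
  assumes "bounded_multiplier u" "g \<in> H" "x \<in> H"
    "\<And>f. f \<in> H \<Longrightarrow> berg_inner \<alpha> (\<lambda>z. u z * f z) g = berg_inner \<alpha> f x"
  shows "adj u g = x"
  by (rule ip_eqI) (simp_all add: assms adj_in_H adj_ip)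

text \<open>Elements of H vanish off the disk, so only the values of a multiplier inside matter.
  This allows the use of identities such as cancelling 1 - cnj a z against its reciprocal, which can
  fail outside.\<close>

lemma adj_cong:
  assumes "bounded_multiplier u" "bounded_multiplier v" "g \<in> H" "\<And>z. cmod z < 1 \<Longrightarrow> u z = v z"
  shows "adj u g = adj v g"
proof (rule adj_eqI[OF assms(1,3) adj_in_H[OF assms(2,3)]])
  fix f assume f: "f \<in> H"
  have "(\<lambda>z. u z * f z) = (\<lambda>z. v z * f z)"
  proof
    fix z show "u z * f z = v z * f z"
      using assms(4)[of z] A2_via_off_disk[OF f, of z] by (cases "cmod z < 1") auto
  qed
  thus "berg_inner \<alpha> (\<lambda>z. u z * f z) g = berg_inner \<alpha> f (adj v g)"
    using adj_ip[OF assms(2) f assms(3)] by simp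
qed

lemma adj_mult:
  assumes u: "bounded_multiplier u" and v: "bounded_multiplier v" and g: "g \<in> H"
  shows "adj (\<lambda>z. u z * v z) g = adj v (adj u g)"
proof (rule adj_eqI[OF bounded_multiplier_mult[OF u v] g])
  show "adj v (adj u g) \<in> H" by (intro adj_in_H u v g)
  fix f assume f: "f \<in> H"
  show "berg_inner \<alpha> (\<lambda>z. u z * v z * f z) g = berg_inner \<alpha> f (adj v (adj u g))"
    using adj_ip[OF v f adj_in_H[OF u g]] adj_ip[OF u mult_in_H[OF v f] g] by (simp add: mult.assoc)
qed

lemma adj_const: "g \<in> H \<Longrightarrow> adj (\<lambda>z. c) g = (\<lambda>z. cnj c * g z)"
  by (rule adj_eqI) (simp_all add: bounded_multiplier_const H_scale ip_simps)

lemma adj_affine: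
  assumes g: "g \<in> H"
  shows "adj (\<lambda>z. a - c * z) g = (\<lambda>z. cnj a * g z - cnj c * adj (\<lambda>z. z) g z)"
proof (rule adj_eqI[OF bounded_multiplier_affine g])
  let ?S = "adj (\<lambda>z. z) g"
  have S: "?S \<in> H" by (rule adj_in_H[OF bounded_multiplier_id g])
  show "(\<lambda>z. cnj a * g z - cnj c * ?S z) \<in> H" by (intro H_diff H_scale g S)
  fix f assume f: "f \<in> H"
  have zf: "(\<lambda>z. z * f z) \<in> H" by (rule mult_in_H[OF bounded_multiplier_id f])
  have "berg_inner \<alpha> (\<lambda>z. (a - c * z) * f z) g = berg_inner \<alpha> (\<lambda>z. a * f z - c * (z * f z)) g"
    by (simp add: algebra_simps)
  also have "\<dots> = a * berg_inner \<alpha> f g - c * berg_inner \<alpha> f ?S"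
    unfolding adj_ip[OF bounded_multiplier_id f g] using f g zf by (simp add: ip_simps H_scale)
  also have "\<dots> = berg_inner \<alpha> f (\<lambda>z. cnj a * g z - cnj c * ?S z)"
    using f g S by (simp add: ip_simps H_scale)
  finally show "berg_inner \<alpha> (\<lambda>z. (a - c * z) * f z) g = berg_inner \<alpha> f (\<lambda>z. cnj a * g z - cnj c * ?S z)" .
qed

definition defect_form :: "(complex \<Rightarrow> complex) \<Rightarrow> (complex \<Rightarrow> complex) \<Rightarrow> real" where
  "defect_form u h = (nrm h)\<^sup>2 - (nrm (adj u h))\<^sup>2"

abbreviation "shift_form \<equiv> defect_form (\<lambda>z. z)"

text \<open>Inserting |T_u* h|^2 makes the difference telescope, because the adjoint of the product
  applies \<open>adj u\<close> first and \<open>adj v\<close> second.\<close>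

lemma defect_form_mult:
  assumes "bounded_multiplier u" "bounded_multiplier v" "h \<in> H"
  shows "defect_form (\<lambda>z. u z * v z) h = defect_form u h + defect_form v (adj u h)"
  by (simp add: defect_form_def adj_mult[OF assms])

lemma contraction_multiplier:
  assumes "u holomorphic_on unit_disk" "\<forall>z\<in>unit_disk. cmod (u z) \<le> 1" shows "bounded_multiplier u"
  using assms by (intro bounded_multiplierI[of _ 1]) auto

lemma nrm_mult_le:
  assumes u: "u holomorphic_on unit_disk" "\<forall>z\<in>unit_disk. cmod (u z) \<le> 1" and f: "f \<in> H"
  shows "nrm (\<lambda>z. u z * f z) \<le> nrm f"
  by (rule power2_le_imp_le) (use mult_in_H_bound(2)[OF u(1) _ f, of 1] u(2) nrm_nonneg[OF f] in auto)

lemma nrm_adj_le: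
  assumes u: "u holomorphic_on unit_disk" "\<forall>z\<in>unit_disk. cmod (u z) \<le> 1" and h: "h \<in> H"
  shows "nrm (adj u h) \<le> nrm h"
proof -
  note b = contraction_multiplier[OF u]
  define x where "x = adj u h"
  have x: "x \<in> H" unfolding x_def by (rule adj_in_H[OF b h])
  have "(nrm x)\<^sup>2 = cmod (berg_inner \<alpha> x x)" using x by (simp add: ip_self norm_power)
  also have "berg_inner \<alpha> x x = berg_inner \<alpha> (\<lambda>z. u z * x z) h" using adj_ip[OF b x h] by (simp add: x_def)
  also have "cmod \<dots> \<le> nrm (\<lambda>z. u z * x z) * nrm h" by (intro cauchy_schwarz mult_in_H b x h)
  also have "\<dots> \<le> nrm x * nrm h" by (intro mult_right_mono nrm_mult_le u x nrm_nonneg h)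
  finally have "nrm x * nrm x \<le> nrm x * nrm h" by (simp add: power2_eq_square)
  thus ?thesis using nrm_nonneg[OF x] nrm_nonneg[OF h] by (cases "nrm x = 0") (auto simp: x_def mult_le_cancel_left)
qed

lemma defect_form_nonneg:
  assumes u: "u holomorphic_on unit_disk" "\<forall>z\<in>unit_disk. cmod (u z) \<le> 1" and h: "h \<in> H"
  shows "0 \<le> defect_form u h"
  using power_mono[OF nrm_adj_le[OF assms] nrm_nonneg[OF adj_in_H[OF contraction_multiplier[OF u] h]], of 2]
  by (simp add: defect_form_def)

lemma shift_form_nonneg: "h \<in> H \<Longrightarrow> 0 \<le> shift_form h"
  by (rule defect_form_nonneg) auto

text \<open>The series construction applies to A = T T*, a self-adjoint contraction, so the choice
  in \<open>op_sqrt\<close> has a witness; pairing R (R f) with f then gives the form.\<close>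

lemma defect_op_prop:
  assumes u: "u holomorphic_on unit_disk" "\<forall>z\<in>unit_disk. cmod (u z) \<le> 1"
  shows "pos (defect_op \<alpha> u)" "f \<in> H \<Longrightarrow> (nrm (defect_op \<alpha> u f))\<^sup>2 = defect_form u f"
proof -
  note b = contraction_multiplier[OF u]
  let ?A = "\<lambda>f. mult_op u (adj u f)"
  let ?R = "defect_op \<alpha> u"
  have Ladj: "lin (adj u)" and Lm: "lin (mult_op u)" using adj_prop[OF b] bop_mult[OF b] by (auto intro: bop_lin)
  have Ain: "?A f \<in> H" if "f \<in> H" for f using that by (intro lin_in[OF Lm] lin_in[OF Ladj])
  have lA: "lin ?A"
    unfolding lin_def by (auto simp: Ain lin_add[OF Ladj] lin_scale[OF Ladj] lin_add[OF Lm] lin_scale[OF Lm] lin_in[OF Ladj])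
  have ipA: "berg_inner \<alpha> (?A f) g = berg_inner \<alpha> (adj u f) (adj u g)" if "f \<in> H" "g \<in> H" for f g
    using adj_ip[OF b adj_in_H[OF b that(1)] that(2)] by (simp add: mult_op_def)
  have "\<exists>R. pos R \<and> (\<forall>f\<in>H. R (R f) = (\<lambda>z. f z - ?A f z))"
  proof (rule sqrt_exists[OF lA])
    fix f g assume fg: "f \<in> H" "g \<in> H"
    have "berg_inner \<alpha> f (?A g) = cnj (berg_inner \<alpha> (?A g) f)" using fg Ain by (intro ip_commute) auto
    also have "\<dots> = cnj (berg_inner \<alpha> (adj u g) (adj u f))" using fg by (simp add: ipA)
    also have "\<dots> = berg_inner \<alpha> (adj u f) (adj u g)" using fg adj_in_H[OF b] by (intro ip_commute[symmetric]) auto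
    finally show "berg_inner \<alpha> (?A f) g = berg_inner \<alpha> f (?A g)" using ipA fg by simp
  next
    fix f assume f: "f \<in> H"
    have "nrm (?A f) \<le> nrm (adj u f)" unfolding mult_op_def by (intro nrm_mult_le u adj_in_H b f)
    thus "nrm (?A f) \<le> nrm f" using nrm_adj_le[OF u f] by simp
  qed
  from someI_ex[OF this] have R: "pos ?R" "\<forall>f\<in>H. ?R (?R f) = (\<lambda>z. f z - ?A f z)"
    unfolding defect_op_def op_sqrt_def adj_def pos_eq by blast+
  show "pos ?R" by (rule R(1))
  assume f: "f \<in> H"
  have Rf: "?R f \<in> H" using R(1) f by (simp add: pos_def bop_def lin_in)
  have "complex_of_real ((nrm (?R f))\<^sup>2) = berg_inner \<alpha> f (?R (?R f))"
    using pos_selfadjoint[OF R(1) f Rf] Rf by (simp add: ip_self)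
  also have "\<dots> = berg_inner \<alpha> f f - cnj (berg_inner \<alpha> (?A f) f)"
    using R(2) f Ain[OF f] ip_commute[OF Ain[OF f] f] by (simp add: ip_simps)
  also have "\<dots> = complex_of_real (defect_form u f)"
    using ipA[OF f f] f adj_in_H[OF b f] by (simp add: ip_self defect_form_def)
  finally show "(nrm (?R f))\<^sup>2 = defect_form u f" by (simp only: of_real_eq_iff)
qed

section \<open>The shift on Taylor coefficients\<close>

text \<open>The plain power z^n does not vanish off the disk and so is no element of H;
  \<open>synth\<close> supplies its representative.\<close>

definition monomial :: "nat \<Rightarrow> complex \<Rightarrow> complex" where
  "monomial n = synth (\<lambda>k. if k = n then 1 else 0)"

lemma monomial_summable: "summable (\<lambda>k. w k * (cmod (if k = n then 1 else 0 :: complex))\<^sup>2)"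
  by (rule summable_finite[of "{n}"]) auto

lemma monomial_in_H: "monomial n \<in> H"
  unfolding monomial_def by (rule synth_in_H[OF monomial_summable])

lemma monomial_apply: "cmod z < 1 \<Longrightarrow> monomial n z = z ^ n"
  using synth_sums[OF monomial_summable[of n], of z] sums_single[of n "\<lambda>k. z ^ k"]
  unfolding monomial_def by (auto intro!: sums_unique2[of "\<lambda>k. (if k = n then 1 else 0) * z ^ k"] simp: if_distrib[where f = "\<lambda>x. x * _"] cong: if_cong)

lemma mult_monomial: "(\<lambda>z. z * monomial n z) = monomial (Suc n)"
proof
  fix z show "z * monomial n z = monomial (Suc n) z"
    by (cases "cmod z < 1") (auto simp: monomial_apply A2_via_off_disk[OF monomial_in_H])
qed

lemma ip_monomial: "g \<in> H \<Longrightarrow> berg_inner \<alpha> (monomial n) g = w n * cnj (taylor_coeff g n)"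
proof -
  assume g: "g \<in> H"
  have "berg_inner \<alpha> (monomial n) g = (\<Sum>k. if k = n then complex_of_real (w k) * cnj (taylor_coeff g k) else 0)"
    unfolding ip_sum[OF monomial_in_H g] by (intro suminf_cong) (simp add: monomial_def synth_coeff[OF monomial_summable])
  also have "\<dots> = w n * cnj (taylor_coeff g n)"
    by (rule sums_unique[symmetric], rule sums_single)
  finally show ?thesis .
qed

text \<open>Pairing with z^n produces the weight w_n for the adjoint and, through z * z^n, the
  weight w_(n+1) for h; the factor is their quotient.\<close>

lemma coeff_adj_shift:
  assumes h: "h \<in> H"
  shows "taylor_coeff (adj (\<lambda>z. z) h) n = complex_of_real ((real n + 1) / (real n + \<alpha> + 2)) * taylor_coeff h (Suc n)"
proof -
  have "w n * cnj (taylor_coeff (adj (\<lambda>z. z) h) n) = w (Suc n) * cnj (taylor_coeff h (Suc n))"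
    using adj_ip[OF bounded_multiplier_id monomial_in_H[of n] h] ip_monomial[OF h, of "Suc n"]
      ip_monomial[OF adj_in_H[OF bounded_multiplier_id h], of n] by (simp add: mult_monomial)
  also have "\<dots> = w n * (complex_of_real ((real n + 1) / (real n + \<alpha> + 2)) * cnj (taylor_coeff h (Suc n)))"
    unfolding wt_Suc[OF \<alpha>] by simp
  finally have *: "w n * cnj (taylor_coeff (adj (\<lambda>z. z) h) n) = w n * (complex_of_real ((real n + 1) / (real n + \<alpha> + 2)) * cnj (taylor_coeff h (Suc n)))" .
  have "complex_of_real (w n) \<noteq> 0" using w_pos[of n] by simp
  from mult_left_cancel[OF this, THEN iffD1, OF *]
  have "cnj (taylor_coeff (adj (\<lambda>z. z) h) n) = complex_of_real ((real n + 1) / (real n + \<alpha> + 2)) * cnj (taylor_coeff h (Suc n))" .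
  from arg_cong[OF this, of cnj] show ?thesis by simp
qed

lemma shift_form_summable:
  assumes h: "h \<in> H"
  shows "summable (\<lambda>n. (\<alpha> + 1) / (real n + \<alpha> + 1) * (w n * (cmod (taylor_coeff h n))\<^sup>2))"
proof (rule summable_comparison_test'[OF H_sum[OF h], of 0])
  fix n
  have "(\<alpha> + 1) / (real n + \<alpha> + 1) \<le> 1" "0 \<le> (\<alpha> + 1) / (real n + \<alpha> + 1)" using \<alpha> by auto
  thus "norm ((\<alpha> + 1) / (real n + \<alpha> + 1) * (w n * (cmod (taylor_coeff h n))\<^sup>2)) \<le> w n * (cmod (taylor_coeff h n))\<^sup>2"
    using mult_right_mono[of "(\<alpha> + 1) / (real n + \<alpha> + 1)" 1 "w n * (cmod (taylor_coeff h n))\<^sup>2"] w_nonneg[of n]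
    by (simp only: real_norm_def abs_mult abs_of_nonneg) simp
qed

lemma shift_form_sum:
  assumes h: "h \<in> H"
  shows "shift_form h = (\<Sum>n. (\<alpha> + 1) / (real n + \<alpha> + 1) * (w n * (cmod (taylor_coeff h n))\<^sup>2))"
proof -
  let ?t = "\<lambda>n. w n * (cmod (taylor_coeff h n))\<^sup>2"
  \<comment> \<open>The factor n kills the term at 0, so reindexing by one loses nothing; the
    complement of n / (n + \<alpha> + 1) to 1 is the diagonal weight.\<close>
  let ?s = "\<lambda>n. real n / (real n + \<alpha> + 1) * ?t n"
  have S: "adj (\<lambda>z. z) h \<in> H" by (rule adj_in_H[OF bounded_multiplier_id h])
  have eq: "w n * (cmod (taylor_coeff (adj (\<lambda>z. z) h) n))\<^sup>2 = ?s (Suc n)" for n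
  proof -
    define r where "r = (real n + 1) / (real n + \<alpha> + 2)"
    have "w n * (cmod (taylor_coeff (adj (\<lambda>z. z) h) n))\<^sup>2 = r * (r * w n * (cmod (taylor_coeff h (Suc n)))\<^sup>2)"
      unfolding coeff_adj_shift[OF h] r_def[symmetric] by (simp add: norm_mult power_mult_distrib power2_eq_square)
    also have "r * w n = w (Suc n)" by (simp add: wt_Suc[OF \<alpha>] r_def)
    finally show ?thesis by (simp add: r_def add_ac)
  qed
  have "(nrm (adj (\<lambda>z. z) h))\<^sup>2 = (\<Sum>n. ?s (Suc n))" unfolding nrm_sq_sum[OF S] eq ..
  moreover have s0: "summable (\<lambda>n. ?s (Suc n))" using H_sum[OF S] unfolding eq .
  moreover have "summable ?s" using s0 summable_Suc_iff[of ?s] by blast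
  ultimately have "shift_form h = suminf ?t - suminf ?s" "summable ?s"
    using suminf_split_head[of ?s] by (auto simp: defect_form_def nrm_sq_sum[OF h])
  hence "shift_form h = (\<Sum>n. ?t n - ?s n)" using suminf_diff[OF H_sum[OF h]] by simp
  also have "\<dots> = (\<Sum>n. (\<alpha> + 1) / (real n + \<alpha> + 1) * ?t n)"
  proof (rule suminf_cong)
    fix n
    have "real n + \<alpha> + 1 \<noteq> 0" using \<alpha> by auto
    hence "1 - real n / (real n + \<alpha> + 1) = (\<alpha> + 1) / (real n + \<alpha> + 1)" by (simp add: field_simps)
    thus "?t n - ?s n = (\<alpha> + 1) / (real n + \<alpha> + 1) * ?t n"
      by (metis left_diff_distrib mult_1)
  qed
  finally show ?thesis .
qed

end

section \<open>The dual Dirichlet norm\<close>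

context bergman_weight
begin

text \<open>Relative to w_n the weights are the reciprocals of those of \<open>shift_form\<close>.
  On \<open>dirichlet_space\<close> the value is |v|^2 plus the Dirichlet integral with exponent
  \<alpha> + 1, divided by \<alpha> + 1.\<close>

definition dirichlet_sq :: "(complex \<Rightarrow> complex) \<Rightarrow> real" where
  "dirichlet_sq v = (\<Sum>n. (real n + \<alpha> + 1) / (\<alpha> + 1) * (w n * (cmod (taylor_coeff v n))\<^sup>2))"

text \<open>This is A^2_(\<alpha>-1), described by coefficients and hence without reference to an
  order of derivative.\<close>

definition dirichlet_space :: "(complex \<Rightarrow> complex) set" where
  "dirichlet_space = {v \<in> H. summable (\<lambda>n. real n * w n * (cmod (taylor_coeff v n))\<^sup>2)}"

lemma dirichlet_space_H: "v \<in> dirichlet_space \<Longrightarrow> v \<in> H" by (simp add: dirichlet_space_def)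

lemma dirichlet_sq_summable:
  assumes v: "v \<in> dirichlet_space"
  shows "summable (\<lambda>n. (real n + \<alpha> + 1) / (\<alpha> + 1) * (w n * (cmod (taylor_coeff v n))\<^sup>2))"
    and "dirichlet_sq v = (nrm v)\<^sup>2 + (\<Sum>n. real n * w n * (cmod (taylor_coeff v n))\<^sup>2) / (\<alpha> + 1)"
proof -
  let ?t = "\<lambda>n. w n * (cmod (taylor_coeff v n))\<^sup>2" and ?s = "\<lambda>n. real n * w n * (cmod (taylor_coeff v n))\<^sup>2"
  have s: "summable ?s" using v by (simp add: dirichlet_space_def)
  have eq: "(real n + \<alpha> + 1) / (\<alpha> + 1) * ?t n = ?t n + ?s n / (\<alpha> + 1)" for n
    using \<alpha> by (simp add: field_simps)
  show "summable (\<lambda>n. (real n + \<alpha> + 1) / (\<alpha> + 1) * ?t n)"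
    unfolding eq by (intro summable_add summable_divide s H_sum dirichlet_space_H v)
  show "dirichlet_sq v = (nrm v)\<^sup>2 + suminf ?s / (\<alpha> + 1)"
    unfolding dirichlet_sq_def eq nrm_sq_sum[OF dirichlet_space_H[OF v]] suminf_divide[OF s, symmetric]
    by (rule suminf_add[symmetric]) (intro summable_divide s H_sum dirichlet_space_H v)+
qed

lemma dirichlet_sq_nonneg: "v \<in> dirichlet_space \<Longrightarrow> 0 \<le> dirichlet_sq v"
  unfolding dirichlet_sq_def using \<alpha> by (intro suminf_nonneg dirichlet_sq_summable(1)) (auto simp: w_nonneg)

text \<open>\<open>dirichlet_sq\<close> and \<open>shift_form\<close> are dual quadratic forms.\<close>

lemma shift_form_pairing:
  assumes h: "h \<in> H" and v: "v \<in> dirichlet_space"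
  shows "(cmod (berg_inner \<alpha> h v))\<^sup>2 \<le> shift_form h * dirichlet_sq v"
proof -
  \<comment> \<open>Multiplying h_n by r_n and dividing v_n by r_n leaves the pairing unchanged and
    turns the two forms into squared norms in H, where Cauchy-Schwarz applies.\<close>
  define r where "r n = sqrt ((\<alpha> + 1) / (real n + \<alpha> + 1))" for n
  have r: "r n > 0" "(r n)\<^sup>2 = (\<alpha> + 1) / (real n + \<alpha> + 1)" "1 / (r n)\<^sup>2 = (real n + \<alpha> + 1) / (\<alpha> + 1)" for n
    using \<alpha> by (auto simp: r_def)
  define h' where "h' = synth (\<lambda>n. complex_of_real (r n) * taylor_coeff h n)"
  define v' where "v' = synth (\<lambda>n. taylor_coeff v n / complex_of_real (r n))"
  have eh: "w n * (cmod (complex_of_real (r n) * taylor_coeff h n))\<^sup>2 = (\<alpha> + 1) / (real n + \<alpha> + 1) * (w n * (cmod (taylor_coeff h n))\<^sup>2)" for n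
    unfolding norm_mult power_mult_distrib norm_of_real power2_abs r(2) by (simp add: mult_ac)
  have ev: "w n * (cmod (taylor_coeff v n / complex_of_real (r n)))\<^sup>2 = (real n + \<alpha> + 1) / (\<alpha> + 1) * (w n * (cmod (taylor_coeff v n))\<^sup>2)" for n
    unfolding norm_divide power_divide norm_of_real power2_abs r(3)[symmetric] by (simp add: mult_ac)
  have sh: "summable (\<lambda>n. w n * (cmod (complex_of_real (r n) * taylor_coeff h n))\<^sup>2)"
    unfolding eh by (rule shift_form_summable[OF h])
  have sv: "summable (\<lambda>n. w n * (cmod (taylor_coeff v n / complex_of_real (r n)))\<^sup>2)"
    unfolding ev by (rule dirichlet_sq_summable(1)[OF v])
  have in_H: "h' \<in> H" "v' \<in> H" unfolding h'_def v'_def by (rule synth_in_H[OF sh], rule synth_in_H[OF sv])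
  have "berg_inner \<alpha> h v = berg_inner \<alpha> h' v'"
    unfolding ip_sum[OF h dirichlet_space_H[OF v]] ip_sum[OF in_H]
  proof (rule suminf_cong)
    fix n show "complex_of_real (w n) * (taylor_coeff h n * cnj (taylor_coeff v n)) = complex_of_real (w n) * (taylor_coeff h' n * cnj (taylor_coeff v' n))"
      unfolding h'_def v'_def synth_coeff[OF sh] synth_coeff[OF sv] using r(1)[of n] by simp
  qed
  hence "(cmod (berg_inner \<alpha> h v))\<^sup>2 \<le> (nrm h' * nrm v')\<^sup>2"
    using cauchy_schwarz[OF in_H] by (intro power_mono) auto
  also have "\<dots> = (nrm h')\<^sup>2 * (nrm v')\<^sup>2" by (rule power_mult_distrib)
  also have "(nrm h')\<^sup>2 = shift_form h"
    unfolding nrm_sq_sum[OF in_H(1)] shift_form_sum[OF h] by (simp only: h'_def synth_coeff[OF sh] eh)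
  also have "(nrm v')\<^sup>2 = dirichlet_sq v"
    unfolding nrm_sq_sum[OF in_H(2)] dirichlet_sq_def by (simp only: v'_def synth_coeff[OF sv] ev)
  finally show ?thesis .
qed

lemma dirichlet_space_dirichlet:
  assumes v: "v \<in> dirichlet_space"
  shows "integrable disk_area (\<lambda>z. (1 - (cmod z)\<^sup>2) powr (\<alpha> + 1) * (cmod (deriv v z))\<^sup>2)"
    and "dirichlet_sq v = (nrm v)\<^sup>2 + (LINT z|disk_area. (1 - (cmod z)\<^sup>2) powr (\<alpha> + 1) * (cmod (deriv v z))\<^sup>2) / (\<alpha> + 1)"
  using dirichlet_integral[OF \<alpha> H_hol[OF dirichlet_space_H[OF v]]] dirichlet_sq_summable(2)[OF v] v by (auto simp: dirichlet_space_def)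

text \<open>In the product rule the term with the derivative of u is absorbed by the Bergman part of
  \<open>dirichlet_sq\<close>, since (1 - |z|^2)^(\<alpha>+1) \<le> (1 - |z|^2)^\<alpha>.\<close>

lemma mult_in_dirichlet_space:
  assumes u: "u holomorphic_on unit_disk" "\<And>z. cmod z < 1 \<Longrightarrow> cmod (u z) \<le> M" "\<And>z. cmod z < 1 \<Longrightarrow> cmod (deriv u z) \<le> M"
    and v: "v \<in> dirichlet_space"
  shows "(\<lambda>z. u z * v z) \<in> dirichlet_space" "dirichlet_sq (\<lambda>z. u z * v z) \<le> (3 * M\<^sup>2 + 2 * M\<^sup>2 / (\<alpha> + 1)\<^sup>2) * dirichlet_sq v"
proof -
  note vH = dirichlet_space_H[OF v]
  note uv = mult_in_H_bound[OF u(1,2) vH]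
  let ?W = "\<lambda>z::complex. (1 - (cmod z)\<^sup>2) powr (\<alpha> + 1)"
  let ?A = "\<lambda>z. (1 - (cmod z)\<^sup>2) powr \<alpha> * (cmod (v z))\<^sup>2"
  let ?B = "\<lambda>z. ?W z * (cmod (deriv v z))\<^sup>2"
  let ?D = "\<lambda>z. ?W z * (cmod (deriv (\<lambda>z. u z * v z) z))\<^sup>2"
  have A: "integrable disk_area ?A" using vH by (simp add: A2_via_def)
  have B: "integrable disk_area ?B" by (rule dirichlet_space_dirichlet(1)[OF v])
  have le: "?D z \<le> 2 * M\<^sup>2 * ?A z + 2 * M\<^sup>2 * ?B z" if z: "cmod z < 1" for z
  proof -
    have "deriv (\<lambda>z. u z * v z) z = u z * deriv v z + deriv u z * v z"
      using z u(1) H_hol[OF vH] by (intro deriv_mult) (auto intro: holomorphic_on_imp_differentiable_at)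
    hence "(cmod (deriv (\<lambda>z. u z * v z) z))\<^sup>2 \<le> 2 * (cmod (deriv u z * v z))\<^sup>2 + 2 * (cmod (u z * deriv v z))\<^sup>2"
      using cmod_add_sq_le[of "deriv u z * v z" "u z * deriv v z"] by (simp add: add.commute)
    also have "\<dots> \<le> 2 * (M\<^sup>2 * (cmod (v z))\<^sup>2) + 2 * (M\<^sup>2 * (cmod (deriv v z))\<^sup>2)"
      unfolding norm_mult power_mult_distrib
      using u(2)[OF z] u(3)[OF z] by (intro add_mono mult_left_mono mult_right_mono power_mono) auto
    finally have "?D z \<le> ?W z * (2 * (M\<^sup>2 * (cmod (v z))\<^sup>2) + 2 * (M\<^sup>2 * (cmod (deriv v z))\<^sup>2))"
      by (intro mult_left_mono) auto
    also have "\<dots> = 2 * M\<^sup>2 * (?W z * (cmod (v z))\<^sup>2) + 2 * M\<^sup>2 * ?B z" by (simp add: algebra_simps)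
    also have "?W z * (cmod (v z))\<^sup>2 \<le> ?A z"
    proof -
      have "0 < 1 - (cmod z)\<^sup>2" using z by (simp add: power_less_one_iff)
      hence "?W z \<le> (1 - (cmod z)\<^sup>2) powr \<alpha>" by (intro powr_mono') auto
      thus ?thesis by (intro mult_right_mono) auto
    qed
    hence "2 * M\<^sup>2 * (?W z * (cmod (v z))\<^sup>2) + 2 * M\<^sup>2 * ?B z \<le> 2 * M\<^sup>2 * ?A z + 2 * M\<^sup>2 * ?B z"
      by (intro add_right_mono mult_left_mono) auto
    finally show ?thesis .
  qed
  have S: "integrable disk_area (\<lambda>z. 2 * M\<^sup>2 * ?A z + 2 * M\<^sup>2 * ?B z)"
    by (intro Bochner_Integration.integrable_add integrable_mult_right A B)
  have D: "integrable disk_area ?D"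
  proof (rule Bochner_Integration.integrable_bound[OF S])
    have "(\<lambda>z. (cmod (deriv (\<lambda>z. u z * v z) z))\<^sup>2) \<in> borel_measurable disk_area"
      by (intro continuous_imp_measurable_disk_area continuous_intros holomorphic_on_imp_continuous_on holomorphic_deriv H_hol uv(1)) simp_all
    thus "?D \<in> borel_measurable disk_area" by (rule borel_measurable_times[OF measurable_weight])
    show "AE z in disk_area. norm (?D z) \<le> norm (2 * M\<^sup>2 * ?A z + 2 * M\<^sup>2 * ?B z)"
    proof (rule AE_I2)
      fix z assume "z \<in> space disk_area"
      hence "?D z \<le> 2 * M\<^sup>2 * ?A z + 2 * M\<^sup>2 * ?B z" by (intro le) simp
      moreover have "0 \<le> ?D z" by simp
      ultimately show "norm (?D z) \<le> norm (2 * M\<^sup>2 * ?A z + 2 * M\<^sup>2 * ?B z)" by (simp only: real_norm_def)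
    qed
  qed
  show uvD: "(\<lambda>z. u z * v z) \<in> dirichlet_space"
    using D dirichlet_integral(1)[OF \<alpha> H_hol[OF uv(1)]] uv(1) by (simp add: dirichlet_space_def)
  define a b where "a = (LINT z|disk_area. ?A z)" and "b = (LINT z|disk_area. ?B z)"
  have ab: "a \<ge> 0" "b \<ge> 0" unfolding a_def b_def by (auto intro!: integral_nonneg_AE)
  have Vv: "dirichlet_sq v = (\<alpha> + 1) * a + b / (\<alpha> + 1)"
    using dirichlet_space_dirichlet(2)[OF v] nrm_sq_integral[OF vH] by (simp add: a_def b_def)
  have "(LINT z|disk_area. ?D z) \<le> (LINT z|disk_area. 2 * M\<^sup>2 * ?A z + 2 * M\<^sup>2 * ?B z)"
    using le by (intro integral_mono D S) auto
  also have "\<dots> = 2 * M\<^sup>2 * a + 2 * M\<^sup>2 * b"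
    unfolding a_def b_def by (subst Bochner_Integration.integral_add) (auto intro!: integrable_mult_right A B)
  finally have "dirichlet_sq (\<lambda>z. u z * v z) \<le> M\<^sup>2 * ((\<alpha> + 1) * a) + (2 * M\<^sup>2 * a + 2 * M\<^sup>2 * b) / (\<alpha> + 1)"
    unfolding dirichlet_space_dirichlet(2)[OF uvD] using uv(2) \<alpha> nrm_sq_integral[OF vH]
    by (intro add_mono divide_right_mono) (auto simp: a_def)
  also have "\<dots> \<le> (3 * M\<^sup>2 + 2 * M\<^sup>2 / (\<alpha> + 1)\<^sup>2) * dirichlet_sq v"
  proof -
    \<comment> \<open>In terms of c a = |v|^2 and b / c the left side is (M^2 + 2 M^2 / c^2) times
      the first plus 2 M^2 times the second; the constant dominates both coefficients.\<close>
    define c where "c = \<alpha> + 1"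
    have c: "c > 0" using \<alpha> by (simp add: c_def)
    have "(3 * M\<^sup>2 + 2 * M\<^sup>2 / c\<^sup>2) * (c * a + b / c) - (M\<^sup>2 * (c * a) + (2 * M\<^sup>2 * a + 2 * M\<^sup>2 * b) / c)
      = 2 * M\<^sup>2 * (c * a) + M\<^sup>2 * b / c + 2 * M\<^sup>2 / c\<^sup>2 * (b / c)"
      using c by (simp add: field_simps power2_eq_square)
    also have "\<dots> \<ge> 0" using c ab by simp
    finally show ?thesis unfolding Vv c_def[symmetric] by simp
  qed
  finally show "dirichlet_sq (\<lambda>z. u z * v z) \<le> (3 * M\<^sup>2 + 2 * M\<^sup>2 / (\<alpha> + 1)\<^sup>2) * dirichlet_sq v" .
qed

text \<open>The coefficients of v are (\<alpha> + 1) / (n + \<alpha> + 1) times those of x, that is,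
  v = x - T_z T_z* x: the case of equality in \<open>shift_form_pairing\<close>.\<close>

lemma shift_form_extremal:
  assumes x: "x \<in> H"
  shows "\<exists>v\<in>dirichlet_space. dirichlet_sq v = shift_form x \<and> berg_inner \<alpha> v x = complex_of_real (shift_form x)"
proof -
  define r where "r n = (\<alpha> + 1) / (real n + \<alpha> + 1)" for n
  have r0: "r n > 0" "r n \<le> 1" "real n * r n \<le> \<alpha> + 1" "(real n + \<alpha> + 1) / (\<alpha> + 1) * r n = 1" for n
  proof -
    have pos: "real n + \<alpha> + 1 > 0" "\<alpha> + 1 > 0" using \<alpha> by auto
    show "r n > 0" "r n \<le> 1" using pos by (auto simp: r_def)
    show "(real n + \<alpha> + 1) / (\<alpha> + 1) * r n = 1" using pos by (simp add: r_def)
    have "real n / (real n + \<alpha> + 1) \<le> 1" using pos by simp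
    from mult_left_mono[OF this, of "\<alpha> + 1"] pos show "real n * r n \<le> \<alpha> + 1" by (simp add: r_def mult_ac)
  qed
  let ?a = "\<lambda>n. complex_of_real (r n) * taylor_coeff x n"
  let ?t = "\<lambda>n. w n * (cmod (taylor_coeff x n))\<^sup>2"
  have e: "w n * (cmod (?a n))\<^sup>2 = (r n)\<^sup>2 * ?t n" for n by (simp add: norm_mult power_mult_distrib mult_ac)
  have t0: "?t n \<ge> 0" for n by (simp add: w_nonneg)
  have s: "summable (\<lambda>n. w n * (cmod (?a n))\<^sup>2)"
  proof (rule summable_comparison_test'[OF H_sum[OF x], of 0])
    fix n
    have "(r n)\<^sup>2 * ?t n \<le> 1 * ?t n" using r0(1,2)[of n] t0 by (intro mult_right_mono power_le_one) auto
    thus "norm (w n * (cmod (?a n))\<^sup>2) \<le> ?t n" unfolding e using t0[of n] by (simp add: abs_of_nonneg del: abs_mult)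
  qed
  define v where "v = synth ?a"
  have vH: "v \<in> H" unfolding v_def by (rule synth_in_H[OF s])
  have cv: "taylor_coeff v n = ?a n" for n unfolding v_def by (rule synth_coeff[OF s])
  have v: "v \<in> dirichlet_space"
  proof -
    have "summable (\<lambda>n. real n * w n * (cmod (taylor_coeff v n))\<^sup>2)"
    proof (rule summable_comparison_test'[OF summable_mult[OF H_sum[OF x], of "\<alpha> + 1"], of 0])
      fix n
      have "real n * w n * (cmod (taylor_coeff v n))\<^sup>2 = (real n * r n) * r n * ?t n"
        unfolding cv using e[of n] by (simp add: power2_eq_square mult_ac)
      also have "\<dots> \<le> (\<alpha> + 1) * 1 * ?t n"
        using r0[of n] t0[of n] \<alpha> by (intro mult_right_mono mult_mono) auto
      finally show "norm (real n * w n * (cmod (taylor_coeff v n))\<^sup>2) \<le> (\<alpha> + 1) * ?t n"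
        using w_nonneg[of n] by simp
    qed
    thus ?thesis using vH by (simp add: dirichlet_space_def)
  qed
  have "dirichlet_sq v = shift_form x"
    unfolding dirichlet_sq_def shift_form_sum[OF x]
  proof (rule suminf_cong)
    fix n
    have "(real n + \<alpha> + 1) / (\<alpha> + 1) * (w n * (cmod (taylor_coeff v n))\<^sup>2) = ((real n + \<alpha> + 1) / (\<alpha> + 1) * r n) * r n * ?t n"
      unfolding cv e by (simp only: power2_eq_square mult_ac)
    thus "(real n + \<alpha> + 1) / (\<alpha> + 1) * (w n * (cmod (taylor_coeff v n))\<^sup>2) = (\<alpha> + 1) / (real n + \<alpha> + 1) * ?t n"
      unfolding r0(4) by (simp add: r_def)
  qed
  moreover have "berg_inner \<alpha> v x = complex_of_real (shift_form x)"
  proof -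
    have "complex_of_real (w n) * (taylor_coeff v n * cnj (taylor_coeff x n)) = complex_of_real (r n * ?t n)" for n
      unfolding cv by (simp only: of_real_mult complex_norm_square mult_ac)
    thus ?thesis unfolding ip_sum[OF vH x] shift_form_sum[OF x] r_def
      by (simp only: suminf_of_real[OF shift_form_summable[OF x]])
  qed
  ultimately show ?thesis using v by blast
qed

text \<open>Duality moves the bound for multiplication by u on \<open>dirichlet_space\<close> to the
  adjoint: with v extremal for x = T_u* h, the square of \<open>shift_form x\<close> is |<u v,
  h>|^2, hence at most \<open>shift_form h\<close> times C \<open>shift_form x\<close>, and one
  factor cancels.\<close>

lemma shift_form_adj_le:
  assumes u: "u holomorphic_on unit_disk" "\<And>z. cmod z < 1 \<Longrightarrow> cmod (u z) \<le> M" "\<And>z. cmod z < 1 \<Longrightarrow> cmod (deriv u z) \<le> M"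
    and h: "h \<in> H"
  shows "shift_form (adj u h) \<le> (3 * M\<^sup>2 + 2 * M\<^sup>2 / (\<alpha> + 1)\<^sup>2) * shift_form h"
proof -
  have b: "bounded_multiplier u" using u(1,2) by (rule bounded_multiplierI)
  define C where "C = 3 * M\<^sup>2 + 2 * M\<^sup>2 / (\<alpha> + 1)\<^sup>2"
  have C: "C \<ge> 0" by (simp add: C_def)
  define x where "x = adj u h"
  have x: "x \<in> H" unfolding x_def by (rule adj_in_H[OF b h])
  obtain v where v: "v \<in> dirichlet_space" "dirichlet_sq v = shift_form x" "berg_inner \<alpha> v x = complex_of_real (shift_form x)" using shift_form_extremal[OF x] by blast
  note uv = mult_in_dirichlet_space[OF u v(1), folded C_def]
  have "(shift_form x)\<^sup>2 = (cmod (berg_inner \<alpha> v x))\<^sup>2" unfolding v(3) by simp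
  also have "berg_inner \<alpha> v x = berg_inner \<alpha> (\<lambda>z. u z * v z) h"
    unfolding x_def by (rule adj_ip[OF b dirichlet_space_H[OF v(1)] h])
  also have "\<dots> = cnj (berg_inner \<alpha> h (\<lambda>z. u z * v z))" by (rule ip_commute[OF h dirichlet_space_H[OF uv(1)]])
  also have "(cmod \<dots>)\<^sup>2 \<le> shift_form h * dirichlet_sq (\<lambda>z. u z * v z)" using shift_form_pairing[OF h uv(1)] by simp
  also have "\<dots> \<le> shift_form h * (C * shift_form x)" using uv(2) shift_form_nonneg[OF h] v(2) by (intro mult_left_mono) auto
  finally have *: "shift_form x * shift_form x \<le> shift_form x * (C * shift_form h)" by (simp add: power2_eq_square mult_ac)
  show ?thesis
  proof (cases "shift_form x = 0")
    case True
    thus ?thesis using C shift_form_nonneg[OF h] by (simp add: x_def C_def)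
  next
    case False
    thus ?thesis using * shift_form_nonneg[OF x] by (simp add: x_def C_def mult_le_cancel_left)
  qed
qed

section \<open>Reproducing kernels\<close>

definition berg_kernel :: "complex \<Rightarrow> complex \<Rightarrow> complex" where
  "berg_kernel \<zeta> = synth (\<lambda>n. cnj \<zeta> ^ n / w n)"

lemma berg_kernel_summable:
  assumes "cmod \<zeta> < 1" shows "summable (\<lambda>n. w n * (cmod (cnj \<zeta> ^ n / w n))\<^sup>2)"
    and "w n * (cmod (cnj \<zeta> ^ n / w n))\<^sup>2 = ((cmod \<zeta>)\<^sup>2) ^ n / w n"
proof -
  show eq: "w n * (cmod (cnj \<zeta> ^ n / w n))\<^sup>2 = ((cmod \<zeta>)\<^sup>2) ^ n / w n" for n
    using w_pos[of n] by (simp add: norm_divide norm_power power_divide mult.commute power2_eq_square flip: power_mult_distrib)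
  have "(cmod \<zeta>)\<^sup>2 < 1" using assms by (simp add: power_less_one_iff)
  thus "summable (\<lambda>n. w n * (cmod (cnj \<zeta> ^ n / w n))\<^sup>2)" unfolding eq by (intro summable_kernel) auto
qed

lemma berg_kernel_in_H: "cmod \<zeta> < 1 \<Longrightarrow> berg_kernel \<zeta> \<in> H"
  unfolding berg_kernel_def by (intro synth_in_H berg_kernel_summable)

lemma berg_kernel_coeff: "cmod \<zeta> < 1 \<Longrightarrow> taylor_coeff (berg_kernel \<zeta>) n = cnj \<zeta> ^ n / w n"
  unfolding berg_kernel_def by (intro synth_coeff berg_kernel_summable)

lemma ip_kernel:
  assumes z: "cmod \<zeta> < 1" and f: "f \<in> H" shows "berg_inner \<alpha> f (berg_kernel \<zeta>) = f \<zeta>"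
proof -
  have eq: "complex_of_real (w n) * (taylor_coeff f n * cnj (taylor_coeff (berg_kernel \<zeta>) n)) = taylor_coeff f n * \<zeta> ^ n" for n
    unfolding berg_kernel_coeff[OF z] using w_pos[of n] by simp
  show ?thesis unfolding ip_sum[OF f berg_kernel_in_H[OF z]] eq
    by (rule sums_unique[OF taylor_sums[OF H_hol[OF f] z], symmetric])
qed

lemma adj_kernel:
  assumes z: "cmod \<zeta> < 1" and u: "bounded_multiplier u"
  shows "adj u (berg_kernel \<zeta>) = (\<lambda>z. cnj (u \<zeta>) * berg_kernel \<zeta> z)"
  by (rule adj_eqI) (simp_all add: u berg_kernel_in_H z H_scale ip_simps ip_kernel mult_in_H)

text \<open>All weights are at most 1, so the kernel on the diagonal dominates the geometric series.
  Its blow-up at the circle later makes the normalised kernels weakly null.\<close>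

lemma nrm_kernel_ge:
  assumes z: "cmod \<zeta> < 1" shows "1 / (1 - (cmod \<zeta>)\<^sup>2) \<le> (nrm (berg_kernel \<zeta>))\<^sup>2"
proof -
  have x: "(cmod \<zeta>)\<^sup>2 < 1" using z by (simp add: power_less_one_iff)
  have "1 / (1 - (cmod \<zeta>)\<^sup>2) = (\<Sum>n. ((cmod \<zeta>)\<^sup>2) ^ n)" using x by (simp add: suminf_geometric)
  also have "\<dots> \<le> (\<Sum>n. ((cmod \<zeta>)\<^sup>2) ^ n / w n)"
  proof (rule suminf_le)
    show "((cmod \<zeta>)\<^sup>2) ^ n \<le> ((cmod \<zeta>)\<^sup>2) ^ n / w n" for n
      using wt_le_1[OF \<alpha>, of n] w_pos[of n] mult_left_mono[of "w n" 1 "((cmod \<zeta>)\<^sup>2) ^ n"] by (simp add: field_simps)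
    show "summable (\<lambda>n. ((cmod \<zeta>)\<^sup>2) ^ n)" using x by (intro summable_geometric) simp
    show "summable (\<lambda>n. ((cmod \<zeta>)\<^sup>2) ^ n / w n)" using x by (intro summable_kernel) auto
  qed
  also have "\<dots> = (nrm (berg_kernel \<zeta>))\<^sup>2"
    unfolding nrm_sq_sum[OF berg_kernel_in_H[OF z]] berg_kernel_coeff[OF z] berg_kernel_summable(2)[OF z] ..
  finally show ?thesis .
qed

end

section \<open>A boundary characterisation of finite Blaschke products\<close>

definition moebius_factor :: "complex \<Rightarrow> complex \<Rightarrow> complex" where
  "moebius_factor a z = (a - z) / (1 - cnj a * z)"

lemma moebius_denominator:
  assumes "cmod a < 1" "cmod z < 1"
  shows "1 - cmod a \<le> cmod (1 - cnj a * z)" "1 - cnj a * z \<noteq> 0"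
proof -
  have "cmod (cnj a * z) \<le> cmod a * 1" unfolding norm_mult using assms by (intro mult_mono) auto
  thus 1: "1 - cmod a \<le> cmod (1 - cnj a * z)" using norm_triangle_ineq2[of 1 "cnj a * z"] by simp
  show "1 - cnj a * z \<noteq> 0" using 1 assms by force
qed

lemma moebius_factor_holomorphic [holomorphic_intros]:
  assumes "cmod a < 1" shows "moebius_factor a holomorphic_on unit_disk"
  unfolding moebius_factor_def using moebius_denominator(2)[OF assms] by (intro holomorphic_intros) auto

lemma moebius_factor_eq: "moebius_factor a z = - Moebius_function 0 a z"
  by (simp add: moebius_factor_def Moebius_function_simple minus_divide_left)

lemma moebius_factor_less_1: "cmod a < 1 \<Longrightarrow> cmod z < 1 \<Longrightarrow> cmod (moebius_factor a z) < 1"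
  using Moebius_function_norm_lt_1[of a z 0] by (simp add: moebius_factor_eq)

text \<open>Rests on |1 - cnj a z|^2 - |a - z|^2 = (1 - |a|^2) (1 - |z|^2).\<close>

lemma moebius_factor_norm:
  assumes "cmod a < 1" "cmod z < 1"
  shows "1 - (cmod (moebius_factor a z))\<^sup>2 = (1 - (cmod a)\<^sup>2) * (1 - (cmod z)\<^sup>2) / (cmod (1 - cnj a * z))\<^sup>2"
proof -
  define d where "d = cmod (1 - cnj a * z)"
  have d: "d \<noteq> 0" using moebius_denominator(2)[OF assms] by (simp add: d_def)
  have "complex_of_real (d\<^sup>2 - (cmod (a - z))\<^sup>2) = complex_of_real ((1 - (cmod a)\<^sup>2) * (1 - (cmod z)\<^sup>2))"
    unfolding d_def of_real_diff of_real_mult complex_norm_square by (simp add: algebra_simps)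
  hence *: "d\<^sup>2 - (cmod (a - z))\<^sup>2 = (1 - (cmod a)\<^sup>2) * (1 - (cmod z)\<^sup>2)" by (simp only: of_real_eq_iff)
  have "1 - (cmod (moebius_factor a z))\<^sup>2 = (d\<^sup>2 - (cmod (a - z))\<^sup>2) / d\<^sup>2"
  proof -
    have "(cmod (moebius_factor a z))\<^sup>2 = (cmod (a - z))\<^sup>2 / d\<^sup>2"
      unfolding moebius_factor_def norm_divide power_divide d_def[symmetric] ..
    thus ?thesis using d by (simp add: diff_divide_distrib)
  qed
  thus ?thesis unfolding * by (simp add: d_def)
qed

text \<open>Schwarz--Pick; scaling by \<open>t < 1\<close> reduces to the strict hypothesis of the Schwarz lemma.\<close>

lemma schwarz_pick_zero:
  assumes f: "f holomorphic_on unit_disk" "\<And>z. cmod z < 1 \<Longrightarrow> cmod (f z) \<le> 1"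
    and a: "cmod a < 1" "f a = 0" and z: "cmod z < 1"
  shows "cmod (f z) \<le> cmod (moebius_factor a z)"
proof -
  define M where "M = (\<lambda>w. moebius_factor a w)"
  have M: "cmod (M w) < 1" if "cmod w < 1" for w using moebius_factor_less_1[OF a(1) that] by (simp add: M_def)
  \<comment> \<open>M is an involution exchanging 0 and a. Hence f composed with M vanishes at 0,
    and the Schwarz lemma at the point M z speaks about f z.\<close>
  have MM: "M (M w) = w" if "cmod w < 1" for w
  proof -
    have d: "1 - cnj a * w \<noteq> 0" by (rule moebius_denominator(2)[OF a(1) that])
    have e: "1 - cnj a * M w \<noteq> 0" by (rule moebius_denominator(2)[OF a(1) M[OF that]])
    have "M w * (1 - cnj a * w) = a - w" using d by (simp add: M_def moebius_factor_def)
    hence "a - M w = w * (1 - cnj a * M w)" by (simp add: algebra_simps)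
    thus ?thesis using e by (simp add: M_def moebius_factor_def[of a "moebius_factor a w"])
  qed
  have "t * cmod (f z) \<le> cmod (M z)" if t: "0 < t" "t < 1" for t :: real
  proof -
    define g where "g w = of_real t * f (M w)" for w
    have Mhol: "M holomorphic_on unit_disk" unfolding M_def by (rule moebius_factor_holomorphic[OF a(1)])
    have "f \<circ> M holomorphic_on unit_disk"
      using M by (intro holomorphic_on_compose_gen[OF Mhol f(1)]) auto
    hence hol: "g holomorphic_on unit_disk" unfolding g_def by (intro holomorphic_intros) (simp add: comp_def)
    have g0: "g 0 = 0" using a by (simp add: g_def M_def moebius_factor_def)
    have g1: "norm (g w) < 1" if "norm w < 1" for w
    proof -
      have "norm (g w) \<le> t * 1" unfolding g_def norm_mult using f(2)[OF M[OF that]] t by (intro mult_mono) auto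
      thus ?thesis using t by simp
    qed
    have "norm (g (M z)) \<le> norm (M z)" by (rule Schwarz_Lemma(1)[OF hol g0 g1 M[OF z]])
    thus ?thesis using t MM[OF z] by (simp add: g_def norm_mult)
  qed
  hence ev: "\<forall>\<^sub>F t in at_left 1. t * cmod (f z) \<le> cmod (M z)"
    using eventually_at_left_real[of 0 1] by (auto elim!: eventually_mono)
  have "((\<lambda>t. t * cmod (f z)) \<longlongrightarrow> 1 * cmod (f z)) (at_left 1)" by (intro tendsto_intros)
  from tendsto_upperbound[OF this ev] show ?thesis by (simp add: M_def trivial_limit_at_left_real)
qed

text \<open>The quotient extends over the removable singularity at a. Schwarz-Pick bounds it by 1
  away from a, and continuity does so at a.\<close>

lemma divide_moebius_factor:
  assumes f: "f holomorphic_on unit_disk" "\<And>z. cmod z < 1 \<Longrightarrow> cmod (f z) \<le> 1"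
    and a: "cmod a < 1" "f a = 0"
  obtains g where "g holomorphic_on unit_disk" "\<And>z. cmod z < 1 \<Longrightarrow> cmod (g z) \<le> 1"
    "\<And>z. cmod z < 1 \<Longrightarrow> f z = moebius_factor a z * g z"
proof -
  define F where "F z = (if z = a then deriv f a else (f z - f a) / (z - a))" for z
  define g where "g z = - (1 - cnj a * z) * F z" for z
  have F: "F holomorphic_on unit_disk" unfolding F_def
    by (rule pole_lemma[OF f(1)]) (use a in simp)
  have g: "g holomorphic_on unit_disk" unfolding g_def by (intro holomorphic_intros F)
  have fg: "f z = moebius_factor a z * g z" if z: "cmod z < 1" for z
  proof (cases "z = a")
    case True
    thus ?thesis using a by (simp add: moebius_factor_def)
  next
    case False
    have d: "1 - cnj a * z \<noteq> 0" by (rule moebius_denominator(2)[OF a(1) z])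
    have "moebius_factor a z * g z = - (moebius_factor a z * (1 - cnj a * z)) * F z" by (simp add: g_def algebra_simps)
    also have "moebius_factor a z * (1 - cnj a * z) = a - z" using d by (simp add: moebius_factor_def)
    also have "- (a - z) * F z = f z" using False a by (simp add: F_def)
    finally show ?thesis ..
  qed
  have off: "cmod (g z) \<le> 1" if z: "cmod z < 1" "z \<noteq> a" for z
  proof -
    have "moebius_factor a z \<noteq> 0" using z moebius_denominator(2)[OF a(1) z(1)] by (simp add: moebius_factor_def)
    moreover have "cmod (moebius_factor a z) * cmod (g z) \<le> cmod (moebius_factor a z) * 1"
      using schwarz_pick_zero[OF f a z(1)] by (simp add: fg[OF z(1)] norm_mult)
    ultimately show ?thesis by (simp add: mult_le_cancel_left)
  qed
  have "cmod (g a) \<le> 1"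
  proof -
    have "isCont g a" using holomorphic_on_imp_continuous_on[OF g] a by (auto simp: continuous_on_eq_continuous_at)
    hence lim: "((\<lambda>z. cmod (g z)) \<longlongrightarrow> cmod (g a)) (at a)" by (intro tendsto_norm) (simp add: isCont_def)
    have "\<forall>\<^sub>F z in at a. z \<in> unit_disk - {a}" using a by (intro eventually_at_in_open) auto
    hence "\<forall>\<^sub>F z in at a. cmod (g z) \<le> 1" by eventually_elim (use off in auto)
    from tendsto_upperbound[OF lim this] show ?thesis by simp
  qed
  hence "cmod (g z) \<le> 1" if "cmod z < 1" for z using off[OF that] by (cases "z = a") auto
  thus ?thesis using that g fg by blast
qed

text \<open>For |f| \<le> 1 this says that |f| tends to 1 uniformly at the circle. It is phrased
  with 1 - |f|^2 because that is the defect form at a normalised kernel.\<close>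

definition unimodular_boundary :: "(complex \<Rightarrow> complex) \<Rightarrow> bool" where
  "unimodular_boundary f \<longleftrightarrow> (\<forall>e>0. \<exists>r<1. \<forall>z. r < cmod z \<and> cmod z < 1 \<longrightarrow> 1 - (cmod (f z))\<^sup>2 < e)"

text \<open>Without zeros, 1 / f is holomorphic and the maximum principle on large disks pushes |f|
  up to 1 everywhere; a function of constant modulus is constant.\<close>

lemma zero_free_unimodular_boundary:
  assumes f: "f holomorphic_on unit_disk" "\<And>z. cmod z < 1 \<Longrightarrow> cmod (f z) \<le> 1"
    and nz: "\<And>z. cmod z < 1 \<Longrightarrow> f z \<noteq> 0" and ub: "unimodular_boundary f"
  shows "\<exists>c. cmod c = 1 \<and> (\<forall>z. cmod z < 1 \<longrightarrow> f z = c)"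
proof -
  have ge: "1 - e \<le> (cmod (f z))\<^sup>2" if z: "cmod z < 1" and e: "0 < e" "e < 1" for z e
  proof -
    obtain r where r: "r < 1" "\<And>z. r < cmod z \<Longrightarrow> cmod z < 1 \<Longrightarrow> 1 - (cmod (f z))\<^sup>2 < e"
      using ub e unfolding unimodular_boundary_def by blast
    \<comment> \<open>The circle of radius s lies in the zone where f is nearly unimodular, and it
      encloses z.\<close>
    obtain s where "max r (cmod z) < s" "s < 1" using dense[of "max r (cmod z)" 1] r z by auto
    hence s: "r < s" "cmod z < s" "s < 1" by auto
    have s0: "0 < s" by (rule le_less_trans[OF norm_ge_zero s(2)])
    have h: "(\<lambda>z. 1 / f z) holomorphic_on cball 0 s"
      using nz s by (intro holomorphic_intros holomorphic_on_subset[OF f(1)]) auto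
    have bd: "norm (1 / f w) \<le> 1 / sqrt (1 - e)" if "w \<in> frontier (cball 0 s)" for w
    proof -
      have w: "cmod w = s" using that s0 by (simp add: frontier_cball)
      have "1 - e \<le> (cmod (f w))\<^sup>2" using r(2)[of w] w s by simp
      hence "sqrt (1 - e) \<le> cmod (f w)" by (intro real_le_lsqrt) auto
      thus ?thesis using e by (simp add: norm_divide frac_le)
    qed
    have "norm (1 / f z) \<le> 1 / sqrt (1 - e)"
      by (rule maximum_modulus_frontier[where S = "cball 0 s" and f = "\<lambda>z. 1 / f z"])
        (use s s0 h bd in \<open>auto intro: holomorphic_on_subset holomorphic_on_imp_continuous_on closed_cball simp: interior_cball\<close>)
    hence "sqrt (1 - e) \<le> cmod (f z)" using e nz[OF z] by (simp add: norm_divide divide_simps split: if_splits)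
    hence "(sqrt (1 - e))\<^sup>2 \<le> (cmod (f z))\<^sup>2" using e by (intro power_mono) auto
    thus ?thesis using e by simp
  qed
  have one: "cmod (f z) = 1" if z: "cmod z < 1" for z
  proof (rule antisym[OF f(2)[OF z]])
    have "1 \<le> (cmod (f z))\<^sup>2"
    proof (rule field_le_epsilon)
      fix e :: real assume "e > 0"
      hence "1 - min e (1/2) \<le> (cmod (f z))\<^sup>2" by (intro ge z) auto
      thus "1 \<le> (cmod (f z))\<^sup>2 + e" by (simp add: min_def split: if_splits)
    qed
    thus "1 \<le> cmod (f z)" by (intro power2_le_imp_le[of 1]) auto
  qed
  have "f constant_on unit_disk"
    by (rule maximum_modulus_principle[where U = unit_disk and \<xi> = 0, OF f(1)]) (auto simp: one)
  then obtain c where "\<And>z. cmod z < 1 \<Longrightarrow> f z = c" by (auto simp: constant_on_def)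
  thus ?thesis using one[of 0] by auto
qed

text \<open>All zeros lie in a fixed compact disk, so every Moebius factor shrinks a fixed nonzero value
  by a fixed amount; hence only finitely many factors can be split off.\<close>

lemma unimodular_boundary_imp_blaschke:
  assumes f: "f holomorphic_on unit_disk" "\<And>z. cmod z < 1 \<Longrightarrow> cmod (f z) \<le> 1" and ub: "unimodular_boundary f"
  shows "finite_blaschke_product f"
proof -
  obtain r0 where r0: "r0 < 1" "\<And>z. r0 < cmod z \<Longrightarrow> cmod z < 1 \<Longrightarrow> 1 - (cmod (f z))\<^sup>2 < 1"
    using ub unfolding unimodular_boundary_def by (meson zero_less_one)
  define r where "r = max r0 0"
  have r: "0 \<le> r" "r < 1" using r0 by (auto simp: r_def)
  have fnz: "f z \<noteq> 0" if "r < cmod z" "cmod z < 1" for z using r0(2)[of z] that by (auto simp: r_def)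
  \<comment> \<open>The zeros of f have modulus at most r, so f does not vanish at this point, which
    lies between r and 1.\<close>
  define z0 where "z0 = complex_of_real ((r + 1) / 2)"
  have z0: "cmod z0 = (r + 1) / 2" using r by (simp add: z0_def)
  have z0': "r < cmod z0" "cmod z0 < 1" using z0 r by auto
  \<comment> \<open>Since |1 - cnj a z0| \<le> 2, this bounds 1 - |b_a(z0)|^2 from below for every
    Moebius factor b_a with |a| \<le> r.\<close>
  define \<delta> where "\<delta> = (1 - r\<^sup>2) * (1 - (cmod z0)\<^sup>2) / 4"
  have \<delta>: "0 < \<delta>" "\<delta> < 1"
  proof -
    have "0 < 1 - r\<^sup>2" "1 - r\<^sup>2 \<le> 1" "0 < 1 - (cmod z0)\<^sup>2" "1 - (cmod z0)\<^sup>2 \<le> 1"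
      using r z0' by (auto simp: power_less_one_iff)
    moreover from this have "(1 - r\<^sup>2) * (1 - (cmod z0)\<^sup>2) \<le> 1 * 1" by (intro mult_mono) auto
    ultimately show "0 < \<delta>" "\<delta> < 1" by (auto simp: \<delta>_def)
  qed
  have shrink: "(cmod (moebius_factor a z0))\<^sup>2 \<le> 1 - \<delta>" if a: "cmod a \<le> r" for a
  proof -
    have a1: "cmod a < 1" using a r by simp
    have "cmod (1 - cnj a * z0) \<le> 2"
    proof -
      have "cmod (cnj a * z0) \<le> 1 * 1" unfolding norm_mult using a1 z0' by (intro mult_mono) auto
      thus ?thesis using norm_triangle_ineq4[of 1 "cnj a * z0"] by simp
    qed
    hence d: "(cmod (1 - cnj a * z0))\<^sup>2 \<le> 4" using power_mono[of "cmod (1 - cnj a * z0)" 2 2] by simp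
    have d0: "0 < (cmod (1 - cnj a * z0))\<^sup>2" using moebius_denominator(2)[OF a1 z0'(2)] by simp
    have "(1 - r\<^sup>2) * (1 - (cmod z0)\<^sup>2) \<le> (1 - (cmod a)\<^sup>2) * (1 - (cmod z0)\<^sup>2)"
      using a z0' by (intro mult_right_mono) (auto intro: power_mono simp: power_le_one)
    hence "\<delta> \<le> (1 - (cmod a)\<^sup>2) * (1 - (cmod z0)\<^sup>2) / (cmod (1 - cnj a * z0))\<^sup>2"
      unfolding \<delta>_def using d d0 a1 z0' by (intro frac_le) (auto simp: power_le_one)
    thus ?thesis using moebius_factor_norm[OF a1 z0'(2)] by simp
  qed
  \<comment> \<open>The cofactor g is kept bounded by 1, so that |f z0|^2 \<le> (1 - \<delta>)^n and
    n stays bounded.\<close>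
  define P where "P n \<longleftrightarrow> (\<exists>a g. (\<forall>i<n. cmod (a i) \<le> r) \<and> g holomorphic_on unit_disk \<and> (\<forall>z. cmod z < 1 \<longrightarrow> cmod (g z) \<le> 1) \<and>
     (\<forall>z. cmod z < 1 \<longrightarrow> f z = (\<Prod>i<n. moebius_factor (a i) z) * g z))" for n :: nat
  have P0: "P 0" unfolding P_def using f by auto
  have bound: "(cmod (f z0))\<^sup>2 \<le> (1 - \<delta>) ^ n" if "P n" for n
  proof -
    obtain a g where a: "\<And>i. i < n \<Longrightarrow> cmod (a i) \<le> r" and g: "cmod (g z0) \<le> 1"
      and fz: "f z0 = (\<Prod>i<n. moebius_factor (a i) z0) * g z0"
      using \<open>P n\<close> z0' unfolding P_def by blast
    have "(cmod (f z0))\<^sup>2 = (\<Prod>i<n. (cmod (moebius_factor (a i) z0))\<^sup>2) * (cmod (g z0))\<^sup>2"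
      by (simp add: fz norm_mult power_mult_distrib prod_norm[symmetric] prod_power_distrib)
    also have "\<dots> \<le> (\<Prod>i<n. 1 - \<delta>) * 1"
      using a shrink g \<delta> by (intro mult_mono prod_mono) (auto simp: power_le_one intro!: prod_nonneg)
    finally show ?thesis by simp
  qed
  have "\<exists>N. \<forall>n. P n \<longrightarrow> n \<le> N"
  proof -
    have "(cmod (f z0))\<^sup>2 > 0" using fnz[OF z0'] by simp
    then obtain N where N: "(1 - \<delta>) ^ N < (cmod (f z0))\<^sup>2" using real_arch_pow_inv[of "(cmod (f z0))\<^sup>2" "1 - \<delta>"] \<delta> by auto
    have "n \<le> N" if "P n" for n
    proof (rule ccontr)
      assume "\<not> n \<le> N"
      hence "(1 - \<delta>) ^ n \<le> (1 - \<delta>) ^ N" using \<delta> by (intro power_decreasing) auto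
      thus False using bound[OF that] N by simp
    qed
    thus ?thesis by blast
  qed
  then obtain N where N: "\<And>n. P n \<Longrightarrow> n \<le> N" by blast
  \<comment> \<open>For the largest number of factors the cofactor has no zeros: a further zero
    would be a zero of f, hence of modulus at most r, and could be split off too.\<close>
  define n where "n = Greatest P"
  have Pn: "P n" unfolding n_def using P0 N by (rule GreatestI_nat)
  have Pmax: "m \<le> n" if "P m" for m unfolding n_def using that N by (rule Greatest_le_nat)
  obtain a g where a: "\<And>i. i < n \<Longrightarrow> cmod (a i) \<le> r" and g: "g holomorphic_on unit_disk"
    "\<And>z. cmod z < 1 \<Longrightarrow> cmod (g z) \<le> 1"
    and fg: "\<And>z. cmod z < 1 \<Longrightarrow> f z = (\<Prod>i<n. moebius_factor (a i) z) * g z"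
    using Pn unfolding P_def by blast
  have gnz: "g z \<noteq> 0" if z: "cmod z < 1" for z
  proof
    assume gz: "g z = 0"
    have "f z = 0" using fg[OF z] gz by simp
    hence zr: "cmod z \<le> r" using fnz[of z] z by force
    obtain h where h: "h holomorphic_on unit_disk" "\<And>w. cmod w < 1 \<Longrightarrow> cmod (h w) \<le> 1"
      "\<And>w. cmod w < 1 \<Longrightarrow> g w = moebius_factor z w * h w"
      using divide_moebius_factor[OF g z gz] by blast
    have "P (Suc n)" unfolding P_def
      by (rule exI[of _ "a(n := z)"], rule exI[of _ h]) (use a zr h fg in \<open>auto simp: less_Suc_eq mult_ac\<close>)
    thus False using Pmax[of "Suc n"] by simp
  qed
  \<comment> \<open>The product of the split-off factors has modulus at most 1, hence |f| \<le> |g|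
    and g inherits the boundary behaviour.\<close>
  have "unimodular_boundary g"
    unfolding unimodular_boundary_def
  proof (intro allI impI)
    fix e :: real assume "e > 0"
    then obtain s where s: "s < 1" "\<And>z. s < cmod z \<and> cmod z < 1 \<Longrightarrow> 1 - (cmod (f z))\<^sup>2 < e"
      using ub unfolding unimodular_boundary_def by blast
    have "1 - (cmod (g z))\<^sup>2 < e" if z: "s < cmod z \<and> cmod z < 1" for z
    proof -
      have "cmod (moebius_factor (a i) z) \<le> 1" if "i < n" for i
        using moebius_factor_less_1[of "a i" z] a[OF that] r(2) z by simp
      hence "cmod (\<Prod>i<n. moebius_factor (a i) z) \<le> (\<Prod>i<n. 1)"
        unfolding prod_norm[symmetric] by (intro prod_mono) auto
      hence "cmod (f z) \<le> 1 * cmod (g z)"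
        unfolding fg[OF conjunct2[OF z]] norm_mult by (intro mult_right_mono) auto
      hence "(cmod (f z))\<^sup>2 \<le> (cmod (g z))\<^sup>2" by (intro power_mono) auto
      thus ?thesis using s(2)[OF z] by linarith
    qed
    thus "\<exists>r<1. \<forall>z. r < cmod z \<and> cmod z < 1 \<longrightarrow> 1 - (cmod (g z))\<^sup>2 < e" using s(1) by blast
  qed
  then obtain c where c: "cmod c = 1" "\<And>z. cmod z < 1 \<Longrightarrow> g z = c"
    using zero_free_unimodular_boundary[OF g gnz] by blast
  show ?thesis unfolding finite_blaschke_product_def
  proof (intro exI conjI)
    show "cmod c = 1" by (rule c(1))
    show "\<forall>i<n. a i \<in> unit_disk" using a r by (auto intro: le_less_trans)
    show "\<forall>z\<in>unit_disk. f z = c * (\<Prod>i<n. (a i - z) / (1 - cnj (a i) * z))"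
      using fg c(2) by (simp add: moebius_factor_def mult.commute)
  qed
qed

section \<open>The defect form of a finite Blaschke product\<close>

context bergman_weight
begin

lemma defect_form_cong:
  assumes "bounded_multiplier u" "bounded_multiplier v" "h \<in> H" "\<And>z. cmod z < 1 \<Longrightarrow> u z = v z"
  shows "defect_form u h = defect_form v h"
  by (simp add: defect_form_def adj_cong[OF assms])

lemma moebius_factor_multiplier: "cmod a < 1 \<Longrightarrow> bounded_multiplier (moebius_factor a)"
  by (rule bounded_multiplierI[of _ 1]) (auto intro: moebius_factor_holomorphic less_imp_le moebius_factor_less_1)

text \<open>One constant serves the function and its derivative, as \<open>shift_form_adj_le\<close>
  asks for a common bound; 1 / (1 - |a|)^2 is the larger of the two natural ones.\<close>

lemma cauchy_factor:
  assumes a: "cmod a < 1"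
  shows "(\<lambda>z. 1 / (1 - cnj a * z)) holomorphic_on unit_disk"
    and "cmod z < 1 \<Longrightarrow> cmod (1 / (1 - cnj a * z)) \<le> 1 / (1 - cmod a)\<^sup>2"
    and "cmod z < 1 \<Longrightarrow> cmod (deriv (\<lambda>z. 1 / (1 - cnj a * z)) z) \<le> 1 / (1 - cmod a)\<^sup>2"
proof -
  show "(\<lambda>z. 1 / (1 - cnj a * z)) holomorphic_on unit_disk"
    using moebius_denominator(2)[OF a] by (intro holomorphic_intros) auto
  assume z: "cmod z < 1"
  note d = moebius_denominator[OF a z]
  have pos: "0 < 1 - cmod a" using a by simp
  have sq: "(1 - cmod a)\<^sup>2 \<le> (cmod (1 - cnj a * z))\<^sup>2" using d pos by (intro power_mono) auto
  have "(1 - cmod a)\<^sup>2 \<le> 1 - cmod a" using pos by (simp add: power2_eq_square mult_left_le)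
  hence "(1 - cmod a)\<^sup>2 \<le> cmod (1 - cnj a * z)" using d by simp
  thus "cmod (1 / (1 - cnj a * z)) \<le> 1 / (1 - cmod a)\<^sup>2"
    using pos by (simp add: norm_divide frac_le)
  have "((\<lambda>z. 1 / (1 - cnj a * z)) has_field_derivative cnj a / (1 - cnj a * z)\<^sup>2) (at z)"
    using d(2) by (auto intro!: derivative_eq_intros simp: power2_eq_square)
  hence "deriv (\<lambda>z. 1 / (1 - cnj a * z)) z = cnj a / (1 - cnj a * z)\<^sup>2" by (rule DERIV_imp_deriv)
  thus "cmod (deriv (\<lambda>z. 1 / (1 - cnj a * z)) z) \<le> 1 / (1 - cmod a)\<^sup>2"
    using a sq pos by (simp add: norm_divide norm_power frac_le)
qed

lemma shift_form_adj_cauchy_factor: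
  assumes a: "cmod a < 1"
  shows "\<exists>C\<ge>0. \<forall>h\<in>H. shift_form (adj (\<lambda>z. 1 / (1 - cnj a * z)) h) \<le> C * shift_form h"
proof -
  let ?M = "1 / (1 - cmod a)\<^sup>2"
  have "0 \<le> 3 * ?M\<^sup>2 + 2 * ?M\<^sup>2 / (\<alpha> + 1)\<^sup>2" by simp
  moreover have "\<forall>h\<in>H. shift_form (adj (\<lambda>z. 1 / (1 - cnj a * z)) h) \<le> (3 * ?M\<^sup>2 + 2 * ?M\<^sup>2 / (\<alpha> + 1)\<^sup>2) * shift_form h"
    by (intro ballI shift_form_adj_le cauchy_factor a)
  ultimately show ?thesis by blast
qed

lemma shift_form_adj_affine: "\<exists>C>0. \<forall>h\<in>H. shift_form (adj (\<lambda>z. a - c * z) h) \<le> C * shift_form h"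
proof -
  \<comment> \<open>The extra 1 keeps M positive even when a and c vanish, since the resulting
    constant is later divided by.\<close>
  define M where "M = cmod a + cmod c + 1"
  have hol: "(\<lambda>z. a - c * z) holomorphic_on unit_disk" by (intro holomorphic_intros)
  have bd: "cmod (a - c * z) \<le> M" if z: "cmod z < 1" for z
  proof -
    have "cmod (c * z) \<le> cmod c * 1" unfolding norm_mult using z by (intro mult_left_mono) auto
    thus ?thesis using norm_triangle_ineq4[of a "c * z"] by (simp add: M_def)
  qed
  have dbd: "cmod (deriv (\<lambda>z. a - c * z) z) \<le> M" for z
  proof -
    have "((\<lambda>z. a - c * z) has_field_derivative - c) (at z)" by (auto intro!: derivative_eq_intros)
    thus ?thesis by (simp add: DERIV_imp_deriv M_def)
  qed
  have "M > 0" by (simp add: M_def add_nonneg_pos)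
  hence "0 < 3 * M\<^sup>2 + 2 * M\<^sup>2 / (\<alpha> + 1)\<^sup>2" by (intro add_pos_nonneg) auto
  moreover have "\<forall>h\<in>H. shift_form (adj (\<lambda>z. a - c * z) h) \<le> (3 * M\<^sup>2 + 2 * M\<^sup>2 / (\<alpha> + 1)\<^sup>2) * shift_form h"
    by (intro ballI shift_form_adj_le hol bd dbd)
  ultimately show ?thesis by blast
qed

text \<open>The operator form of
  \<open>1 - b(z) cnj (b(w)) = (1 - |a|\<^sup>2) (1 - z cnj w) / ((1 - cnj a z) (1 - a cnj w))\<close>.\<close>

lemma defect_form_moebius_factor:
  assumes a: "cmod a < 1" and h: "h \<in> H"
  defines "x \<equiv> adj (\<lambda>z. 1 / (1 - cnj a * z)) h"
  shows "x \<in> H" "h = adj (\<lambda>z. 1 - cnj a * z) x" "adj (moebius_factor a) h = adj (\<lambda>z. a - 1 * z) x"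
    "defect_form (moebius_factor a) h = (1 - (cmod a)\<^sup>2) * shift_form x"
proof -
  let ?g = "\<lambda>z. 1 / (1 - cnj a * z)"
  have g: "bounded_multiplier ?g" using cauchy_factor(1,2)[OF a] by (rule bounded_multiplierI)
  show x: "x \<in> H" unfolding x_def by (rule adj_in_H[OF g h])
  have eq: "adj (\<lambda>z. ?g z * (1 - cnj a * z)) h = adj (\<lambda>z. 1) h"
    by (intro adj_cong bounded_multiplier_mult g bounded_multiplier_affine bounded_multiplier_const h)
      (use moebius_denominator(2)[OF a] in auto)
  have one: "adj (\<lambda>z. 1) h = h" using adj_const[OF h, of 1] by simp
  show hx: "h = adj (\<lambda>z. 1 - cnj a * z) x"
    unfolding x_def adj_mult[OF g bounded_multiplier_affine h, symmetric] eq one ..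
  have eqb: "adj (moebius_factor a) h = adj (\<lambda>z. ?g z * (a - 1 * z)) h"
    by (intro adj_cong bounded_multiplier_mult g bounded_multiplier_affine moebius_factor_multiplier a h)
      (simp add: moebius_factor_def)
  show bx: "adj (moebius_factor a) h = adj (\<lambda>z. a - 1 * z) x"
    unfolding x_def adj_mult[OF g bounded_multiplier_affine h, symmetric] by (rule eqb)
  define y where "y = adj (\<lambda>z. z) x"
  have y: "y \<in> H" unfolding y_def by (rule adj_in_H[OF bounded_multiplier_id x])
  \<comment> \<open>With y = T_z* x this reads h = x - a y, and below T_b* h = cnj a x - y. The
    cross terms of the two squared norms agree and cancel in the difference.\<close>
  have h': "h = (\<lambda>z. x z - a * y z)" using hx adj_affine[OF x, of 1 "cnj a"] by (simp add: y_def)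
  have b': "adj (moebius_factor a) h = (\<lambda>z. cnj a * x z - y z)" using bx adj_affine[OF x, of a 1] by (simp add: y_def)
  have "(nrm h)\<^sup>2 = (nrm x)\<^sup>2 + (cmod a)\<^sup>2 * (nrm y)\<^sup>2 - 2 * Re (cnj a * berg_inner \<alpha> x y)"
    using x y by (subst h') (simp add: nrm_sq_diff H_scale nrm_scale power_mult_distrib ip_simps)
  moreover have "(nrm (adj (moebius_factor a) h))\<^sup>2 = (cmod a)\<^sup>2 * (nrm x)\<^sup>2 + (nrm y)\<^sup>2 - 2 * Re (cnj a * berg_inner \<alpha> x y)"
    unfolding b' using x y by (simp add: nrm_sq_diff H_scale nrm_scale power_mult_distrib ip_simps)
  ultimately have "defect_form (moebius_factor a) h = (1 - (cmod a)\<^sup>2) * ((nrm x)\<^sup>2 - (nrm y)\<^sup>2)"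
    unfolding defect_form_def[of "moebius_factor a"] by (simp add: algebra_simps)
  thus "defect_form (moebius_factor a) h = (1 - (cmod a)\<^sup>2) * shift_form x" by (simp add: defect_form_def y_def)
qed

text \<open>h is recovered from x = T_g* h by the adjoint of 1 - cnj a z, which is bounded for
  \<open>shift_form\<close>; so \<open>shift_form h\<close> is at most a multiple of
  \<open>shift_form x\<close>.\<close>

lemma defect_form_moebius_factor_lower:
  assumes a: "cmod a < 1"
  shows "\<exists>c>0. \<forall>h\<in>H. c * shift_form h \<le> defect_form (moebius_factor a) h"
proof -
  obtain C where C: "C > 0" "\<And>h. h \<in> H \<Longrightarrow> shift_form (adj (\<lambda>z. 1 - cnj a * z) h) \<le> C * shift_form h"
    using shift_form_adj_affine[of 1 "cnj a"] by blast
  have a2: "0 < 1 - (cmod a)\<^sup>2" using a by (simp add: power_less_one_iff)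
  have "(1 - (cmod a)\<^sup>2) / C * shift_form h \<le> defect_form (moebius_factor a) h" if h: "h \<in> H" for h
  proof -
    note M = defect_form_moebius_factor[OF a h]
    have "shift_form h \<le> C * shift_form (adj (\<lambda>z. 1 / (1 - cnj a * z)) h)"
      by (subst M(2)) (rule C(2)[OF M(1)])
    hence "shift_form h / C \<le> shift_form (adj (\<lambda>z. 1 / (1 - cnj a * z)) h)" using C(1) by (simp add: divide_le_eq mult.commute)
    from mult_left_mono[OF this less_imp_le[OF a2]] show ?thesis using M(4) by simp
  qed
  moreover have "(1 - (cmod a)\<^sup>2) / C > 0" using a2 C(1) by simp
  ultimately show ?thesis by blast
qed

text \<open>The second inequality, boundedness of T_b* for the shift form, is what the induction
  over the factors needs beside the first.\<close>

lemma moebius_factor_upper: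
  assumes a: "cmod a < 1"
  shows "\<exists>C\<ge>0. \<forall>h\<in>H. defect_form (moebius_factor a) h \<le> C * shift_form h \<and> shift_form (adj (moebius_factor a) h) \<le> C * shift_form h"
proof -
  obtain C where C: "C \<ge> 0" "\<And>h. h \<in> H \<Longrightarrow> shift_form (adj (\<lambda>z. 1 / (1 - cnj a * z)) h) \<le> C * shift_form h"
    using shift_form_adj_cauchy_factor[OF a] by blast
  obtain K where K: "K > 0" "\<And>h. h \<in> H \<Longrightarrow> shift_form (adj (\<lambda>z. a - 1 * z) h) \<le> K * shift_form h"
    using shift_form_adj_affine[of a 1] by blast
  have a2: "0 \<le> 1 - (cmod a)\<^sup>2" "1 - (cmod a)\<^sup>2 \<le> 1" using a by (auto simp: power_le_one)
  have "defect_form (moebius_factor a) h \<le> (C + K * C) * shift_form h \<and> shift_form (adj (moebius_factor a) h) \<le> (C + K * C) * shift_form h" if h: "h \<in> H" for h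
  proof -
    note M = defect_form_moebius_factor[OF a h]
    let ?x = "adj (\<lambda>z. 1 / (1 - cnj a * z)) h"
    have n: "0 \<le> C * shift_form h" "0 \<le> K * C * shift_form h" using C(1) K(1) shift_form_nonneg[OF h] by auto
    have "(1 - (cmod a)\<^sup>2) * shift_form ?x \<le> 1 * shift_form ?x" using a2 shift_form_nonneg[OF M(1)] by (intro mult_right_mono) auto
    hence 1: "defect_form (moebius_factor a) h \<le> C * shift_form h" unfolding M(4) using C(2)[OF h] by simp
    have "shift_form (adj (\<lambda>z. a - 1 * z) ?x) \<le> K * shift_form ?x" by (rule K(2)[OF M(1)])
    also have "\<dots> \<le> K * (C * shift_form h)" using C(2)[OF h] K(1) by (intro mult_left_mono) auto
    finally have 2: "shift_form (adj (moebius_factor a) h) \<le> K * C * shift_form h" unfolding M(3) by simp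
    show ?thesis using 1 2 n by (simp add: distrib_right)
  qed
  moreover have "0 \<le> C + K * C" using C(1) K(1) by simp
  ultimately show ?thesis by blast
qed

definition blaschke :: "complex \<Rightarrow> (nat \<Rightarrow> complex) \<Rightarrow> nat \<Rightarrow> complex \<Rightarrow> complex" where
  "blaschke c a n z = c * (\<Prod>i<n. moebius_factor (a i) z)"

lemma blaschke_props:
  assumes "cmod c = 1" "\<And>i. i < n \<Longrightarrow> cmod (a i) < 1"
  shows "blaschke c a n holomorphic_on unit_disk" "\<forall>z\<in>unit_disk. cmod (blaschke c a n z) \<le> 1"
proof -
  show "blaschke c a n holomorphic_on unit_disk"
    unfolding blaschke_def using assms by (intro holomorphic_intros) auto
  have "cmod (blaschke c a n z) \<le> 1" if "cmod z < 1" for z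
  proof -
    have "cmod (blaschke c a n z) = (\<Prod>i<n. cmod (moebius_factor (a i) z))"
      by (simp add: blaschke_def norm_mult assms(1) prod_norm)
    also have "\<dots> \<le> (\<Prod>i<n. 1)"
      using moebius_factor_less_1[OF assms(2) that] by (intro prod_mono) (auto intro: less_imp_le)
    finally show ?thesis by simp
  qed
  thus "\<forall>z\<in>unit_disk. cmod (blaschke c a n z) \<le> 1" by simp
qed

lemma defect_form_blaschke_Suc:
  assumes "cmod c = 1" "\<And>i. i < Suc n \<Longrightarrow> cmod (a i) < 1" "h \<in> H"
  shows "defect_form (blaschke c a (Suc n)) h = defect_form (moebius_factor (a n)) h + defect_form (blaschke c a n) (adj (moebius_factor (a n)) h)"
proof -
  have 1: "blaschke c a (Suc n) = (\<lambda>z. moebius_factor (a n) z * blaschke c a n z)"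
    by (simp add: blaschke_def fun_eq_iff mult_ac)
  have "bounded_multiplier (blaschke c a n)"
    using assms by (intro contraction_multiplier blaschke_props) auto
  thus ?thesis unfolding 1 using assms by (intro defect_form_mult moebius_factor_multiplier) auto
qed

text \<open>When the last factor is split off, its own form costs K and the remaining product,
  evaluated at T_b* h, costs C K; hence K + C K. Without factors the form vanishes since |c| =
  1.\<close>

lemma defect_form_blaschke_upper:
  assumes "cmod c = 1" "\<And>i. i < n \<Longrightarrow> cmod (a i) < 1"
  shows "\<exists>C\<ge>0. \<forall>h\<in>H. defect_form (blaschke c a n) h \<le> C * shift_form h"
  using assms(2)
proof (induction n)
  case 0
  have "defect_form (blaschke c a 0) h = 0" if "h \<in> H" for h
  proof -
    have "blaschke c a 0 = (\<lambda>z. c)" by (simp add: blaschke_def fun_eq_iff)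
    thus ?thesis using that assms(1) by (simp add: defect_form_def adj_const nrm_scale)
  qed
  thus ?case by (intro exI[of _ 0]) auto
next
  case (Suc n)
  obtain C where C: "C \<ge> 0" "\<And>h. h \<in> H \<Longrightarrow> defect_form (blaschke c a n) h \<le> C * shift_form h" using Suc by auto
  have an: "cmod (a n) < 1" using Suc.prems by simp
  obtain K where K: "K \<ge> 0" "\<And>h. h \<in> H \<Longrightarrow> defect_form (moebius_factor (a n)) h \<le> K * shift_form h"
    "\<And>h. h \<in> H \<Longrightarrow> shift_form (adj (moebius_factor (a n)) h) \<le> K * shift_form h"
    using moebius_factor_upper[OF an] by blast
  have "defect_form (blaschke c a (Suc n)) h \<le> (K + C * K) * shift_form h" if h: "h \<in> H" for h
  proof -
    have "defect_form (blaschke c a n) (adj (moebius_factor (a n)) h) \<le> C * shift_form (adj (moebius_factor (a n)) h)"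
      by (intro C adj_in_H moebius_factor_multiplier an h)
    also have "\<dots> \<le> C * (K * shift_form h)" using K(3)[OF h] C(1) by (intro mult_left_mono) auto
    finally show ?thesis using K(2)[OF h] defect_form_blaschke_Suc[OF assms(1) Suc.prems h] by (simp add: algebra_simps)
  qed
  moreover have "0 \<le> K + C * K" using K(1) C(1) by simp
  ultimately show ?case by blast
qed

text \<open>The last factor supplies the bound, the other summand of the cocycle being nonnegative.
  For n = 0 the form is zero, so a factor must exist.\<close>

lemma defect_form_blaschke_lower:
  assumes "cmod c = 1" "\<And>i. i < n \<Longrightarrow> cmod (a i) < 1" "n > 0"
  shows "\<exists>k>0. \<forall>h\<in>H. k * shift_form h \<le> defect_form (blaschke c a n) h"
proof -
  obtain m where m: "n = Suc m" using assms(3) by (cases n) auto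
  have am: "cmod (a m) < 1" using assms(2) m by simp
  obtain k where k: "k > 0" "\<And>h. h \<in> H \<Longrightarrow> k * shift_form h \<le> defect_form (moebius_factor (a m)) h"
    using defect_form_moebius_factor_lower[OF am] by blast
  have "k * shift_form h \<le> defect_form (blaschke c a n) h" if h: "h \<in> H" for h
  proof -
    have "0 \<le> defect_form (blaschke c a m) (adj (moebius_factor (a m)) h)"
      using assms m by (intro defect_form_nonneg blaschke_props adj_in_H moebius_factor_multiplier am h) auto
    thus ?thesis using k(2)[OF h] defect_form_blaschke_Suc[OF assms(1) assms(2)[unfolded m] h] m by simp
  qed
  thus ?thesis using k(1) by blast
qed

section \<open>Spaces described by quadratic forms\<close>

text \<open>The direct part is duality. For the converse the form is tested on h with h_n = s_n f_n
  for n < N: pairing and form both equal the N-th partial sum A of the weighted series, so A^2 \<le>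
  C A bounds it uniformly in N.\<close>

lemma dirichlet_space_iff:
  assumes f: "f \<in> H"
  shows "f \<in> dirichlet_space \<longleftrightarrow> (\<exists>C. \<forall>h\<in>H. (cmod (berg_inner \<alpha> h f))\<^sup>2 \<le> C * shift_form h)"
proof
  assume "f \<in> dirichlet_space"
  hence "\<forall>h\<in>H. (cmod (berg_inner \<alpha> h f))\<^sup>2 \<le> dirichlet_sq f * shift_form h" using shift_form_pairing by (auto simp: mult.commute)
  thus "\<exists>C. \<forall>h\<in>H. (cmod (berg_inner \<alpha> h f))\<^sup>2 \<le> C * shift_form h" by blast
next
  assume "\<exists>C. \<forall>h\<in>H. (cmod (berg_inner \<alpha> h f))\<^sup>2 \<le> C * shift_form h"
  then obtain C where C: "\<And>h. h \<in> H \<Longrightarrow> (cmod (berg_inner \<alpha> h f))\<^sup>2 \<le> C * shift_form h" by blast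
  define s where "s n = (real n + \<alpha> + 1) / (\<alpha> + 1)" for n
  have s: "s n > 0" for n using \<alpha> by (simp add: s_def)
  define t where "t n = s n * (w n * (cmod (taylor_coeff f n))\<^sup>2)" for n
  have t0: "t n \<ge> 0" for n using s[of n] w_nonneg[of n] by (simp add: t_def)
  \<comment> \<open>C has no prescribed sign; if it is negative, A vanishes, which the maximum with
    0 accounts for.\<close>
  have bd: "(\<Sum>n<N. t n) \<le> max C 0" for N
  proof -
    let ?a = "\<lambda>n. if n < N then complex_of_real (s n) * taylor_coeff f n else 0"
    define A where "A = (\<Sum>n<N. t n)"
    have fin: "summable (\<lambda>n. w n * (cmod (?a n))\<^sup>2)" by (rule summable_finite[of "{..<N}"]) auto
    define h where "h = synth ?a"
    have h: "h \<in> H" unfolding h_def by (rule synth_in_H[OF fin])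
    have ch: "taylor_coeff h n = ?a n" for n unfolding h_def by (rule synth_coeff[OF fin])
    have "berg_inner \<alpha> h f = (\<Sum>n<N. complex_of_real (w n) * (taylor_coeff h n * cnj (taylor_coeff f n)))"
      unfolding ip_sum[OF h f] by (rule suminf_finite) (auto simp: ch)
    also have "\<dots> = (\<Sum>n<N. complex_of_real (t n))"
    proof (rule sum.cong)
      fix n assume "n \<in> {..<N}"
      thus "complex_of_real (w n) * (taylor_coeff h n * cnj (taylor_coeff f n)) = complex_of_real (t n)"
        unfolding ch t_def of_real_mult complex_norm_square by simp
    qed simp
    finally have i: "berg_inner \<alpha> h f = complex_of_real A" by (simp add: A_def)
    have "shift_form h = (\<Sum>n<N. (\<alpha> + 1) / (real n + \<alpha> + 1) * (w n * (cmod (taylor_coeff h n))\<^sup>2))"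
      unfolding shift_form_sum[OF h] by (rule suminf_finite) (auto simp: ch)
    also have "\<dots> = A" unfolding A_def
    proof (rule sum.cong)
      fix n assume n: "n \<in> {..<N}"
      have "(\<alpha> + 1) / (real n + \<alpha> + 1) * s n = 1" using s[of n] \<alpha> by (simp add: s_def)
      hence "(\<alpha> + 1) / (real n + \<alpha> + 1) * s n * t n = t n" by (simp only: mult_1_left)
      thus "(\<alpha> + 1) / (real n + \<alpha> + 1) * (w n * (cmod (taylor_coeff h n))\<^sup>2) = t n"
        using n s[of n] unfolding ch t_def by (simp add: norm_mult power_mult_distrib power2_eq_square mult_ac)
    qed simp
    finally have qh: "shift_form h = A" .
    have A0: "A \<ge> 0" unfolding A_def using t0 by (rule sum_nonneg)
    have "A * A \<le> C * A" using C[OF h] unfolding i qh by (simp add: power2_eq_square)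
    hence "A \<le> max C 0" using A0 by (cases "A = 0") (auto simp: mult_le_cancel_right)
    thus ?thesis by (simp add: A_def)
  qed
  have "summable t" by (rule bounded_imp_summable[of _ "max C 0"]) (use t0 bd[of "Suc _"] in \<open>auto simp: lessThan_Suc_atMost\<close>)
  hence "summable (\<lambda>n. (\<alpha> + 1) * t n)" by (rule summable_mult)
  hence "summable (\<lambda>n. real n * w n * (cmod (taylor_coeff f n))\<^sup>2)"
  proof (rule summable_comparison_test'[of _ 0])
    fix n
    have "real n * (w n * (cmod (taylor_coeff f n))\<^sup>2) \<le> (real n + \<alpha> + 1) * (w n * (cmod (taylor_coeff f n))\<^sup>2)"
      using \<alpha> w_nonneg[of n] by (intro mult_right_mono) auto
    also have "\<dots> = (\<alpha> + 1) * t n" using \<alpha> by (simp add: t_def s_def)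
    finally show "norm (real n * w n * (cmod (taylor_coeff f n))\<^sup>2) \<le> (\<alpha> + 1) * t n"
      using w_nonneg[of n] by (simp add: mult_ac)
  qed
  thus "f \<in> dirichlet_space" using f by (simp add: dirichlet_space_def)
qed

text \<open>The range criterion with |R h|^2 replaced by the defect form: comparing ranges becomes
  comparing forms.\<close>

lemma sub_bergman_iff:
  assumes u: "u holomorphic_on unit_disk" "\<forall>z\<in>unit_disk. cmod (u z) \<le> 1" and f: "f \<in> H"
  shows "f \<in> sub_bergman \<alpha> u \<longleftrightarrow> (\<exists>C. \<forall>h\<in>H. (cmod (berg_inner \<alpha> h f))\<^sup>2 \<le> C * defect_form u h)"
proof -
  let ?R = "defect_op \<alpha> u"
  note R = defect_op_prop[OF u]
  have Rin: "?R h \<in> H" if "h \<in> H" for h using R(1) that by (simp add: pos_def bop_def lin_in)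
  have "f \<in> sub_bergman \<alpha> u \<longleftrightarrow> (\<exists>C. \<forall>h\<in>H. cmod (berg_inner \<alpha> h f) \<le> C * nrm (?R h))"
    unfolding sub_bergman_def by (rule range_pos_iff[OF R(1) f])
  also have "\<dots> \<longleftrightarrow> (\<exists>C. \<forall>h\<in>H. (cmod (berg_inner \<alpha> h f))\<^sup>2 \<le> C * defect_form u h)"
  proof
    assume "\<exists>C. \<forall>h\<in>H. cmod (berg_inner \<alpha> h f) \<le> C * nrm (?R h)"
    then obtain C where C: "\<And>h. h \<in> H \<Longrightarrow> cmod (berg_inner \<alpha> h f) \<le> C * nrm (?R h)" by blast
    have "(cmod (berg_inner \<alpha> h f))\<^sup>2 \<le> C\<^sup>2 * defect_form u h" if h: "h \<in> H" for h
      using power_mono[OF C[OF h], of 2] R(2)[OF h] by (simp add: power_mult_distrib)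
    thus "\<exists>C. \<forall>h\<in>H. (cmod (berg_inner \<alpha> h f))\<^sup>2 \<le> C * defect_form u h" by blast
  next
    assume "\<exists>C. \<forall>h\<in>H. (cmod (berg_inner \<alpha> h f))\<^sup>2 \<le> C * defect_form u h"
    then obtain C where C: "\<And>h. h \<in> H \<Longrightarrow> (cmod (berg_inner \<alpha> h f))\<^sup>2 \<le> C * defect_form u h" by blast
    \<comment> \<open>Nonnegativity of the form allows |C| in place of C before taking
      roots.\<close>
    have "cmod (berg_inner \<alpha> h f) \<le> sqrt \<bar>C\<bar> * nrm (?R h)" if h: "h \<in> H" for h
    proof (rule power2_le_imp_le)
      have "C * defect_form u h \<le> \<bar>C\<bar> * defect_form u h" using defect_form_nonneg[OF u h] by (intro mult_right_mono) auto
      thus "(cmod (berg_inner \<alpha> h f))\<^sup>2 \<le> (sqrt \<bar>C\<bar> * nrm (?R h))\<^sup>2"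
        using C[OF h] R(2)[OF h] by (simp add: power_mult_distrib)
      show "0 \<le> sqrt \<bar>C\<bar> * nrm (?R h)" using nrm_nonneg[OF Rin[OF h]] by simp
    qed
    thus "\<exists>C. \<forall>h\<in>H. cmod (berg_inner \<alpha> h f) \<le> C * nrm (?R h)" by blast
  qed
  finally show ?thesis .
qed

lemma sub_bergman_subset_H:
  assumes u: "u holomorphic_on unit_disk" "\<forall>z\<in>unit_disk. cmod (u z) \<le> 1"
  shows "sub_bergman \<alpha> u \<subseteq> H"
  using defect_op_prop(1)[OF u] by (auto simp: sub_bergman_def pos_def bop_def lin_in)

lemma sub_bergman_subset_dirichlet_space:
  assumes u: "u holomorphic_on unit_disk" "\<forall>z\<in>unit_disk. cmod (u z) \<le> 1"
    and K: "\<And>h. h \<in> H \<Longrightarrow> defect_form u h \<le> K * shift_form h" "K \<ge> 0"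
  shows "sub_bergman \<alpha> u \<subseteq> dirichlet_space"
proof
  fix f assume f: "f \<in> sub_bergman \<alpha> u"
  hence fH: "f \<in> H" using sub_bergman_subset_H[OF u] by blast
  obtain C where C: "\<And>h. h \<in> H \<Longrightarrow> (cmod (berg_inner \<alpha> h f))\<^sup>2 \<le> C * defect_form u h"
    using f sub_bergman_iff[OF u fH] by blast
  have "(cmod (berg_inner \<alpha> h f))\<^sup>2 \<le> (\<bar>C\<bar> * K) * shift_form h" if h: "h \<in> H" for h
  proof -
    have "C * defect_form u h \<le> \<bar>C\<bar> * defect_form u h" using defect_form_nonneg[OF u h] by (intro mult_right_mono) auto
    also have "\<dots> \<le> \<bar>C\<bar> * (K * shift_form h)" using K(1)[OF h] by (intro mult_left_mono) auto
    finally show ?thesis using C[OF h] by simp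
  qed
  thus "f \<in> dirichlet_space" using dirichlet_space_iff[OF fH] by blast
qed

lemma dirichlet_space_subset_sub_bergman:
  assumes u: "u holomorphic_on unit_disk" "\<forall>z\<in>unit_disk. cmod (u z) \<le> 1"
    and k: "\<And>h. h \<in> H \<Longrightarrow> k * shift_form h \<le> defect_form u h" "k > 0"
  shows "dirichlet_space \<subseteq> sub_bergman \<alpha> u"
proof
  fix f assume f: "f \<in> dirichlet_space"
  note fH = dirichlet_space_H[OF f]
  obtain C where C: "\<And>h. h \<in> H \<Longrightarrow> (cmod (berg_inner \<alpha> h f))\<^sup>2 \<le> C * shift_form h" using f dirichlet_space_iff[OF fH] by blast
  have "(cmod (berg_inner \<alpha> h f))\<^sup>2 \<le> (\<bar>C\<bar> / k) * defect_form u h" if h: "h \<in> H" for h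
  proof -
    have "C * shift_form h \<le> \<bar>C\<bar> * shift_form h" using shift_form_nonneg[OF h] by (intro mult_right_mono) auto
    also have "\<dots> \<le> \<bar>C\<bar> * (defect_form u h / k)" using k(1)[OF h] k(2) by (intro mult_left_mono) (auto simp: field_simps)
    finally show ?thesis using C[OF h] by simp
  qed
  thus "f \<in> sub_bergman \<alpha> u" using sub_bergman_iff[OF u fH] by blast
qed

end

section \<open>Compactness and boundary behaviour\<close>

text \<open>\<open>Metric_space\<close> demands nonnegativity and symmetry for all functions, also
  outside the carrier, so this and the next fact are stated for arbitrary arguments.\<close>

lemma berg_norm_nonneg: "0 \<le> berg_norm \<alpha> f"
proof -
  have "f z * cnj (f z) = complex_of_real ((cmod (f z))\<^sup>2)" for z by (simp only: complex_norm_square)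
  hence "berg_inner \<alpha> f f = complex_of_real (LINT z|weighted_area \<alpha>. (cmod (f z))\<^sup>2)"
    unfolding berg_inner_def by (simp only: integral_complex_of_real)
  thus ?thesis unfolding berg_norm_def by (simp add: integral_nonneg_AE)
qed

lemma berg_norm_minus_commute: "berg_norm \<alpha> (\<lambda>z. f z - g z) = berg_norm \<alpha> (\<lambda>z. g z - f z)"
proof -
  have "(f z - g z) * cnj (f z - g z) = (g z - f z) * cnj (g z - f z)" for z by (simp add: algebra_simps)
  thus ?thesis unfolding berg_norm_def berg_inner_def by simp
qed

context bergman_weight
begin

sublocale Met: Metric_space "bergman \<alpha>" "\<lambda>f g. berg_norm \<alpha> (\<lambda>z. f z - g z)"
proof
  fix f g h assume fgh: "f \<in> H" "g \<in> H"
  show "(berg_norm \<alpha> (\<lambda>z. f z - g z) = 0) = (f = g)"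
    using nrm_eq_0[OF H_diff[OF fgh]] nrm_zero by (auto simp: nrm_eq fun_eq_iff)
  show "berg_norm \<alpha> (\<lambda>z. f z - h z) \<le> berg_norm \<alpha> (\<lambda>z. f z - g z) + berg_norm \<alpha> (\<lambda>z. g z - h z)" if "h \<in> H"
    using nrm_triangle_diff[OF fgh that] by (simp add: nrm_eq)
qed (rule berg_norm_nonneg berg_norm_minus_commute)+

lemma topology_eq: "berg_topology \<alpha> = Met.mtopology"
  by (simp add: berg_topology_def)

lemma mcomplete: "Met.mcomplete"
  unfolding Met.mcomplete_def
proof (intro allI impI)
  fix X assume "Met.MCauchy X"
  hence X: "X n \<in> H" and C: "\<And>e. e > 0 \<Longrightarrow> \<exists>N. \<forall>m n. N \<le> m \<longrightarrow> N \<le> n \<longrightarrow> nrm (\<lambda>z. X m z - X n z) < e" for n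
    by (auto simp: Met.MCauchy_def nrm_eq)
  have "\<exists>l\<in>H. (\<lambda>n. nrm (\<lambda>z. X n z - l z)) \<longlonglongrightarrow> 0" by (rule complete_nrm[OF X]) (use C in blast)
  then obtain l where l: "l \<in> H" "(\<lambda>n. nrm (\<lambda>z. X n z - l z)) \<longlonglongrightarrow> 0" by blast
  have "limitin Met.mtopology X l sequentially"
    unfolding Met.limit_metric_sequentially
    using l X LIMSEQ_D[OF l(2)] nrm_nonneg[OF H_diff[OF X l(1)]] by (simp add: nrm_eq)
  thus "\<exists>x. limitin Met.mtopology X x sequentially" by blast
qed

lemma coeff_bound:
  assumes "f \<in> H" shows "w n * (cmod (taylor_coeff f n))\<^sup>2 \<le> (nrm f)\<^sup>2"
proof -
  have "(\<Sum>k\<in>{n}. w k * (cmod (taylor_coeff f k))\<^sup>2) \<le> (\<Sum>k. w k * (cmod (taylor_coeff f k))\<^sup>2)"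
    by (rule sum_le_suminf[OF H_sum[OF assms]]) (auto simp: w_nonneg)
  thus ?thesis by (simp add: nrm_sq_sum[OF assms])
qed

text \<open>The diagonal weights decrease to 0: the tail is small uniformly on bounded sets, and the
  head depends on finitely many coefficients. This is the source of compactness.\<close>

lemma shift_form_le_head_tail:
  assumes f: "f \<in> H"
  shows "shift_form f \<le> (\<Sum>n<N. w n * (cmod (taylor_coeff f n))\<^sup>2) + (\<alpha> + 1) / (real N + \<alpha> + 1) * (nrm f)\<^sup>2"
proof -
  let ?t = "\<lambda>n. w n * (cmod (taylor_coeff f n))\<^sup>2"
  let ?r = "\<lambda>n. (\<alpha> + 1) / (real n + \<alpha> + 1)"
  have t0: "?t n \<ge> 0" for n by (simp add: w_nonneg)
  have r: "0 \<le> ?r n" "?r n \<le> 1" for n using \<alpha> by auto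
  have fin: "summable (\<lambda>n. if n < N then ?t n else 0)" by (rule summable_finite[of "{..<N}"]) auto
  have "shift_form f \<le> (\<Sum>n. (if n < N then ?t n else 0) + ?r N * ?t n)"
    unfolding shift_form_sum[OF f]
  proof (rule suminf_le)
    show "summable (\<lambda>n. (if n < N then ?t n else 0) + ?r N * ?t n)"
      by (intro summable_add fin summable_mult H_sum f)
    fix n
    show "?r n * ?t n \<le> (if n < N then ?t n else 0) + ?r N * ?t n"
    proof (cases "n < N")
      case True
      have "?r n * ?t n \<le> 1 * ?t n" by (intro mult_right_mono r t0)
      moreover have "0 \<le> ?r N * ?t n" by (intro mult_nonneg_nonneg r t0)
      ultimately show ?thesis using True by simp
    next
      case False
      hence "?r n \<le> ?r N" using \<alpha> by (intro divide_left_mono) auto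
      hence "?r n * ?t n \<le> ?r N * ?t n" by (intro mult_right_mono t0)
      thus ?thesis using False by simp
    qed
  qed (rule shift_form_summable[OF f])
  also have "\<dots> = (\<Sum>n. if n < N then ?t n else 0) + (\<Sum>n. ?r N * ?t n)"
    by (rule suminf_add[symmetric]) (intro fin summable_mult H_sum f)+
  also have "(\<Sum>n. if n < N then ?t n else 0) = (\<Sum>n<N. ?t n)"
    by (subst suminf_finite[of "{..<N}"]) auto
  also have "(\<Sum>n. ?r N * ?t n) = ?r N * (nrm f)\<^sup>2"
    unfolding nrm_sq_sum[OF f] by (rule suminf_mult[OF H_sum[OF f]])
  finally show ?thesis .
qed

text \<open>Total boundedness by a diagonal argument: along a subsequence all coefficients converge,
  which makes the head of the shift form of differences small, and the tail is small uniformly.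
  Completeness turns this into compact closure.\<close>

lemma compact_of_q_bound:
  assumes L: "bop R" and bd: "\<And>f. f \<in> H \<Longrightarrow> (nrm (R f))\<^sup>2 \<le> C * shift_form f" and C: "C \<ge> 0"
  shows "compact_op \<alpha> R"
proof -
  let ?B = "{f \<in> H. berg_norm \<alpha> f \<le> 1}"
  note lin = bop_lin[OF L]
  have Rin: "R f \<in> H" if "f \<in> H" for f by (rule lin_in[OF lin that])
  have "Met.mtotally_bounded (R ` ?B)"
    unfolding Met.mtotally_bounded_sequentially
  proof (intro conjI allI impI)
    show "R ` ?B \<subseteq> H" using Rin by auto
    fix \<sigma> :: "nat \<Rightarrow> complex \<Rightarrow> complex" assume "range \<sigma> \<subseteq> R ` ?B"
    hence "\<forall>n. \<exists>f. f \<in> ?B \<and> \<sigma> n = R f" by blast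
    then obtain f where f: "\<And>n. f n \<in> H" "\<And>n. nrm (f n) \<le> 1" and \<sigma>: "\<And>n. \<sigma> n = R (f n)"
      by (metis (mono_tags, lifting) mem_Collect_eq nrm_eq)
    \<comment> \<open>Scaling by sqrt(w_k) makes all coefficients at most 1 in modulus, as the
      selection of a subsequence asks for a uniform bound.\<close>
    define g where "g n k = complex_of_real (sqrt (w k)) * taylor_coeff (f n) k" for n k
    have g: "(cmod (g n k))\<^sup>2 = w k * (cmod (taylor_coeff (f n) k))\<^sup>2" for n k
      by (simp add: g_def norm_mult power_mult_distrib w_nonneg)
    have g1: "norm (g n k) \<le> 1" for n k
    proof (rule power2_le_imp_le)
      have "(nrm (f n))\<^sup>2 \<le> 1" using f nrm_nonneg by (intro power_le_one) auto
      thus "(norm (g n k))\<^sup>2 \<le> 1\<^sup>2" unfolding g using coeff_bound[OF f(1), of k n] by simp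
    qed simp
    obtain r where r: "strict_mono (r::nat\<Rightarrow>nat)" and "\<And>k. \<exists>l. (\<lambda>n. g (r n) k) \<longlonglongrightarrow> l"
      by (rule function_convergent_subsequence[of "UNIV :: nat set" g 1]) (use g1 in auto)
    then obtain l where l: "\<And>k. (\<lambda>n. g (r n) k) \<longlonglongrightarrow> l k" by metis
    have "Met.MCauchy (\<sigma> \<circ> r)"
      unfolding Met.MCauchy_def
    proof (intro conjI allI impI)
      show "range (\<sigma> \<circ> r) \<subseteq> H" using Rin f \<sigma> by auto
      fix e :: real assume e: "e > 0"
      \<comment> \<open>Differences of vectors in the unit ball have squared norm at most 4, so the
        tail contributes at most 4 C (\<alpha> + 1) / (N + \<alpha> + 1), which this N brings down
        to e^2 / 2.\<close>
      obtain N :: nat where N: "8 * C * (\<alpha> + 1) / e\<^sup>2 < real N" using reals_Archimedean2 by blast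
      have tail: "C * ((\<alpha> + 1) / (real N + \<alpha> + 1) * 4) \<le> e\<^sup>2 / 2"
      proof -
        have pos: "real N + \<alpha> + 1 > 0" using \<alpha> by simp
        have "8 * C * (\<alpha> + 1) < real N * e\<^sup>2" using N e by (simp add: divide_less_eq)
        also have "\<dots> \<le> (real N + \<alpha> + 1) * e\<^sup>2" using \<alpha> by (intro mult_right_mono) auto
        finally show ?thesis using pos by (simp add: field_simps)
      qed
      define T where "T i j = (\<Sum>k<N. (cmod (g (r i) k - g (r j) k))\<^sup>2)" for i j
      have hd: "\<exists>M. \<forall>i\<ge>M. \<forall>j\<ge>M. C * T i j < e\<^sup>2 / 2"
      proof -
        \<comment> \<open>C times N terms of size \<delta> must stay below e^2 / 2; the summands 1
          avoid division by zero and make the inequality strict.\<close>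
        define \<delta> where "\<delta> = e\<^sup>2 / (2 * (C + 1) * (real N + 1))"
        have \<delta>: "\<delta> > 0" using e C by (simp add: \<delta>_def)
        have "\<exists>M. \<forall>i\<ge>M. \<forall>j\<ge>M. norm (g (r i) k - g (r j) k) < sqrt \<delta>" for k
          using CauchyD[OF LIMSEQ_imp_Cauchy[OF l[of k]], of "sqrt \<delta>"] \<delta> by auto
        then obtain M where M: "\<And>k i j. i \<ge> M k \<Longrightarrow> j \<ge> M k \<Longrightarrow> norm (g (r i) k - g (r j) k) < sqrt \<delta>" by metis
        \<comment> \<open>The sum of finitely many thresholds bounds each of them, also for N =
          0.\<close>
        define K where "K = (\<Sum>k<N. M k)"
        have MK: "M k \<le> K" if "k < N" for k unfolding K_def using that by (intro member_le_sum) auto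
        have "C * T i j < e\<^sup>2 / 2" if "i \<ge> K" "j \<ge> K" for i j
        proof -
          have "T i j \<le> (\<Sum>k<N. \<delta>)" unfolding T_def
          proof (rule sum_mono)
            fix k assume k: "k \<in> {..<N}"
            have "norm (g (r i) k - g (r j) k) < sqrt \<delta>" using MK[of k] k that by (intro M) auto
            hence "(norm (g (r i) k - g (r j) k))\<^sup>2 \<le> (sqrt \<delta>)\<^sup>2" by (intro power_mono) auto
            thus "(cmod (g (r i) k - g (r j) k))\<^sup>2 \<le> \<delta>" using \<delta> by simp
          qed
          hence "C * T i j \<le> C * (real N * \<delta>)" using C by (intro mult_left_mono) auto
          also have "\<dots> < (C + 1) * ((real N + 1) * \<delta>)"
          proof -
            have "(C + 1) * ((real N + 1) * \<delta>) = C * (real N * \<delta>) + (C + real N + 1) * \<delta>" by (simp add: algebra_simps)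
            moreover have "(C + real N + 1) * \<delta> > 0" using C \<delta> by (intro mult_pos_pos) auto
            ultimately show ?thesis by linarith
          qed
          also have "\<dots> = e\<^sup>2 / 2"
          proof -
            have "C + 1 \<noteq> 0" "real N + 1 \<noteq> 0" using C by auto
            thus ?thesis unfolding \<delta>_def by (simp add: divide_simps)
          qed
          finally show ?thesis .
        qed
        thus ?thesis by blast
      qed
      then obtain M where M: "\<And>i j. i \<ge> M \<Longrightarrow> j \<ge> M \<Longrightarrow> C * T i j < e\<^sup>2 / 2" by blast
      have "nrm (\<lambda>z. \<sigma> (r i) z - \<sigma> (r j) z) < e" if ij: "i \<ge> M" "j \<ge> M" for i j
      proof -
        let ?d = "\<lambda>z. f (r i) z - f (r j) z"
        have d: "?d \<in> H" by (intro H_diff f)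
        have "nrm ?d \<le> 2" using nrm_triangle_minus[OF f(1) f(1), of "r i" "r j"] f(2)[of "r i"] f(2)[of "r j"] by simp
        hence d4: "(nrm ?d)\<^sup>2 \<le> 4" using power_mono[of "nrm ?d" 2 2] nrm_nonneg[OF d] by simp
        have "w k * (cmod (taylor_coeff ?d k))\<^sup>2 = (cmod (g (r i) k - g (r j) k))\<^sup>2" for k
          unfolding taylor_coeff_diff[OF H_hol[OF f(1)] H_hol[OF f(1)]] g_def right_diff_distrib[symmetric]
          by (simp add: norm_mult power_mult_distrib w_nonneg)
        hence "shift_form ?d \<le> T i j + (\<alpha> + 1) / (real N + \<alpha> + 1) * (nrm ?d)\<^sup>2"
          using shift_form_le_head_tail[OF d, of N] by (simp add: T_def)
        also have "\<dots> \<le> T i j + (\<alpha> + 1) / (real N + \<alpha> + 1) * 4"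
          using d4 \<alpha> by (intro add_left_mono mult_left_mono) auto
        finally have "C * shift_form ?d \<le> C * (T i j + (\<alpha> + 1) / (real N + \<alpha> + 1) * 4)" by (rule mult_left_mono[OF _ C])
        also have "\<dots> < e\<^sup>2" unfolding distrib_left using M[OF ij] tail by linarith
        finally have "(nrm (R ?d))\<^sup>2 < e\<^sup>2" using bd[OF d] by simp
        hence "nrm (R ?d) < e" by (rule power2_less_imp_less) (use e in simp)
        thus ?thesis unfolding \<sigma> using lin_diff[OF lin f(1) f(1)] by simp
      qed
      thus "\<exists>N. \<forall>n n'. N \<le> n \<longrightarrow> N \<le> n' \<longrightarrow> berg_norm \<alpha> (\<lambda>z. (\<sigma> \<circ> r) n z - (\<sigma> \<circ> r) n' z) < e"
        unfolding nrm_eq by auto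
    qed
    thus "\<exists>r. strict_mono r \<and> Met.MCauchy (\<sigma> \<circ> r)" using r by blast
  qed
  hence "compactin Met.mtopology (Met.mtopology closure_of (R ` ?B))"
    using Met.mtotally_bounded_eq_compact_closure_of[OF mcomplete] by blast
  thus ?thesis using L unfolding compact_op_def topology_eq bop_eq by blast
qed

section \<open>Normalised kernels near the circle\<close>

lemma not_unimodular_boundary_sequence:
  assumes "\<not> unimodular_boundary u"
  shows "\<exists>e>0. \<exists>\<zeta>::nat \<Rightarrow> complex. \<forall>n. cmod (\<zeta> n) < 1 \<and> 1 - 1 / (real n + 1) < cmod (\<zeta> n) \<and> e \<le> 1 - (cmod (u (\<zeta> n)))\<^sup>2"
proof -
  have "\<exists>e>0. \<forall>r<1. \<exists>z. r < cmod z \<and> cmod z < 1 \<and> e \<le> 1 - (cmod (u z))\<^sup>2"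
    using assms unfolding unimodular_boundary_def by (meson not_less)
  then obtain e where e: "e > 0" "\<forall>r<1. \<exists>z. r < cmod z \<and> cmod z < 1 \<and> e \<le> 1 - (cmod (u z))\<^sup>2" by blast
  have "\<forall>n::nat. \<exists>z. cmod z < 1 \<and> 1 - 1 / (real n + 1) < cmod z \<and> e \<le> 1 - (cmod (u z))\<^sup>2"
  proof
    fix n :: nat
    have "1 - 1 / (real n + 1) < 1" by simp
    thus "\<exists>z. cmod z < 1 \<and> 1 - 1 / (real n + 1) < cmod z \<and> e \<le> 1 - (cmod (u z))\<^sup>2" using e(2) by blast
  qed
  from choice[OF this] e(1) show ?thesis by blast
qed

lemma nrm_kernel_pos: "cmod \<zeta> < 1 \<Longrightarrow> 0 < nrm (berg_kernel \<zeta>)"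
proof -
  assume z: "cmod \<zeta> < 1"
  have "0 < 1 / (1 - (cmod \<zeta>)\<^sup>2)" using z by (simp add: power_less_one_iff)
  hence "0 < (nrm (berg_kernel \<zeta>))\<^sup>2" by (rule less_le_trans) (rule nrm_kernel_ge[OF z])
  thus ?thesis using nrm_nonneg[OF berg_kernel_in_H[OF z]] by (cases "nrm (berg_kernel \<zeta>) = 0") (auto simp: less_le)
qed

definition nkernel :: "complex \<Rightarrow> complex \<Rightarrow> complex" where
  "nkernel \<zeta> = (\<lambda>z. complex_of_real (1 / nrm (berg_kernel \<zeta>)) * berg_kernel \<zeta> z)"

lemma nkernel_props:
  assumes z: "cmod \<zeta> < 1"
  shows "nkernel \<zeta> \<in> H" "nrm (nkernel \<zeta>) = 1"
    "f \<in> H \<Longrightarrow> berg_inner \<alpha> f (nkernel \<zeta>) = f \<zeta> / nrm (berg_kernel \<zeta>)"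
    "bounded_multiplier u \<Longrightarrow> defect_form u (nkernel \<zeta>) = 1 - (cmod (u \<zeta>))\<^sup>2"
proof -
  note k = berg_kernel_in_H[OF z] and n = nrm_kernel_pos[OF z]
  show N: "nkernel \<zeta> \<in> H" unfolding nkernel_def by (rule H_scale[OF k])
  show N1: "nrm (nkernel \<zeta>) = 1" unfolding nkernel_def nrm_scale[OF k] using n by (simp add: norm_divide)
  show "berg_inner \<alpha> f (nkernel \<zeta>) = f \<zeta> / nrm (berg_kernel \<zeta>)" if "f \<in> H"
    unfolding nkernel_def ip_scale_right[OF that k] ip_kernel[OF z that] by simp
  assume u: "bounded_multiplier u"
  have "adj u (nkernel \<zeta>) = (\<lambda>z. cnj (u \<zeta>) * nkernel \<zeta> z)"
    unfolding nkernel_def lin_scale[OF bop_lin[OF conjunct1[OF adj_prop[OF u]]] k] adj_kernel[OF z u]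
    by (simp only: mult.left_commute)
  thus "defect_form u (nkernel \<zeta>) = 1 - (cmod (u \<zeta>))\<^sup>2"
    by (simp add: defect_form_def N1 nrm_scale[OF N] power_mult_distrib)
qed

lemma boundary_sequence_sq:
  assumes "\<And>n. cmod (\<zeta> n) < 1" "\<And>n. 1 - 1 / (real n + 1) < cmod (\<zeta> n)"
  shows "1 - (cmod (\<zeta> n))\<^sup>2 \<le> 2 / (real n + 1)"
proof -
  have "1 - (cmod (\<zeta> n))\<^sup>2 = (1 - cmod (\<zeta> n)) * (1 + cmod (\<zeta> n))" by (simp add: power2_eq_square algebra_simps)
  also have "\<dots> \<le> (1 / (real n + 1)) * 2" using assms[of n] by (intro mult_mono) (auto simp: less_imp_le algebra_simps)
  finally show ?thesis by simp
qed

text \<open>The pairing is f(\<zeta>) divided by the kernel norm. A tail T of f contributes at most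
  |T|, which is small, and the remaining polynomial is bounded while the kernel norm tends to
  infinity.\<close>

lemma nkernel_weakly_null:
  assumes z: "\<And>n. cmod (\<zeta> n) < 1" "\<And>n. 1 - 1 / (real n + 1) < cmod (\<zeta> n)" and f: "f \<in> H"
  shows "(\<lambda>n. berg_inner \<alpha> f (nkernel (\<zeta> n))) \<longlonglongrightarrow> 0"
proof (rule LIMSEQ_I)
  fix e :: real assume e: "e > 0"
  let ?t = "\<lambda>n. w n * (cmod (taylor_coeff f n))\<^sup>2"
  obtain N where N: "norm (\<Sum>n. ?t (n + N)) < (e / 2)\<^sup>2"
    using suminf_exist_split[OF _ H_sum[OF f], of "(e / 2)\<^sup>2"] e by auto
  let ?a = "\<lambda>n. if n < N then 0 else taylor_coeff f n"
  have sa: "summable (\<lambda>n. w n * (cmod (?a n))\<^sup>2)"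
    by (rule summable_comparison_test'[OF H_sum[OF f], of 0]) (auto simp: w_nonneg)
  define T where "T = synth ?a"
  have T: "T \<in> H" unfolding T_def by (rule synth_in_H[OF sa])
  have "(nrm T)\<^sup>2 = (\<Sum>n. w n * (cmod (?a n))\<^sup>2)" unfolding nrm_sq_sum[OF T] by (simp only: T_def synth_coeff[OF sa])
  also have "\<dots> = (\<Sum>n. w (n + N) * (cmod (?a (n + N)))\<^sup>2)"
    by (subst suminf_split_initial_segment[OF sa, of N]) simp
  also have "\<dots> < (e / 2)\<^sup>2" using N by simp
  finally have nT: "nrm T < e / 2" by (rule power2_less_imp_less) (use e in simp)
  define M where "M = (\<Sum>n<N. cmod (taylor_coeff f n))"
  have fz: "cmod (f \<zeta>) \<le> M + cmod (T \<zeta>)" if \<zeta>: "cmod \<zeta> < 1" for \<zeta>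
  proof -
    have "(\<lambda>n. ?a n * \<zeta> ^ n + (if n < N then taylor_coeff f n * \<zeta> ^ n else 0)) sums (T \<zeta> + (\<Sum>n<N. taylor_coeff f n * \<zeta> ^ n))"
      using sums_If_finite_set[of "{..<N}" "\<lambda>n. taylor_coeff f n * \<zeta> ^ n"]
      by (intro sums_add) (auto simp: T_def intro!: synth_sums sa \<zeta>)
    moreover have "(\<lambda>n. ?a n * \<zeta> ^ n + (if n < N then taylor_coeff f n * \<zeta> ^ n else 0)) = (\<lambda>n. taylor_coeff f n * \<zeta> ^ n)" by auto
    ultimately have "f \<zeta> = T \<zeta> + (\<Sum>n<N. taylor_coeff f n * \<zeta> ^ n)"
      using taylor_sums[OF H_hol[OF f] \<zeta>] by (metis sums_unique2)
    moreover have "cmod (\<Sum>n<N. taylor_coeff f n * \<zeta> ^ n) \<le> M" unfolding M_def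
      using \<zeta> by (intro sum_norm_le) (simp add: norm_mult norm_power mult_left_le power_le_one)
    ultimately show ?thesis using norm_triangle_ineq[of "T \<zeta>" "\<Sum>n<N. taylor_coeff f n * \<zeta> ^ n"] by simp
  qed
  have M0: "M \<ge> 0" unfolding M_def by (simp add: sum_nonneg)
  \<comment> \<open>This makes the kernel norm at least 2 M / e, since its square is at least 1 / (1
    - |\<zeta>|^2) \<ge> (n + 1) / 2.\<close>
  obtain n0 :: nat where n0: "2 * (2 * M / e)\<^sup>2 < real n0" using reals_Archimedean2 by blast
  have "norm (berg_inner \<alpha> f (nkernel (\<zeta> n)) - 0) < e" if n: "n \<ge> n0" for n
  proof -
    let ?k = "nrm (berg_kernel (\<zeta> n))"
    have k: "?k > 0" by (rule nrm_kernel_pos[OF z(1)])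
    have d: "0 < 1 - (cmod (\<zeta> n))\<^sup>2" using z(1) by (simp add: power_less_one_iff)
    have "(2 * M / e)\<^sup>2 \<le> (real n + 1) / 2" using n0 n by simp
    also have "\<dots> \<le> 1 / (1 - (cmod (\<zeta> n))\<^sup>2)"
      using boundary_sequence_sq[of \<zeta>, OF z] d by (simp add: field_simps)
    also have "\<dots> \<le> ?k\<^sup>2" by (rule nrm_kernel_ge[OF z(1)])
    finally have "2 * M / e \<le> ?k" by (rule power2_le_imp_le) (use k in simp)
    hence Mk: "M \<le> e / 2 * ?k" using e by (simp add: field_simps)
    have "cmod (T (\<zeta> n)) \<le> nrm T * ?k"
      using cauchy_schwarz[OF T berg_kernel_in_H[OF z(1)]] ip_kernel[OF z(1) T] by simp
    also have "\<dots> < e / 2 * ?k" using nT k by (intro mult_strict_right_mono)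
    finally have "cmod (f (\<zeta> n)) < e * ?k" using fz[OF z(1), of n] Mk by simp
    thus ?thesis unfolding nkernel_props(3)[OF z(1) f] using k by (simp add: norm_divide divide_less_eq)
  qed
  thus "\<exists>no. \<forall>n\<ge>no. norm (berg_inner \<alpha> f (nkernel (\<zeta> n)) - 0) < e" by blast
qed

text \<open>A compact R sends the weakly null unit vectors \<open>nkernel\<close> to a sequence with
  a norm null subsequence, but the squared norms 1 - |u(\<zeta>)|^2 of the images stay at least
  e.\<close>

lemma compact_imp_unimodular_boundary:
  assumes u: "u holomorphic_on unit_disk" "\<forall>z\<in>unit_disk. cmod (u z) \<le> 1"
    and K: "compact_op \<alpha> (defect_op \<alpha> u)"
  shows "unimodular_boundary u"
proof (rule ccontr)
  assume "\<not> unimodular_boundary u"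
  then obtain e \<zeta> where e: "e > 0" and z: "\<And>n::nat. cmod (\<zeta> n) < 1" "\<And>n. 1 - 1 / (real n + 1) < cmod (\<zeta> n)"
    and ue: "\<And>n. e \<le> 1 - (cmod (u (\<zeta> n)))\<^sup>2" using not_unimodular_boundary_sequence by blast
  note R = defect_op_prop[OF u] and b = contraction_multiplier[OF u]
  let ?R = "defect_op \<alpha> u"
  let ?S = "?R ` {f \<in> H. berg_norm \<alpha> f \<le> 1}"
  have Rin: "?R f \<in> H" if "f \<in> H" for f using R(1) that by (simp add: pos_def bop_def lin_in)
  have nk: "nkernel (\<zeta> n) \<in> H" for n by (rule nkernel_props(1)[OF z(1)])
  have "range (\<lambda>n. ?R (nkernel (\<zeta> n))) \<subseteq> ?S"
    using nk nkernel_props(2)[OF z(1)] by (auto simp: nrm_eq[symmetric])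
  also have "?S \<subseteq> Met.mtopology closure_of ?S" by (rule closure_of_subset) (use Rin in auto)
  finally obtain l r where lr: "strict_mono r" "limitin Met.mtopology ((\<lambda>n. ?R (nkernel (\<zeta> n))) \<circ> r) l sequentially"
    using K unfolding compact_op_def topology_eq Met.compactin_sequentially by blast
  define Y where "Y n = ?R (nkernel (\<zeta> (r n)))" for n
  have Y: "Y n \<in> H" for n unfolding Y_def by (intro Rin nk)
  have l: "l \<in> H" and lim: "\<And>\<epsilon>. \<epsilon> > 0 \<Longrightarrow> \<exists>N. \<forall>n\<ge>N. nrm (\<lambda>z. Y n z - l z) < \<epsilon>"
    using lr(2) unfolding Met.limit_metric_sequentially Y_def nrm_eq comp_def by blast+
  have lim0: "(\<lambda>n. nrm (\<lambda>z. Y n z - l z)) \<longlonglongrightarrow> 0"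
    by (rule LIMSEQ_I) (use lim nrm_nonneg[OF H_diff[OF Y l]] in simp)
  \<comment> \<open>By self-adjointness <l, Y n> is the pairing of R l with a normalised kernel, so
    it tends to 0. Since Y n tends to l in norm, this forces |l|^2 = 0.\<close>
  have "(\<lambda>n. berg_inner \<alpha> (?R l) (nkernel (\<zeta> n))) \<longlonglongrightarrow> 0" by (rule nkernel_weakly_null[OF z Rin[OF l]])
  hence "(\<lambda>n. berg_inner \<alpha> l (Y n)) \<longlonglongrightarrow> 0"
    using LIMSEQ_subseq_LIMSEQ[OF _ lr(1)] pos_selfadjoint[OF R(1) l nk] by (force simp: Y_def comp_def)
  moreover have "(\<lambda>n. berg_inner \<alpha> l (\<lambda>z. Y n z - l z)) \<longlonglongrightarrow> 0"
  proof (rule Lim_null_comparison)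
    show "(\<lambda>n. nrm l * nrm (\<lambda>z. Y n z - l z)) \<longlonglongrightarrow> 0" using tendsto_mult_right_zero[OF lim0] .
    show "\<forall>\<^sub>F n in sequentially. norm (berg_inner \<alpha> l (\<lambda>z. Y n z - l z)) \<le> nrm l * nrm (\<lambda>z. Y n z - l z)"
      by (intro always_eventually allI cauchy_schwarz l H_diff Y)
  qed
  ultimately have "(\<lambda>n. berg_inner \<alpha> l (Y n) - berg_inner \<alpha> l (\<lambda>z. Y n z - l z)) \<longlonglongrightarrow> 0 - 0" by (rule tendsto_diff)
  hence "(\<lambda>n::nat. berg_inner \<alpha> l l) \<longlonglongrightarrow> 0" using l Y by (simp add: ip_simps)
  hence "berg_inner \<alpha> l l = 0" by (simp add: LIMSEQ_const_iff)
  hence "nrm l = 0" by (simp add: nrm_def)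
  hence "l = (\<lambda>z. 0)" by (rule nrm_eq_0[OF l])
  hence "(\<lambda>n. nrm (Y n)) \<longlonglongrightarrow> 0" using lim0 by simp
  hence sq: "(\<lambda>n. (nrm (Y n))\<^sup>2) \<longlonglongrightarrow> 0\<^sup>2" by (rule tendsto_power)
  have "e \<le> (nrm (Y n))\<^sup>2" for n
    unfolding Y_def R(2)[OF nk] nkernel_props(4)[OF z(1) b] by (rule ue)
  hence "e \<le> 0\<^sup>2" by (intro LIMSEQ_le_const[OF sq]) blast
  thus False using e by simp
qed

text \<open>By duality each R f, lying in \<open>dirichlet_space\<close>, pairs with the normalised
  kernel k to at most a constant times sqrt(1 - |\<zeta>|^2). Thus R k / sqrt(1 - |\<zeta>|^2) is
  weakly bounded, hence bounded in norm, and 1 - |u(\<zeta>)|^2 = O(1 - |\<zeta>|^2) contradicts the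
  choice of the points.\<close>

lemma subset_imp_unimodular_boundary:
  assumes u: "u holomorphic_on unit_disk" "\<forall>z\<in>unit_disk. cmod (u z) \<le> 1"
    and sub: "sub_bergman \<alpha> u \<subseteq> dirichlet_space"
  shows "unimodular_boundary u"
proof (rule ccontr)
  assume "\<not> unimodular_boundary u"
  then obtain e \<zeta> where e: "e > 0" and z: "\<And>n::nat. cmod (\<zeta> n) < 1" "\<And>n. 1 - 1 / (real n + 1) < cmod (\<zeta> n)"
    and ue: "\<And>n. e \<le> 1 - (cmod (u (\<zeta> n)))\<^sup>2" using not_unimodular_boundary_sequence by blast
  note R = defect_op_prop[OF u] and b = contraction_multiplier[OF u]
  let ?R = "defect_op \<alpha> u"
  have Rin: "?R f \<in> H" if "f \<in> H" for f using R(1) that by (simp add: pos_def bop_def lin_in)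
  have nk: "nkernel (\<zeta> n) \<in> H" for n by (rule nkernel_props(1)[OF z(1)])
  define s where "s n = sqrt (1 - (cmod (\<zeta> n))\<^sup>2)" for n
  have s: "s n > 0" "(s n)\<^sup>2 = 1 - (cmod (\<zeta> n))\<^sup>2" for n
    using z(1)[of n] power_less_one_iff[of "cmod (\<zeta> n)" 2] by (auto simp: s_def)
  define Y where "Y n = (\<lambda>z. complex_of_real (1 / s n) * ?R (nkernel (\<zeta> n)) z)" for n
  have Y: "Y n \<in> H" for n unfolding Y_def by (intro H_scale Rin nk)
  have "\<exists>C. \<forall>n. nrm (Y n) \<le> C"
  proof (rule weakly_bounded_imp_bounded[OF Y])
    fix f assume f: "f \<in> H"
    have RfD: "?R f \<in> dirichlet_space" using sub f by (auto simp: sub_bergman_def)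
    have "cmod (berg_inner \<alpha> f (Y n)) \<le> sqrt (dirichlet_sq (?R f))" for n
    proof (rule power2_le_imp_le)
      have "berg_inner \<alpha> f (Y n) = complex_of_real (1 / s n) * berg_inner \<alpha> (?R f) (nkernel (\<zeta> n))"
        unfolding Y_def ip_scale_right[OF f Rin[OF nk]] pos_selfadjoint[OF R(1) f nk] by simp
      also have "berg_inner \<alpha> (?R f) (nkernel (\<zeta> n)) = cnj (berg_inner \<alpha> (nkernel (\<zeta> n)) (?R f))"
        by (rule ip_commute[OF nk Rin[OF f]])
      finally have "(cmod (berg_inner \<alpha> f (Y n)))\<^sup>2 = (cmod (berg_inner \<alpha> (nkernel (\<zeta> n)) (?R f)))\<^sup>2 / (s n)\<^sup>2"
        by (simp add: norm_mult norm_divide power_divide)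
      also have "\<dots> \<le> (shift_form (nkernel (\<zeta> n)) * dirichlet_sq (?R f)) / (s n)\<^sup>2"
        by (intro divide_right_mono shift_form_pairing nk RfD) auto
      \<comment> \<open>The shift form of the normalised kernel is exactly (s n)^2, which cancels
        the normalisation of Y.\<close>
      also have "\<dots> = dirichlet_sq (?R f)"
        unfolding nkernel_props(4)[OF z(1) bounded_multiplier_id] s(2)[symmetric] using s(1)[of n] by simp
      finally show "(cmod (berg_inner \<alpha> f (Y n)))\<^sup>2 \<le> (sqrt (dirichlet_sq (?R f)))\<^sup>2" using dirichlet_sq_nonneg[OF RfD] by simp
    qed (simp add: dirichlet_sq_nonneg[OF RfD])
    thus "\<exists>C. \<forall>n. cmod (berg_inner \<alpha> f (Y n)) \<le> C" by blast
  qed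
  then obtain C where C: "\<And>n. nrm (Y n) \<le> C" by blast
  have low: "e * (real n + 1) / 2 \<le> C\<^sup>2" for n
  proof -
    have d: "0 < 1 - (cmod (\<zeta> n))\<^sup>2" using z(1)[of n] by (simp add: power_less_one_iff)
    have "(real n + 1) / 2 \<le> 1 / (s n)\<^sup>2"
      using boundary_sequence_sq[of \<zeta>, OF z] d unfolding s(2) by (simp add: field_simps)
    hence "e * ((real n + 1) / 2) \<le> (1 - (cmod (u (\<zeta> n)))\<^sup>2) * (1 / (s n)\<^sup>2)"
      using ue[of n] e by (intro mult_mono) auto
    also have "\<dots> = (nrm (Y n))\<^sup>2"
      unfolding Y_def nrm_scale[OF Rin[OF nk]] power_mult_distrib R(2)[OF nk] nkernel_props(4)[OF z(1) b]
      by (simp add: power_divide norm_divide)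
    also have "\<dots> \<le> C\<^sup>2" using C[of n] nrm_nonneg[OF Y] by (intro power_mono)
    finally show ?thesis by simp
  qed
  obtain n :: nat where "2 * C\<^sup>2 / e < real n" using reals_Archimedean2 by blast
  hence "C\<^sup>2 < e * (real n + 1) / 2" using e by (simp add: field_simps)
  thus False using low[of n] by simp
qed

end

section \<open>Equivalence of compactness, Blaschke form and range inclusion\<close>

theorem theorem11:
  fixes \<alpha> :: real and \<phi> :: "complex \<Rightarrow> complex" and k :: nat
  assumes "\<alpha> > -1"
    and "\<phi> holomorphic_on unit_disk"
    and "\<forall>z\<in>unit_disk. cmod (\<phi> z) \<le> 1"
    and "2 * real k + (\<alpha> - 1) > -1"
  shows "(compact_op \<alpha> (defect_op \<alpha> \<phi>) \<longleftrightarrow> finite_blaschke_product \<phi>) \<and>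
         (finite_blaschke_product \<phi> \<longleftrightarrow> sub_bergman \<alpha> \<phi> \<subseteq> A2_via k (\<alpha> - 1)) \<and>
         (\<not> unimodular_constant \<phi> \<longrightarrow>
            (sub_bergman \<alpha> \<phi> = A2_via k (\<alpha> - 1) \<longleftrightarrow> sub_bergman \<alpha> \<phi> \<subseteq> A2_via k (\<alpha> - 1)))"
proof -
  interpret bergman_weight \<alpha> by standard (rule assms(1))
  note u = assms(2,3)
  \<comment> \<open>All admissible orders describe the same space, so k disappears here.\<close>
  have VA: "A2_via k (\<alpha> - 1) = dirichlet_space" using A2_via_iff[OF assms(1,4)] by (auto simp: dirichlet_space_def)
  have fb: "finite_blaschke_product \<phi>" if "unimodular_boundary \<phi>"
    using unimodular_boundary_imp_blaschke[OF u(1) _ that] u(2) by simp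
  \<comment> \<open>The lower comparison requires at least one Moebius factor, which is guaranteed
    when \<phi> is not a unimodular constant.\<close>
  have forms: "(\<exists>C\<ge>0. \<forall>h\<in>H. defect_form \<phi> h \<le> C * shift_form h) \<and> (\<not> unimodular_constant \<phi> \<longrightarrow> (\<exists>c>0. \<forall>h\<in>H. c * shift_form h \<le> defect_form \<phi> h))"
    if B: "finite_blaschke_product \<phi>"
  proof -
    obtain c n a where B': "cmod c = 1" "\<forall>i<n::nat. a i \<in> unit_disk"
      "\<forall>z\<in>unit_disk. \<phi> z = c * (\<Prod>i<n. (a i - z) / (1 - cnj (a i) * z))"
      using B unfolding finite_blaschke_product_def by blast
    have c: "cmod c = 1" and a: "\<And>i. i < n \<Longrightarrow> cmod (a i) < 1" using B' by auto
    have \<phi>: "\<phi> z = blaschke c a n z" if "cmod z < 1" for z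
      using B'(3) that by (simp add: blaschke_def moebius_factor_def)
    have defect_form: "defect_form \<phi> h = defect_form (blaschke c a n) h" if "h \<in> H" for h
      using \<phi> by (intro defect_form_cong contraction_multiplier u blaschke_props c a that) auto
    have "n > 0" if "\<not> unimodular_constant \<phi>"
    proof (rule ccontr)
      assume "\<not> n > 0"
      hence "\<forall>z\<in>unit_disk. \<phi> z = c" using \<phi> by (simp add: blaschke_def)
      thus False using that c unfolding unimodular_constant_def by blast
    qed
    thus ?thesis using defect_form_blaschke_upper[OF c a] defect_form_blaschke_lower[OF c a] defect_form by auto
  qed
  have ab: "compact_op \<alpha> (defect_op \<alpha> \<phi>) \<longleftrightarrow> finite_blaschke_product \<phi>"
  proof
    assume "compact_op \<alpha> (defect_op \<alpha> \<phi>)"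
    thus "finite_blaschke_product \<phi>" by (intro fb compact_imp_unimodular_boundary u)
  next
    assume "finite_blaschke_product \<phi>"
    then obtain C where "C \<ge> 0" "\<And>h. h \<in> H \<Longrightarrow> defect_form \<phi> h \<le> C * shift_form h" using forms by blast
    thus "compact_op \<alpha> (defect_op \<alpha> \<phi>)"
      using defect_op_prop[OF u] by (intro compact_of_q_bound[where C = C]) (simp_all add: pos_def)
  qed
  have bd: "finite_blaschke_product \<phi> \<longleftrightarrow> sub_bergman \<alpha> \<phi> \<subseteq> dirichlet_space"
  proof
    assume "finite_blaschke_product \<phi>"
    then obtain C where C: "C \<ge> 0" "\<And>h. h \<in> H \<Longrightarrow> defect_form \<phi> h \<le> C * shift_form h" using forms by blast
    show "sub_bergman \<alpha> \<phi> \<subseteq> dirichlet_space" by (rule sub_bergman_subset_dirichlet_space[OF u C(2,1)])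
  next
    assume "sub_bergman \<alpha> \<phi> \<subseteq> dirichlet_space"
    thus "finite_blaschke_product \<phi>" by (intro fb subset_imp_unimodular_boundary u)
  qed
  \<comment> \<open>The inclusion first yields a finite Blaschke product, whose lower form bound
    then gives the reverse inclusion.\<close>
  have eq: "dirichlet_space \<subseteq> sub_bergman \<alpha> \<phi>" if nu: "\<not> unimodular_constant \<phi>" and sub: "sub_bergman \<alpha> \<phi> \<subseteq> dirichlet_space"
  proof -
    have "finite_blaschke_product \<phi>" using bd sub by blast
    then obtain c where c: "c > 0" "\<And>h. h \<in> H \<Longrightarrow> c * shift_form h \<le> defect_form \<phi> h" using forms nu by blast
    show ?thesis by (rule dirichlet_space_subset_sub_bergman[OF u c(2,1)])
  qed
  show ?thesis unfolding VA
  proof (intro conjI impI)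
    assume "\<not> unimodular_constant \<phi>"
    thus "sub_bergman \<alpha> \<phi> = dirichlet_space \<longleftrightarrow> sub_bergman \<alpha> \<phi> \<subseteq> dirichlet_space" using eq by (metis subset_antisym order_refl)
  qed (rule ab bd)+
qed

end
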